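(* Let $n\ge 2$. The action of the spin type D nilHecke algebra ${}^{D}\mathrm{NH}_n^-$ on $\mathrm{Pol}_n^-$ is faithful. One has the graded rank formulas $$\mathrm{rk}_{q,\pi}({}^{D}\mathrm{NC}_n^-)=(\pi q)^{-n(n-1)}[n]_\pi[2n-2]_\pi!!,\qquad \mathrm{rk}_{q,\pi}({}^{D}\mathrm{NH}_n^-)=\frac{(\pi q)^{-n(n-1)}[n]_\pi[2n-2]_\pi!!}{(1-\pi q^2)^n}.$$
   Context: $\mathrm{Pol}_n^-$ is the unital $\mathbb{Z}$-algebra generated by $x_1,\dots,x_n$ subject to $x_ix_j+x_jx_i=0$ for all $i\ne j$. The spin type D nilHecke algebra ${}^{D}\mathrm{NH}_n^-$ is the unital $\mathbb{Z}$-algebra generated by $x_1,\dots,x_n$, $\partial_1^-,\dots,\partial_{n-1}^-$, $\partial_n^D$ subject to $x_ix_j+x_jx_i=0$ ($i\neq j$) and, for $1\le i\le n-1$ (whenever the indices make sense): $(\partial_i^-)^2=0$; $\partial_i^-\partial_{i+1}^-\partial_i^-=\partial_{i+1}^-\partial_i^-\partial_{i+1}^-$; $\partial_i^-\partial_j^-+\partial_j^-\partial_i^-=0$ for $|i-j|>1$; $x_i\partial_i^-+\partial_i^-x_{i+1}=1$; $\partial_i^-x_i+x_{i+1}\partial_i^-=1$; $\partial_i^-x_j+x_j\partial_i^-=0$ for $j\ne i,i+1$; and $(\partial_n^D)^2=0$; $\partial_n^D\partial_{n-2}^-\partial_n^D=\partial_{n-2}^-\partial_n^D\partial_{n-2}^-$;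 $\partial_n^D\partial_i^-+\partial_i^-\partial_n^D=0$ for $1\le i\le n-3$; $\partial_n^D\partial_{n-1}^--\partial_{n-1}^-\partial_n^D=0$; $x_{n-1}\partial_n^D-\partial_n^Dx_n=1$; $\partial_n^Dx_{n-1}-x_n\partial_n^D=1$; $\partial_n^Dx_i+x_i\partial_n^D=0$ for $1\le i\le n-2$. The spin type D nilCoxeter algebra ${}^{D}\mathrm{NC}_n^-$ is its subalgebra generated by $\partial_1^-,\dots,\partial_{n-1}^-,\partial_n^D$. The algebra is $\mathbb{Z}$-graded by $|x_i|=2$, $|\partial_i^-|=|\partial_n^D|=-2$, and $\mathbb{Z}_2$-graded by declaring all generators to have parity $p=1$. It acts on $\mathrm{Pol}_n^-$ as follows. The $x_i$ act by left multiplication. For $1\le i\le n-1$ let $s_i$ be the algebra endomorphism of $\mathrm{Pol}_n^-$ with $s_i(x_i)=-x_{i+1}$, $s_i(x_{i+1})=-x_i$, $s_i(x_j)=-x_j$ for $j\ne i,i+1$, and let $s_n^D$ be the algebra endomorphism with $s_n^D(x_n)=x_{n-1}$, $s_n^D(x_{n-1})=x_n$, $s_n^D(x_j)=-x_j$ for $j\le n-2$. Then $\partial_i^-$ and $\partial_n^D$ act as the $\mathbb{Z}$-linear operators that kill $1$ and satisfy: $\partial_i^-(x_j)=1$ if $j\in\{i,i+1\}$ and $0$ otherwise; $\partial_n^D(x_n)=-1$, $\partial_n^D(x_{n-1})=1$, $\partial_n^D(x_j)=0$ for $j\le n-2$; $\partial_i^-(fg)=\partial_i^-(f)g+s_i(f)\partial_i^-(g)$,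 $\partial_n^D(fg)=\partial_n^D(f)g+s_n^D(f)\partial_n^D(g)$. For a $\mathbb{Z}\times\mathbb{Z}_2$-graded algebra $A$ with homogeneous $\mathbb{Z}$-basis $\mathfrak B$, $\mathrm{rk}_{q,\pi}(A)=\sum_{b\in\mathfrak B}q^{|b|}\pi^{p(b)}$, where $\pi^2=1$. Also $[m]_\pi=\frac{\pi^mq^m-q^{-m}}{\pi q-q^{-1}}$ and $[2n-2]_\pi!!=[2n-2]_\pi[2n-4]_\pi\cdots[4]_\pi[2]_\pi$. *)

theory Defs
  imports
    "HOL-Library.Poly_Mapping"
    "HOL-Library.Z2"
    "HOL-Computational_Algebra.Formal_Laurent_Series"
    "HOL-Algebra.QuotRing"
    "HOL-Algebra.Generated_Rings"
begin

section \<open>Unital rings given by generators and relations\<close>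

text \<open>
  The free unital \<open>\<int>\<close>-algebra is the monoid ring of the free monoid, so that its elements are
  finitely supported integer functions on words with the convolution product of
  \<^theory>\<open>HOL-Library.Poly_Mapping\<close>; the wrapper type makes concatenation available as the
  \<open>+\<close> required there.
\<close>

datatype 'g fword = Word (letters: "'g list")

instantiation fword :: (type) monoid_add
begin

definition zero_fword :: "'a fword" where "0 = Word []"

definition plus_fword :: "'a fword \<Rightarrow> 'a fword \<Rightarrow> 'a fword"
  where "u + v = Word (letters u @ letters v)"

instance
  by standard (simp_all add: zero_fword_def plus_fword_def)

end

type_synonym 'g fpoly = "'g fword \<Rightarrow>\<^sub>0 int"

definition fvar :: "'g \<Rightarrow> 'g fpoly"
  where "fvar g = Poly_Mapping.single (Word [g]) 1"

definition free_ring :: "'g set \<Rightarrow> 'g fpoly ring"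
  where "free_ring G =
    \<lparr>carrier = {f. \<forall>w\<in>Poly_Mapping.keys f. set (letters w) \<subseteq> G}, mult = (*), one = 1, zero = 0, add = (+)\<rparr>"

lemma fvar_in_free_ring: "g \<in> G \<Longrightarrow> fvar g \<in> carrier (free_ring G)"
  by (simp add: free_ring_def fvar_def)

lemma ring_free_ring: "ring (free_ring G)"
proof -
  have plus: "f + g \<in> carrier (free_ring G)"
    if "f \<in> carrier (free_ring G)" "g \<in> carrier (free_ring G)" for f g
    using that Poly_Mapping.keys_add[of f g] by (auto simp: free_ring_def)
  have times: "f * g \<in> carrier (free_ring G)"
    if "f \<in> carrier (free_ring G)" "g \<in> carrier (free_ring G)" for f g
  proof -
    have "set (letters w) \<subseteq> G" if w: "w \<in> Poly_Mapping.keys (f * g)" for w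
    proof -
      obtain a b where "w = a + b" "a \<in> Poly_Mapping.keys f" "b \<in> Poly_Mapping.keys g"
        using w keys_mult[of f g] by blast
      then show ?thesis
        using \<open>f \<in> carrier (free_ring G)\<close> \<open>g \<in> carrier (free_ring G)\<close>
        by (auto simp: free_ring_def plus_fword_def)
    qed
    then show ?thesis by (auto simp: free_ring_def)
  qed
  have one: "1 \<in> carrier (free_ring G)"
    by (auto simp: free_ring_def zero_fword_def simp flip: single_one)
  have neg: "\<exists>y\<in>carrier (free_ring G). y + f = 0" if "f \<in> carrier (free_ring G)" for f
    using that by (intro bexI[of _ "- f"]) (auto simp: free_ring_def)
  have sel: "add (free_ring G) = (+)" "mult (free_ring G) = (*)" "zero (free_ring G) = 0"
    "one (free_ring G) = 1"
    by (simp_all add: free_ring_def)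
  have zero: "0 \<in> carrier (free_ring G)"
    by (simp add: free_ring_def)
  show ?thesis
  proof (rule ringI)
    show "abelian_group (free_ring G)"
      by (rule abelian_groupI; (unfold sel)?;
        (rule plus neg zero add.assoc add.commute add_0_left; assumption?)?)
    show "Group.monoid (free_ring G)"
      by (rule monoidI; (unfold sel)?;
        (rule times one mult.assoc mult_1_left mult_1_right; assumption?)?)
  qed (unfold sel, (rule distrib_right distrib_left)+)
qed

text \<open>\<open>G\<close> are the generators; a relation \<open>l = r\<close> is represented by the relator \<open>l - r\<close>.\<close>

definition presented_ring :: "'g set \<Rightarrow> 'g fpoly set \<Rightarrow> 'g fpoly set ring"
  where "presented_ring G R = free_ring G Quot (genideal (free_ring G) R)"

definition presented_class :: "'g set \<Rightarrow> 'g fpoly set \<Rightarrow> 'g fpoly \<Rightarrow> 'g fpoly set"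
  where "presented_class G R f = genideal (free_ring G) R +>\<^bsub>free_ring G\<^esub> f"

lemma ring_presented_ring:
  assumes "R \<subseteq> carrier (free_ring G)"
  shows "ring (presented_ring G R)"
  unfolding presented_ring_def
  by (rule ideal.quotient_is_ring[OF ring.genideal_ideal[OF ring_free_ring assms]])

text \<open>
  The grading by \<open>\<int> \<times> \<int>\<^sub>2\<close> of a presented ring in which every generator \<open>g\<close> has degree
  \<open>gdeg g\<close> and parity \<open>1\<close>: the component of bidegree \<open>(d, p)\<close> is spanned by the classes of the
  words of degree \<open>d\<close> and parity \<open>p\<close>.
\<close>

definition presented_component ::
    "'g set \<Rightarrow> 'g fpoly set \<Rightarrow> ('g \<Rightarrow> int) \<Rightarrow> int \<Rightarrow> bit \<Rightarrow> 'g fpoly set set"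
  where "presented_component G R gdeg d p =
    presented_class G R ` {f \<in> carrier (free_ring G).
      \<forall>w\<in>Poly_Mapping.keys f. sum_list (map gdeg (letters w)) = d \<and> of_nat (length (letters w)) = p}"


section \<open>Skew polynomials\<close>

definition pol_relators :: "nat \<Rightarrow> nat fpoly set"
  where "pol_relators n =
    {fvar i * fvar j + fvar j * fvar i | i j. i \<in> {1..n} \<and> j \<in> {1..n} \<and> i \<noteq> j}"

definition Pol :: "nat \<Rightarrow> nat fpoly set ring"
  where "Pol n = presented_ring {1..n} (pol_relators n)"

definition pol_x :: "nat \<Rightarrow> nat \<Rightarrow> nat fpoly set"
  where "pol_x n i = presented_class {1..n} (pol_relators n) (fvar i)"


section \<open>The spin type D nilHecke and nilCoxeter algebras\<close>

text \<open>\<open>X i\<close>, \<open>Del i\<close> and \<open>DelD\<close> stand for \<open>x\<^sub>i\<close>, \<open>\<partial>\<^sub>i\<^sup>-\<close> and \<open>\<partial>\<^sub>n\<^sup>D\<close>.\<close>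

datatype nh_gen = X nat | Del nat | DelD

definition nh_gens :: "nat \<Rightarrow> nh_gen set"
  where "nh_gens n = X ` {1..n} \<union> Del ` {1..n - 1} \<union> {DelD}"

abbreviation xg where "xg i \<equiv> fvar (X i)"
abbreviation dg where "dg i \<equiv> fvar (Del i)"
abbreviation dD where "dD \<equiv> fvar DelD"

inductive_set nh_relators :: "nat \<Rightarrow> nh_gen fpoly set" for n :: nat
  where
  x_x: "\<lbrakk>i \<in> {1..n}; j \<in> {1..n}; i \<noteq> j\<rbrakk> \<Longrightarrow> xg i * xg j + xg j * xg i \<in> nh_relators n"
| del_sq: "i \<in> {1..n-1} \<Longrightarrow> dg i * dg i \<in> nh_relators n"
| del_braid: "\<lbrakk>i \<in> {1..n-1}; i + 1 \<in> {1..n-1}\<rbrakk> \<Longrightarrow>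
    dg i * dg (i+1) * dg i - dg (i+1) * dg i * dg (i+1) \<in> nh_relators n"
| del_far: "\<lbrakk>i \<in> {1..n-1}; j \<in> {1..n-1}; i + 1 < j \<or> j + 1 < i\<rbrakk> \<Longrightarrow>
    dg i * dg j + dg j * dg i \<in> nh_relators n"
| x_del: "i \<in> {1..n-1} \<Longrightarrow> xg i * dg i + dg i * xg (i+1) - 1 \<in> nh_relators n"
| del_x: "i \<in> {1..n-1} \<Longrightarrow> dg i * xg i + xg (i+1) * dg i - 1 \<in> nh_relators n"
| del_x_far: "\<lbrakk>i \<in> {1..n-1}; j \<in> {1..n}; j \<noteq> i; j \<noteq> i + 1\<rbrakk> \<Longrightarrow>
    dg i * xg j + xg j * dg i \<in> nh_relators n"
| delD_sq: "dD * dD \<in> nh_relators n"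
| delD_braid: "n \<ge> 3 \<Longrightarrow>
    dD * dg (n-2) * dD - dg (n-2) * dD * dg (n-2) \<in> nh_relators n"
| delD_far: "\<lbrakk>1 \<le> i; i + 3 \<le> n\<rbrakk> \<Longrightarrow> dD * dg i + dg i * dD \<in> nh_relators n"
| delD_comm: "dD * dg (n-1) - dg (n-1) * dD \<in> nh_relators n"
| x_delD: "xg (n-1) * dD - dD * xg n - 1 \<in> nh_relators n"
| delD_x: "dD * xg (n-1) - xg n * dD - 1 \<in> nh_relators n"
| delD_x_far: "\<lbrakk>1 \<le> i; i + 2 \<le> n\<rbrakk> \<Longrightarrow> dD * xg i + xg i * dD \<in> nh_relators n"

definition NH :: "nat \<Rightarrow> nh_gen fpoly set ring"
  where "NH n = presented_ring (nh_gens n) (nh_relators n)"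

definition nh_class :: "nat \<Rightarrow> nh_gen \<Rightarrow> nh_gen fpoly set"
  where "nh_class n g = presented_class (nh_gens n) (nh_relators n) (fvar g)"

definition NC :: "nat \<Rightarrow> nh_gen fpoly set ring"
  where "NC n = (NH n)\<lparr>carrier :=
    generate_ring (NH n) (nh_class n ` (Del ` {1..n - 1} \<union> {DelD}))\<rparr>"

primrec gen_deg :: "nh_gen \<Rightarrow> int"
  where
  "gen_deg (X i) = 2"
| "gen_deg (Del i) = -2"
| "gen_deg DelD = -2"

definition NH_component :: "nat \<Rightarrow> int \<Rightarrow> bit \<Rightarrow> nh_gen fpoly set set"
  where "NH_component n = presented_component (nh_gens n) (nh_relators n) gen_deg"

definition NC_component :: "nat \<Rightarrow> int \<Rightarrow> bit \<Rightarrow> nh_gen fpoly set set"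
  where "NC_component n d p = NH_component n d p \<inter> carrier (NC n)"

lemma nh_relators_subset:
  assumes "n \<ge> 2"
  shows "nh_relators n \<subseteq> carrier (free_ring (nh_gens n))"
proof
  let ?C = "carrier (free_ring (nh_gens n))"
  interpret ring "free_ring (nh_gens n)" by (rule ring_free_ring)
  have plus: "f + g \<in> ?C" if "f \<in> ?C" "g \<in> ?C" for f g
    using add.m_closed[OF that] by (simp add: free_ring_def)
  have times: "f * g \<in> ?C" if "f \<in> ?C" "g \<in> ?C" for f g
    using m_closed[OF that] by (simp add: free_ring_def)
  have neg: "- f \<in> ?C" if "f \<in> ?C" for f
    using that by (simp add: free_ring_def)
  have minus: "f - g \<in> ?C" if "f \<in> ?C" "g \<in> ?C" for f g
    using plus[OF that(1) neg[OF that(2)]] by simp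
  have one: "1 \<in> ?C"
    using one_closed by (simp add: free_ring_def)
  have X: "xg i \<in> ?C" if "1 \<le> i" "i \<le> n" for i
    using that by (intro fvar_in_free_ring) (auto simp: nh_gens_def)
  have D: "dg i \<in> ?C" if "1 \<le> i" "i \<le> n - 1" for i
    using that by (intro fvar_in_free_ring) (auto simp: nh_gens_def)
  have DD: "dD \<in> ?C"
    by (intro fvar_in_free_ring) (auto simp: nh_gens_def)
  fix r assume "r \<in> nh_relators n"
  then show "r \<in> ?C"
    using assms by cases (auto intro!: plus times minus one X D DD)
qed

lemma ring_NH: "n \<ge> 2 \<Longrightarrow> ring (NH n)"
  unfolding NH_def by (intro ring_presented_ring nh_relators_subset)

lemma ring_NC:
  assumes "n \<ge> 2"
  shows "ring (NC n)"
proof -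
  interpret ring "NH n" by (rule ring_NH[OF assms])
  have "g \<in> nh_gens n \<Longrightarrow> nh_class n g \<in> carrier (NH n)" for g
    using ideal.rcos_ring_hom[OF ring.genideal_ideal[OF ring_free_ring nh_relators_subset[OF assms]]]
    by (auto simp: nh_class_def presented_class_def NH_def presented_ring_def
        dest: ring_hom_closed[OF _ fvar_in_free_ring])
  then have "nh_class n ` (Del ` {1..n - 1} \<union> {DelD}) \<subseteq> carrier (NH n)"
    by (auto simp: nh_gens_def)
  from generate_ring_is_subring[OF this] show ?thesis
    unfolding NC_def by (rule subring_is_ring)
qed

lemma ring_Pol: "ring (Pol n)"
proof -
  interpret ring "free_ring {1..n}" by (rule ring_free_ring)
  have "fvar i * fvar j + fvar j * fvar i \<in> carrier (free_ring {1..n})"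
    if "i \<in> {1..n}" "j \<in> {1..n}" for i j
  proof -
    have "fvar i \<in> carrier (free_ring {1..n})" "fvar j \<in> carrier (free_ring {1..n})"
      using that by (auto intro: fvar_in_free_ring)
    from add.m_closed[OF m_closed[OF this] m_closed[OF this(2,1)]]
    show ?thesis by (simp add: free_ring_def)
  qed
  then have "pol_relators n \<subseteq> carrier (free_ring {1..n})"
    unfolding pol_relators_def by blast
  then show ?thesis
    unfolding Pol_def by (rule ring_presented_ring)
qed


section \<open>The action on skew polynomials\<close>

definition ring_action ::
    "('a, 'c) ring_scheme \<Rightarrow> ('b, 'd) ring_scheme \<Rightarrow> ('a \<Rightarrow> 'b \<Rightarrow> 'b) \<Rightarrow> bool"
  where "ring_action A M act \<longleftrightarrow>
    (\<forall>a\<in>carrier A. \<forall>f\<in>carrier M. act a f \<in> carrier M) \<and>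
    (\<forall>a\<in>carrier A. \<forall>f\<in>carrier M. \<forall>g\<in>carrier M. act a (f \<oplus>\<^bsub>M\<^esub> g) = act a f \<oplus>\<^bsub>M\<^esub> act a g) \<and>
    (\<forall>a\<in>carrier A. \<forall>b\<in>carrier A. \<forall>f\<in>carrier M. act (a \<oplus>\<^bsub>A\<^esub> b) f = act a f \<oplus>\<^bsub>M\<^esub> act b f) \<and>
    (\<forall>a\<in>carrier A. \<forall>b\<in>carrier A. \<forall>f\<in>carrier M. act (a \<otimes>\<^bsub>A\<^esub> b) f = act a (act b f)) \<and>
    (\<forall>f\<in>carrier M. act \<one>\<^bsub>A\<^esub> f = f)"

definition faithful_action ::
    "('a, 'c) ring_scheme \<Rightarrow> ('b, 'd) ring_scheme \<Rightarrow> ('a \<Rightarrow> 'b \<Rightarrow> 'b) \<Rightarrow> bool"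
  where "faithful_action A M act \<longleftrightarrow>
    (\<forall>a\<in>carrier A. (\<forall>f\<in>carrier M. act a f = \<zero>\<^bsub>M\<^esub>) \<longrightarrow> a = \<zero>\<^bsub>A\<^esub>)"

text \<open>\<open>\<int>\<close>-linear is the same as additive.\<close>

definition twisted_derivation :: "('b, 'd) ring_scheme \<Rightarrow> ('b \<Rightarrow> 'b) \<Rightarrow> ('b \<Rightarrow> 'b) \<Rightarrow> bool"
  where "twisted_derivation P s d \<longleftrightarrow>
    (\<forall>f\<in>carrier P. d f \<in> carrier P) \<and>
    (\<forall>f\<in>carrier P. \<forall>g\<in>carrier P. d (f \<oplus>\<^bsub>P\<^esub> g) = d f \<oplus>\<^bsub>P\<^esub> d g) \<and>
    (\<forall>f\<in>carrier P. \<forall>g\<in>carrier P. d (f \<otimes>\<^bsub>P\<^esub> g) = d f \<otimes>\<^bsub>P\<^esub> g \<oplus>\<^bsub>P\<^esub> s f \<otimes>\<^bsub>P\<^esub> d g)"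

definition is_s :: "nat \<Rightarrow> nat \<Rightarrow> (nat fpoly set \<Rightarrow> nat fpoly set) \<Rightarrow> bool"
  where "is_s n i s \<longleftrightarrow> s \<in> ring_hom (Pol n) (Pol n) \<and>
    s (pol_x n i) = \<ominus>\<^bsub>Pol n\<^esub> pol_x n (i+1) \<and>
    s (pol_x n (i+1)) = \<ominus>\<^bsub>Pol n\<^esub> pol_x n i \<and>
    (\<forall>j\<in>{1..n} - {i, i+1}. s (pol_x n j) = \<ominus>\<^bsub>Pol n\<^esub> pol_x n j)"

definition is_sD :: "nat \<Rightarrow> (nat fpoly set \<Rightarrow> nat fpoly set) \<Rightarrow> bool"
  where "is_sD n s \<longleftrightarrow> s \<in> ring_hom (Pol n) (Pol n) \<and>
    s (pol_x n n) = pol_x n (n-1) \<and>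
    s (pol_x n (n-1)) = pol_x n n \<and>
    (\<forall>j\<in>{1..n} - {n-1, n}. s (pol_x n j) = \<ominus>\<^bsub>Pol n\<^esub> pol_x n j)"

definition is_del :: "nat \<Rightarrow> nat \<Rightarrow> (nat fpoly set \<Rightarrow> nat fpoly set) \<Rightarrow> bool"
  where "is_del n i d \<longleftrightarrow>
    (\<exists>s. is_s n i s \<and> twisted_derivation (Pol n) s d) \<and>
    d \<one>\<^bsub>Pol n\<^esub> = \<zero>\<^bsub>Pol n\<^esub> \<and>
    (\<forall>j\<in>{1..n}. d (pol_x n j) = (if j \<in> {i, i+1} then \<one>\<^bsub>Pol n\<^esub> else \<zero>\<^bsub>Pol n\<^esub>))"

definition is_delD :: "nat \<Rightarrow> (nat fpoly set \<Rightarrow> nat fpoly set) \<Rightarrow> bool"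
  where "is_delD n d \<longleftrightarrow>
    (\<exists>s. is_sD n s \<and> twisted_derivation (Pol n) s d) \<and>
    d \<one>\<^bsub>Pol n\<^esub> = \<zero>\<^bsub>Pol n\<^esub> \<and>
    d (pol_x n n) = \<ominus>\<^bsub>Pol n\<^esub> \<one>\<^bsub>Pol n\<^esub> \<and>
    d (pol_x n (n-1)) = \<one>\<^bsub>Pol n\<^esub> \<and>
    (\<forall>j\<in>{1..n} - {n-1, n}. d (pol_x n j) = \<zero>\<^bsub>Pol n\<^esub>)"

text \<open>These conditions determine \<open>act\<close> on \<open>carrier (NH n) \<times> carrier (Pol n)\<close>.\<close>

definition NH_action :: "nat \<Rightarrow> (nh_gen fpoly set \<Rightarrow> nat fpoly set \<Rightarrow> nat fpoly set) \<Rightarrow> bool"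
  where "NH_action n act \<longleftrightarrow>
    ring_action (NH n) (Pol n) act \<and>
    (\<forall>i\<in>{1..n}. \<forall>f\<in>carrier (Pol n). act (nh_class n (X i)) f = pol_x n i \<otimes>\<^bsub>Pol n\<^esub> f) \<and>
    (\<forall>i\<in>{1..n-1}. is_del n i (act (nh_class n (Del i)))) \<and>
    is_delD n (act (nh_class n DelD))"


section \<open>Graded rank\<close>

text \<open>
  \<open>\<int>\<close>-bases: every element is an integer combination of \<open>B\<close>, with unique finitely supported
  coefficients.
\<close>

definition int_basis :: "('a, 'c) ring_scheme \<Rightarrow> 'a set \<Rightarrow> bool"
  where "int_basis A B \<longleftrightarrow> B \<subseteq> carrier A \<and>
    (\<forall>a\<in>carrier A. \<exists>!c :: 'a \<Rightarrow>\<^sub>0 int.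
      Poly_Mapping.keys c \<subseteq> B \<and> a = (\<Oplus>\<^bsub>A\<^esub>b\<in>Poly_Mapping.keys c. [Poly_Mapping.lookup c b] \<cdot>\<^bsub>A\<^esub> b))"

definition homogeneous_basis ::
    "('a, 'c) ring_scheme \<Rightarrow> (int \<Rightarrow> bit \<Rightarrow> 'a set) \<Rightarrow> 'a set \<Rightarrow> bool"
  where "homogeneous_basis A C B \<longleftrightarrow> int_basis A B \<and> (\<forall>b\<in>B. \<exists>d p. b \<in> C d p)"

text \<open>
  Graded ranks are Laurent series in \<open>q\<close> over \<open>\<int>[\<pi>]/(\<pi>\<^sup>2 - 1)\<close>. The coefficient ring is
  encoded as the group ring of \<open>\<int>\<^sub>2\<close> (the additive group of \<^typ>\<open>bit\<close>), the group
  element \<open>1\<close> being \<open>\<pi>\<close>.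
\<close>

type_synonym qpi = "(bit \<Rightarrow>\<^sub>0 int) fls"

abbreviation qv :: qpi where "qv \<equiv> fls_X"

definition \<pi> :: qpi
  where "\<pi> = fls_const (Poly_Mapping.single 1 1)"

lemma \<pi>_square: "\<pi> * \<pi> = 1"
  by (simp add: \<pi>_def mult_single)

text \<open>
  The series \<open>F\<close> equals the sum of \<open>q\<^sup>d \<pi>\<^sup>p\<close> over the elements of a homogeneous basis, which
  exists and may be chosen arbitrarily; \<open>d\<close> and \<open>p\<close> denote the degree and parity of the basis
  element.
\<close>

definition has_graded_rank ::
    "('a, 'c) ring_scheme \<Rightarrow> (int \<Rightarrow> bit \<Rightarrow> 'a set) \<Rightarrow> qpi \<Rightarrow> bool"
  where "has_graded_rank A C F \<longleftrightarrow>
    (\<exists>B. homogeneous_basis A C B) \<and>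
    (\<forall>B. homogeneous_basis A C B \<longrightarrow>
      (\<forall>d p. finite (B \<inter> C d p) \<and> Poly_Mapping.lookup (fls_nth F d) p = int (card (B \<inter> C d p))))"

text \<open>
  Division in \<^typ>\<open>qpi\<close>, whose coefficient ring is not a field: \<open>a / b\<close> is rendered as
  \<open>a * unit_inv b\<close>, which is only used for the units below.
\<close>

definition unit_inv :: "'a::comm_ring_1 \<Rightarrow> 'a"
  where "unit_inv b = (THE c. b * c = 1)"

lemma unit_inv_right:
  fixes b :: "'a::comm_ring_1"
  assumes "b dvd 1"
  shows "b * unit_inv b = 1"
proof -
  obtain c where c: "b * c = 1" using assms by (metis dvdE)
  have "\<exists>!c. b * c = 1"
  proof (rule ex1I[where a = c])
    show "b * c = 1" by (rule c)
  next
    fix c' assume c': "b * c' = 1"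
    have "c' = (b * c) * c'" by (simp add: c)
    also have "\<dots> = (b * c') * c" by (simp add: ac_simps)
    finally show "c' = c" by (simp add: c')
  qed
  then show ?thesis unfolding unit_inv_def by (rule theI')
qed

lemma unit_qv: "qv dvd 1"
  by (rule dvdI[of _ _ fls_X_inv]) (simp add: fls_X_times_conv_shift)

lemma unit_inv_qv: "unit_inv qv = fls_X_inv"
proof -
  have "unit_inv qv = (fls_X_inv * qv) * unit_inv qv"
    by (simp add: fls_X_times_conv_shift)
  also have "\<dots> = fls_X_inv"
    using unit_inv_right[OF unit_qv] by (simp add: mult.assoc)
  finally show ?thesis .
qed

lemma unit_\<pi>_qv: "\<pi> * qv dvd 1"
  using mult_dvd_mono[of \<pi> 1 qv 1] unit_qv dvdI[OF \<pi>_square[symmetric]] by simp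

lemma unit_1_minus_\<pi>_qv2: "1 - \<pi> * qv\<^sup>2 dvd 1"
proof -
  let ?f = "1 - \<pi> * qv\<^sup>2"
  have nth: "fls_nth ?f k = (if k = 0 then 1 else if k = 2 then - Poly_Mapping.single 1 1 else 0)" for k
    by (simp add: \<pi>_def fls_X_power_nth)
  have sub: "fls_subdegree ?f = 0"
    by (rule fls_subdegree_eqI; simp only: nth; simp)
  have "?f * fls_right_inverse ?f 1 = 1"
    by (rule fls_right_inverse) (simp only: sub nth, simp)
  then show ?thesis by (metis dvdI)
qed

lemma unit_\<pi>_qv_minus_qv_inv: "\<pi> * qv - unit_inv qv dvd 1"
proof -
  have X: "qv * fls_X_inv = 1"
    by (simp add: fls_X_times_conv_shift)
  have "\<pi> * qv - unit_inv qv = (- fls_X_inv) * (1 - \<pi> * qv\<^sup>2)"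
  proof -
    have "fls_X_inv * (\<pi> * qv\<^sup>2) = \<pi> * qv * (qv * fls_X_inv)"
      by (simp only: power2_eq_square ac_simps)
    then show ?thesis
      by (simp add: X unit_inv_qv right_diff_distrib)
  qed
  moreover have "- fls_X_inv dvd (1 :: qpi)"
    by (rule dvdI[of _ _ "- qv"]) (use X in \<open>simp add: ac_simps\<close>)
  ultimately show ?thesis
    using mult_dvd_mono[OF _ unit_1_minus_\<pi>_qv2, of "- fls_X_inv" 1] by simp
qed

definition qint :: "nat \<Rightarrow> qpi"
  where "qint m = ((\<pi> * qv) ^ m - unit_inv qv ^ m) * unit_inv (\<pi> * qv - unit_inv qv)"

text \<open>\<open>qdfact m\<close> is \<open>[2m]\<^sub>\<pi>!! = [2m]\<^sub>\<pi> \<cdots> [4]\<^sub>\<pi> [2]\<^sub>\<pi>\<close>.\<close>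

definition qdfact :: "nat \<Rightarrow> qpi"
  where "qdfact m = (\<Prod>k=1..m. qint (2 * k))"

end

theory Submission
  imports Defs "HOL-Library.Product_Plus"
begin

text \<open>
  Write \<open>D\<close> for \<open>\<partial>\<^sub>n\<^sup>D\<close>. The diagram nodes \<open>k, \<dots>, n-1, D\<close> span a subdiagram of type \<open>D\<close> and rank
  \<open>n-k+1\<close>; call the subalgebra generated by their operators level \<open>k\<close>. The minimal representatives of
  the cosets of level \<open>k+1\<close> in level \<open>k\<close> are the \<open>2(n-k+1)\<close> words, called chains below, that carry the
  vector \<open>e\<^sub>k\<close> to the vectors \<open>\<plusminus>e\<^sub>j\<close> with \<open>j \<ge> k\<close>. Multiplying a chain from the left by a generator
  of level \<open>k\<close> gives, up to sign, zero, a longer chain, or the same chain times a generator of level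
  \<open>k+1\<close> (lemma \<open>chain_step\<close>). Hence products of one chain from every level span the nilCoxeter algebra,
  and since every \<open>x\<^sub>i\<close> can be moved to the left past the \<open>\<partial>\<close>'s, monomials times such products span the
  nilHecke algebra (lemma \<open>spanning_word\<close>). The argument never leaves a given bidegree.

  These normal words are independent because they act independently on skew polynomials. In a
  relation consider the shortest products \<open>u\<close> of chains that occur, of length \<open>l\<close> say, and apply the
  relation to a polynomial of degree \<open>l\<close>: longer products kill it and those of length \<open>l\<close> send it to
  a constant. So it suffices that the functionals \<open>g \<mapsto> \<epsilon>(u g)\<close> are independent, where \<open>\<epsilon>\<close> is the
  constant term. This is proved by induction on the level. An element \<open>e\<close> killed by all generators of
  level \<open>k+1\<close> can be pulled out on the right, \<open>u(g e) = u(g) e\<close>, so on test polynomials \<open>g e\<close> the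
  matrix of functionals becomes block triangular, with blocks \<open>\<epsilon>(c e)\<close> for chains \<open>c\<close> of level \<open>k\<close>. With
  \<open>e = x\<^sub>k\<^sup>j\<close> this settles every degree with a single chain; in degree \<open>n-k\<close> there are two chains, which
  are separated by the additional Euler class \<open>e = x\<^sub>k\<^sub>+\<^sub>1 \<cdots> x\<^sub>n\<close>
  (lemma \<open>chain_functionals_independent\<close>). The values \<open>\<epsilon>(c x\<^sub>k\<^sup>j)\<close> are computed by recursion on the level;
  they are \<open>\<plusminus>1\<close> or \<open>\<plusminus>2\<close>, and all that matters is that these are nonzero integers.
  The outcome is \<open>normal_form_faithful\<close>: a combination of normal words that acts as zero is zero. Together
  with spanning it gives both faithfulness and bases.

  For the ranks, an arbitrary homogeneous basis is compared with the basis of normal words by a trace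
  argument (lemma \<open>graded_rank\<close>). With \<open>t = \<pi>q\<^sup>-\<^sup>2\<close>, the chains of level \<open>k\<close> contribute the factor
  \<open>(1 + t\<^sup>n\<^sup>-\<^sup>k)(1 + t + \<cdots> + t\<^sup>n\<^sup>-\<^sup>k)\<close>, and the product over all levels is the stated product of
  \<open>\<pi>\<close>-integers.
\<close>

section \<open>Free rings and two-sided ideals\<close>

abbreviation (input) keys where "keys \<equiv> Poly_Mapping.keys"
abbreviation (input) lookup where "lookup \<equiv> Poly_Mapping.lookup"
abbreviation (input) single where "single \<equiv> Poly_Mapping.single"

abbreviation mon :: "'g list \<Rightarrow> 'g fpoly"
  where "mon w \<equiv> frag_of (Word w)"

lemma mon_Nil: "mon [] = 1"
  by (simp add: zero_fword_def flip: single_one)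

lemma mon_append: "mon (u @ v) = mon u * mon v"
  by (simp add: mult_single plus_fword_def)

lemma fvar_eq_mon: "fvar g = mon [g]"
  by (simp add: fvar_def)

lemma mon_Cons: "mon (g # w) = fvar g * mon w"
  by (simp add: fvar_def mult_single plus_fword_def)

lemma mon_in_free_ring: "mon w \<in> carrier (free_ring G) \<longleftrightarrow> set w \<subseteq> G"
  by (simp add: free_ring_def)

lemma of_int_times_frag:
  fixes f :: "'a::monoid_add \<Rightarrow>\<^sub>0 int"
  shows "of_int c * f = frag_cmul c f"
  by (rule poly_mapping_eqI) (simp add: flip: single_of_int mult_map_scale_conv_mult add: Poly_Mapping.map.rep_eq when_def)

lemma free_ring_simps [simp]:
  "add (free_ring G) = (+)" "mult (free_ring G) = (*)" "zero (free_ring G) = 0" "one (free_ring G) = 1"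
  by (simp_all add: free_ring_def)

lemma free_ring_closed:
  "0 \<in> carrier (free_ring G)" "1 \<in> carrier (free_ring G)"
  "f \<in> carrier (free_ring G) \<Longrightarrow> g \<in> carrier (free_ring G) \<Longrightarrow> f + g \<in> carrier (free_ring G)"
  "f \<in> carrier (free_ring G) \<Longrightarrow> g \<in> carrier (free_ring G) \<Longrightarrow> f * g \<in> carrier (free_ring G)"
  "f \<in> carrier (free_ring G) \<Longrightarrow> - f \<in> carrier (free_ring G)"
  "f \<in> carrier (free_ring G) \<Longrightarrow> g \<in> carrier (free_ring G) \<Longrightarrow> f - g \<in> carrier (free_ring G)"
proof -
  interpret R: ring "free_ring G" by (rule ring_free_ring)
  show z: "0 \<in> carrier (free_ring G)" "1 \<in> carrier (free_ring G)"
    using R.zero_closed R.one_closed by simp_all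
  show a: "f \<in> carrier (free_ring G) \<Longrightarrow> g \<in> carrier (free_ring G) \<Longrightarrow> f + g \<in> carrier (free_ring G)" for f g
    using R.add.m_closed[of f g] by simp
  show "f \<in> carrier (free_ring G) \<Longrightarrow> g \<in> carrier (free_ring G) \<Longrightarrow> f * g \<in> carrier (free_ring G)"
    using R.m_closed[of f g] by simp
  show n: "f \<in> carrier (free_ring G) \<Longrightarrow> - f \<in> carrier (free_ring G)" for f
    by (simp add: free_ring_def)
  show "f \<in> carrier (free_ring G) \<Longrightarrow> g \<in> carrier (free_ring G) \<Longrightarrow> f - g \<in> carrier (free_ring G)"
    using a[OF _ n] by simp
qed

lemma free_ring_induct [consumes 1, case_names zero mon diff]:
  assumes "f \<in> carrier (free_ring G)" "P 0"
    "\<And>w. set w \<subseteq> G \<Longrightarrow> P (mon w)"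
    "\<And>f g. f \<in> carrier (free_ring G) \<Longrightarrow> g \<in> carrier (free_ring G) \<Longrightarrow> P f \<Longrightarrow> P g \<Longrightarrow> P (f - g)"
  shows "P f"
proof -
  have "keys f \<subseteq> {w. set (letters w) \<subseteq> G}"
    using assms(1) by (auto simp: free_ring_def)
  then have "f \<in> carrier (free_ring G) \<and> P f"
  proof (induction f rule: frag_induction)
    case zero
    then show ?case using assms(2) free_ring_closed(1) by auto
  next
    case (one x)
    then show ?case using assms(3)[of "letters x"] by (simp add: mon_in_free_ring[symmetric])
  next
    case (diff a b)
    then show ?case using assms(4) free_ring_closed(6) by blast
  qed
  then show ?thesis by blast
qed

lemma fpoly_induct [case_names zero mon diff]:
  fixes f :: "'g fpoly"
  assumes "P 0" "\<And>w. P (mon w)" "\<And>f g. P f \<Longrightarrow> P g \<Longrightarrow> P (f - g)"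
  shows "P f"
  by (rule free_ring_induct[of f UNIV]) (use assms in \<open>auto simp: free_ring_def\<close>)

subsection \<open>Evaluation\<close>

definition fp_eval :: "('g \<Rightarrow> 'r::ring_1) \<Rightarrow> 'g fpoly \<Rightarrow> 'r"
  where "fp_eval h f = (\<Sum>w\<in>keys f. of_int (lookup f w) * prod_list (map h (letters w)))"

lemma fp_eval_superset:
  assumes "finite S" "keys f \<subseteq> S"
  shows "fp_eval h f = (\<Sum>w\<in>S. of_int (lookup f w) * prod_list (map h (letters w)))"
  unfolding fp_eval_def using assms by (intro sum.mono_neutral_left) (auto simp: in_keys_iff)

lemma fp_eval_0 [simp]: "fp_eval h 0 = 0"
  by (simp add: fp_eval_def)

lemma fp_eval_mon [simp]: "fp_eval h (mon w) = prod_list (map h w)"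
  by (simp add: fp_eval_def)

lemma fp_eval_diff [simp]: "fp_eval h (f - g) = fp_eval h f - fp_eval h g"
proof -
  let ?S = "keys f \<union> keys g"
  have "keys (f - g) \<subseteq> ?S" by (rule keys_diff)
  then show ?thesis
    by (simp add: fp_eval_superset[of ?S] lookup_minus left_diff_distrib sum_subtractf)
qed

lemma fp_eval_uminus [simp]: "fp_eval h (- f) = - fp_eval h f"
  using fp_eval_diff[of h 0 f] by simp

lemma fp_eval_add [simp]: "fp_eval h (f + g) = fp_eval h f + fp_eval h g"
  using fp_eval_diff[of h f "- g"] by simp

lemma fp_eval_fvar [simp]: "fp_eval h (fvar g) = h g"
  by (simp add: fvar_eq_mon)

lemma fp_eval_1 [simp]: "fp_eval h 1 = 1"
  using fp_eval_mon[of h "[]"] by (simp add: mon_Nil)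

lemma fp_eval_mult [simp]: "fp_eval h (f * g) = fp_eval h f * fp_eval h g"
proof (induction f rule: fpoly_induct)
  case (mon u)
  show ?case
  proof (induction g rule: fpoly_induct)
    case (mon v)
    show ?case by (simp flip: mon_append)
  qed (simp_all add: right_diff_distrib)
qed (simp_all add: left_diff_distrib)

subsection \<open>The ideal generated by relators\<close>

text \<open>
  This ideal lives in the free ring on all letters, so that computations modulo the relators carry no
  side conditions on letters. Lemma \<open>genideal_free_ring\<close> returns to the free ring on a given set of
  generators.
\<close>

inductive_set idl :: "'g fpoly set \<Rightarrow> 'g fpoly set" for R
  where
  zero: "0 \<in> idl R"
| step: "r \<in> R \<Longrightarrow> a \<in> idl R \<Longrightarrow> u * r * v + a \<in> idl R"

lemma idl_gen: "r \<in> R \<Longrightarrow> r \<in> idl R"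
  using idl.step[OF _ idl.zero, of r R 1 1] by simp

lemma idl_add: "a \<in> idl R \<Longrightarrow> b \<in> idl R \<Longrightarrow> a + b \<in> idl R"
  by (induction rule: idl.induct) (auto simp: add.assoc intro: idl.intros)

lemma idl_mult_left: "a \<in> idl R \<Longrightarrow> f * a \<in> idl R"
proof (induction rule: idl.induct)
  case (step r a u v)
  then show ?case using idl.step[of r R "f * a" "f * u" v] by (simp add: distrib_left mult.assoc)
qed (simp add: idl.zero)

lemma idl_mult_right: "a \<in> idl R \<Longrightarrow> a * f \<in> idl R"
proof (induction rule: idl.induct)
  case (step r a u v)
  then show ?case using idl.step[of r R "a * f" u "v * f"] by (simp add: distrib_right mult.assoc)
qed (simp add: idl.zero)

lemma idl_uminus: "a \<in> idl R \<Longrightarrow> - a \<in> idl R"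
  using idl_mult_left[of a R "-1"] by simp

lemma idl_diff: "a \<in> idl R \<Longrightarrow> b \<in> idl R \<Longrightarrow> a - b \<in> idl R"
  using idl_add[OF _ idl_uminus] by fastforce

lemma fp_eval_idl:
  assumes "\<And>r. r \<in> R \<Longrightarrow> fp_eval h r = 0" "a \<in> idl R"
  shows "fp_eval h a = 0"
  using assms(2) by (induction rule: idl.induct) (simp_all add: assms(1))

lemma fp_eval_retraction:
  assumes "f \<in> carrier (free_ring G)"
  shows "fp_eval (\<lambda>g. if g \<in> G then fvar g else 0) f = f"
  using assms
proof (induction rule: free_ring_induct)
  case (mon w)
  then have "prod_list (map (\<lambda>g. if g \<in> G then fvar g else 0) w) = mon w"
    by (induction w) (auto simp: mon_Nil mon_Cons)
  then show ?case by simp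
qed simp_all

lemma fp_eval_retraction_closed: 
  "fp_eval (\<lambda>g. if g \<in> G then fvar g else 0) f \<in> carrier (free_ring G)"
proof (induction f rule: fpoly_induct)
  case (mon w)
  have "prod_list (map (\<lambda>g. if g \<in> G then fvar g else 0) w) \<in> carrier (free_ring G)"
    by (induction w) (auto intro: free_ring_closed fvar_in_free_ring)
  then show ?case by simp
qed (auto intro: free_ring_closed)

text \<open>
  Sending the letters outside \<open>G\<close> to zero is a ring homomorphism that fixes the elements over \<open>G\<close>.
  Therefore additional letters and relators create no new relations over \<open>G\<close>, as long as the additional
  relators are sent to zero or to relators.
\<close>

lemma idl_retraction:
  assumes "a \<in> idl R" "a \<in> carrier (free_ring G)"
    and "\<And>r. r \<in> R \<Longrightarrow> fp_eval (\<lambda>g. if g \<in> G then fvar g else 0) r \<in> R' \<union> {0}"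
  shows "a \<in> idl R'"
proof -
  let ?\<rho> = "fp_eval (\<lambda>g. if g \<in> G then fvar g else 0) :: 'a fpoly \<Rightarrow> 'a fpoly"
  have "?\<rho> a \<in> idl R'"
    using assms(1)
  proof (induction rule: idl.induct)
    case (step r a u v)
    have "?\<rho> r \<in> idl R'" using assms(3)[OF step(1)] idl_gen idl.zero by fastforce
    then show ?case using step by (simp add: idl_add idl_mult_left idl_mult_right)
  qed (simp add: idl.zero)
  then show ?thesis using fp_eval_retraction[OF assms(2)] by simp
qed

lemma genideal_free_ring:
  assumes R: "R \<subseteq> carrier (free_ring G)"
  shows "genideal (free_ring G) R = idl R \<inter> carrier (free_ring G)"
proof
  interpret F: ring "free_ring G" by (rule ring_free_ring)
  have inv: "\<ominus>\<^bsub>free_ring G\<^esub> a = - a" if "a \<in> carrier (free_ring G)" for a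
    using F.minus_equality[of "- a" a] that by (simp add: free_ring_closed)
  have "ideal (idl R \<inter> carrier (free_ring G)) (free_ring G)"
  proof (rule idealI[OF ring_free_ring])
    show "subgroup (idl R \<inter> carrier (free_ring G)) (add_monoid (free_ring G))"
    proof (rule F.add.subgroupI)
      show "idl R \<inter> carrier (free_ring G) \<noteq> {}"
        using idl.zero[of R] free_ring_closed(1)[of G] by blast
    next
      fix a assume "a \<in> idl R \<inter> carrier (free_ring G)"
      then show "\<ominus>\<^bsub>free_ring G\<^esub> a \<in> idl R \<inter> carrier (free_ring G)"
        by (simp add: inv idl_uminus free_ring_closed)
    qed (auto intro: idl_add free_ring_closed)
  qed (auto intro: idl_mult_left idl_mult_right free_ring_closed)
  then show "genideal (free_ring G) R \<subseteq> idl R \<inter> carrier (free_ring G)"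
    by (rule F.genideal_minimal) (use R in \<open>auto intro: idl_gen\<close>)
  interpret I: ideal "genideal (free_ring G) R" "free_ring G"
    by (rule F.genideal_ideal[OF R])
  let ?\<rho> = "fp_eval (\<lambda>g. if g \<in> G then fvar g else 0) :: 'a fpoly \<Rightarrow> 'a fpoly"
  have "?\<rho> a \<in> genideal (free_ring G) R" if "a \<in> idl R" for a
    using that
  proof (induction rule: idl.induct)
    case zero
    show ?case using I.zero_closed by simp
  next
    case (step r a u v)
    have "?\<rho> r \<in> genideal (free_ring G) R"
      using step(1) R F.genideal_self[OF R] by (auto simp: fp_eval_retraction subset_iff)
    then have "?\<rho> u * ?\<rho> r * ?\<rho> v \<in> genideal (free_ring G) R"
      using I.I_l_closed[of "?\<rho> r" "?\<rho> u"] I.I_r_closed[of "?\<rho> u * ?\<rho> r" "?\<rho> v"]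
      by (simp add: fp_eval_retraction_closed)
    then show ?case using I.a_closed[of _ "?\<rho> a"] step by simp
  qed
  then show "idl R \<inter> carrier (free_ring G) \<subseteq> genideal (free_ring G) R"
    using fp_eval_retraction by fastforce
qed

locale presentation =
  fixes G :: "'g set" and R :: "'g fpoly set"
  assumes relators: "R \<subseteq> carrier (free_ring G)"
begin

abbreviation A where "A \<equiv> presented_ring G R"
abbreviation cls where "cls \<equiv> presented_class G R"
abbreviation F where "F \<equiv> carrier (free_ring G)"

sublocale I: ideal "genideal (free_ring G) R" "free_ring G"
  by (rule ring.genideal_ideal[OF ring_free_ring relators])

sublocale A: ring A
  by (rule ring_presented_ring[OF relators])

lemma carrier_presented: "carrier A = cls ` F"
  by (auto simp: presented_ring_def presented_class_def FactRing_def A_RCOSETS_def' image_def)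

lemma cls_closed: "f \<in> F \<Longrightarrow> cls f \<in> carrier A"
  by (simp add: carrier_presented)

lemma cls_hom: "cls \<in> ring_hom (free_ring G) A"
  using I.rcos_ring_hom by (simp add: presented_class_def[abs_def] presented_ring_def)

lemma cls_mult: "f \<in> F \<Longrightarrow> g \<in> F \<Longrightarrow> cls (f * g) = cls f \<otimes>\<^bsub>A\<^esub> cls g"
  using ring_hom_mult[OF cls_hom] by fastforce

lemma cls_add: "f \<in> F \<Longrightarrow> g \<in> F \<Longrightarrow> cls (f + g) = cls f \<oplus>\<^bsub>A\<^esub> cls g"
  using ring_hom_add[OF cls_hom] by fastforce

lemma cls_one: "cls 1 = \<one>\<^bsub>A\<^esub>"
  using ring_hom_one[OF cls_hom] by simp

lemma cls_zero: "cls 0 = \<zero>\<^bsub>A\<^esub>"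
  using ring_hom_zero[OF cls_hom ring_free_ring A.ring_axioms] by simp

lemma cls_uminus: "f \<in> F \<Longrightarrow> cls (- f) = \<ominus>\<^bsub>A\<^esub> cls f"
proof -
  assume f: "f \<in> F"
  have "cls (- f) \<oplus>\<^bsub>A\<^esub> cls f = cls (- f + f)"
    by (rule cls_add[symmetric]) (use f in \<open>auto intro: free_ring_closed\<close>)
  then have "cls (- f) \<oplus>\<^bsub>A\<^esub> cls f = \<zero>\<^bsub>A\<^esub>" by (simp add: cls_zero)
  then show ?thesis
    using A.minus_equality f by (simp add: cls_closed free_ring_closed)
qed

lemma cls_eq_iff:
  assumes "f \<in> F" "g \<in> F"
  shows "cls f = cls g \<longleftrightarrow> f - g \<in> idl R"
proof -
  have fg: "f = (f - g) + g" "f - g \<in> F" using assms by (auto intro: free_ring_closed)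
  have inv: "\<ominus>\<^bsub>free_ring G\<^esub> g = - g"
    using I.minus_equality[of "- g" g] assms by (simp add: free_ring_closed)
  have "cls f = cls g \<longleftrightarrow> f \<ominus>\<^bsub>free_ring G\<^esub> g \<in> genideal (free_ring G) R"
    unfolding presented_class_def
    using I.quotient_eq_iff_same_a_r_cos[OF I.ideal_axioms assms] by blast
  also have "f \<ominus>\<^bsub>free_ring G\<^esub> g = f - g"
    by (simp add: a_minus_def inv)
  finally show ?thesis using genideal_free_ring[OF relators] fg(2) by blast
qed

lemma cls_eq_zero_iff: "f \<in> F \<Longrightarrow> cls f = \<zero>\<^bsub>A\<^esub> \<longleftrightarrow> f \<in> idl R"
  using cls_eq_iff[of f 0] by (simp add: cls_zero free_ring_closed)

end

section \<open>Two auxiliary rings\<close>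

text \<open>
  Additive endomorphisms are made into a ring in order that a module over a free ring is the same as a
  choice of values for \<open>fp_eval\<close>.
\<close>

typedef (overloaded) ('a::ring_1) aend = "{f :: 'a \<Rightarrow> 'a. \<forall>x y. f (x + y) = f x + f y}"
  morphisms ap Aend by (rule exI[of _ id]) simp

setup_lifting type_definition_aend

instantiation aend :: (ring_1) ring_1
begin
lift_definition zero_aend :: "'a aend" is "\<lambda>_. 0" by simp
lift_definition one_aend :: "'a aend" is "\<lambda>x. x" by simp
lift_definition plus_aend :: "'a aend \<Rightarrow> 'a aend \<Rightarrow> 'a aend" is "\<lambda>f g x. f x + g x"
  by (simp add: algebra_simps)
lift_definition minus_aend :: "'a aend \<Rightarrow> 'a aend \<Rightarrow> 'a aend" is "\<lambda>f g x. f x - g x"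
  by (simp add: algebra_simps)
lift_definition uminus_aend :: "'a aend \<Rightarrow> 'a aend" is "\<lambda>f x. - f x"
  by (simp add: algebra_simps)
lift_definition times_aend :: "'a aend \<Rightarrow> 'a aend \<Rightarrow> 'a aend" is "\<lambda>f g x. f (g x)"
  by simp
instance
proof
  show "(0 :: 'a aend) \<noteq> 1"
    by transfer (metis zero_neq_one)
qed (transfer; simp add: fun_eq_iff algebra_simps)+
end

lemma ap_simps [simp]:
  "ap 0 x = 0" "ap 1 x = x" "ap (f + g) x = ap f x + ap g x" "ap (f - g) x = ap f x - ap g x"
  "ap (- f) x = - ap f x" "ap (f * g) x = ap f (ap g x)"
  by (transfer; simp)+

lemma ap_add [simp]: "ap f (x + y) = ap f x + ap f y"
  by transfer simp

lemma ap_zero [simp]: "ap f 0 = 0"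
  using ap_add[of f 0 0] by simp

lemma ap_uminus [simp]: "ap f (- x) = - ap f x"
  using ap_add[of f x "- x"] by (simp add: eq_neg_iff_add_eq_0 add.commute)

lemma ap_diff [simp]: "ap f (x - y) = ap f x - ap f y"
  using ap_add[of f x "- y"] by simp

lemma ap_of_int_mult [simp]: "ap f (of_int c * x) = of_int c * ap f x"
  by (induction c rule: int_induct[where k = 0]) (simp_all add: algebra_simps)

lemma ap_of_int [simp]: "ap (of_int c) x = of_int c * x"
  by (induction c rule: int_induct[where k = 0]) (simp_all add: algebra_simps)

lemma ap_sum_left: "ap (sum g S) x = (\<Sum>i\<in>S. ap (g i) x)"
  by (induction S rule: infinite_finite_induct) simp_all

lemma aend_eqI: "(\<And>x. ap f x = ap g x) \<Longrightarrow> f = g"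
  by (simp add: ap_inject[symmetric] fun_eq_iff)

text \<open>
  The element \<open>UT s d i\<close> is the matrix with rows \<open>(s, d)\<close> and \<open>(0, i)\<close>. A ring homomorphism
  \<open>p \<mapsto> UT (s p) (d p) p\<close> is the same as an endomorphism \<open>s\<close> with a twisted derivation \<open>d\<close>, so the
  universal property of a ring given by generators and relations constructs \<open>s\<close> and \<open>d\<close> together.
\<close>

datatype 'r ut = UT (ut_s: 'r) (ut_d: 'r) (ut_i: 'r)

instantiation ut :: (ring_1) ring_1
begin
definition zero_ut :: "'a ut" where "0 = UT 0 0 0"
definition one_ut :: "'a ut" where "1 = UT 1 0 1"
definition plus_ut :: "'a ut \<Rightarrow> 'a ut \<Rightarrow> 'a ut"
  where "A + B = UT (ut_s A + ut_s B) (ut_d A + ut_d B) (ut_i A + ut_i B)"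
definition minus_ut :: "'a ut \<Rightarrow> 'a ut \<Rightarrow> 'a ut"
  where "A - B = UT (ut_s A - ut_s B) (ut_d A - ut_d B) (ut_i A - ut_i B)"
definition uminus_ut :: "'a ut \<Rightarrow> 'a ut"
  where "- A = UT (- ut_s A) (- ut_d A) (- ut_i A)"
definition times_ut :: "'a ut \<Rightarrow> 'a ut \<Rightarrow> 'a ut"
  where "A * B = UT (ut_s A * ut_s B) (ut_s A * ut_d B + ut_d A * ut_i B) (ut_i A * ut_i B)"
instance
  by standard (simp_all add: zero_ut_def one_ut_def plus_ut_def minus_ut_def uminus_ut_def
      times_ut_def algebra_simps ut.expand)
end

lemma ut_simps [simp]:
  "ut_s 0 = 0" "ut_d 0 = 0" "ut_i 0 = 0" "ut_s 1 = 1" "ut_d 1 = 0" "ut_i 1 = 1"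
  "ut_s (A + B) = ut_s A + ut_s B" "ut_d (A + B) = ut_d A + ut_d B" "ut_i (A + B) = ut_i A + ut_i B"
  "ut_s (A - B) = ut_s A - ut_s B" "ut_d (A - B) = ut_d A - ut_d B" "ut_i (A - B) = ut_i A - ut_i B"
  "ut_s (A * B) = ut_s A * ut_s B" "ut_d (A * B) = ut_s A * ut_d B + ut_d A * ut_i B"
  "ut_i (A * B) = ut_i A * ut_i B"
  by (simp_all add: zero_ut_def one_ut_def plus_ut_def minus_ut_def times_ut_def)

section \<open>Skew polynomials in infinitely many variables\<close>

definition anticomm :: "nat fpoly set"
  where "anticomm = {fvar i * fvar j + fvar j * fvar i | i j. i \<noteq> j}"

text \<open>
  Taking all variables \<open>x\<^sub>0, x\<^sub>1, \<dots>\<close> at once gives a single type that contains the skew polynomial rings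
  for every \<open>n\<close>.
\<close>

quotient_type spol = "nat fpoly" / "\<lambda>f g. f - g \<in> idl anticomm"
proof (rule equivpI)
  show "reflp (\<lambda>f g. f - g \<in> idl anticomm)"
    by (rule reflpI) (simp add: idl.zero)
  show "symp (\<lambda>f g. f - g \<in> idl anticomm)"
    by (rule sympI) (metis idl_uminus minus_diff_eq)
  show "transp (\<lambda>f g. f - g \<in> idl anticomm)"
    by (rule transpI) (metis idl_add diff_add_cancel add_diff_eq)
qed

lemma one_notin_anticomm: "1 \<notin> idl anticomm"
proof
  assume "1 \<in> idl anticomm"
  then have "fp_eval (\<lambda>_. 0 :: int) (1 :: nat fpoly) = 0"
    by (rule fp_eval_idl[rotated]) (auto simp: anticomm_def)
  then show False by simp
qed

instantiation spol :: ring_1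
begin
lift_definition zero_spol :: spol is 0 .
lift_definition one_spol :: spol is 1 .
lift_definition plus_spol :: "spol \<Rightarrow> spol \<Rightarrow> spol" is "(+)"
  using idl_add by (metis add_diff_add)
lift_definition minus_spol :: "spol \<Rightarrow> spol \<Rightarrow> spol" is "(-)"
proof -
  fix a b c d :: "nat fpoly"
  assume "a - b \<in> idl anticomm" "c - d \<in> idl anticomm"
  from idl_diff[OF this] show "a - c - (b - d) \<in> idl anticomm" by (simp add: algebra_simps)
qed
lift_definition uminus_spol :: "spol \<Rightarrow> spol" is uminus
  using idl_uminus by fastforce
lift_definition times_spol :: "spol \<Rightarrow> spol \<Rightarrow> spol" is "(*)"
proof -
  fix a b c d :: "nat fpoly"
  assume "a - b \<in> idl anticomm" "c - d \<in> idl anticomm"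
  then have "(a - b) * c + b * (c - d) \<in> idl anticomm"
    by (intro idl_add idl_mult_left idl_mult_right)
  then show "a * c - b * d \<in> idl anticomm" by (simp add: algebra_simps)
qed
instance
proof
  show "(0 :: spol) \<noteq> 1"
    by transfer (use one_notin_anticomm idl_uminus in fastforce)
qed (transfer; simp add: idl.zero algebra_simps)+
end

definition spol_of :: "nat fpoly \<Rightarrow> spol" where "spol_of = abs_spol"

lemma spol_of_simps [simp]:
  "spol_of 0 = 0" "spol_of 1 = 1" "spol_of (f + g) = spol_of f + spol_of g"
  "spol_of (f - g) = spol_of f - spol_of g" "spol_of (- f) = - spol_of f"
  "spol_of (f * g) = spol_of f * spol_of g"
  by (simp_all add: spol_of_def zero_spol_def one_spol_def plus_spol.abs_eq minus_spol.abs_eq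
      uminus_spol.abs_eq times_spol.abs_eq)

lemma spol_of_eq_0_iff: "spol_of f = 0 \<longleftrightarrow> f \<in> idl anticomm"
  by (simp add: spol_of_def zero_spol_def spol.abs_eq_iff)

lemma surj_spol_of: "\<exists>f. p = spol_of f"
  unfolding spol_of_def by (metis Quotient3_abs_rep Quotient3_spol)

definition sx :: "nat \<Rightarrow> spol" where "sx i = spol_of (fvar i)"

lemma sx_anticomm: "i \<noteq> j \<Longrightarrow> sx i * sx j = - (sx j * sx i)"
proof -
  assume "i \<noteq> j"
  then have "spol_of (fvar i * fvar j + fvar j * fvar i) = 0"
    unfolding spol_of_eq_0_iff by (intro idl_gen) (auto simp: anticomm_def)
  then show ?thesis by (simp add: sx_def eq_neg_iff_add_eq_0)
qed

text \<open>
  The universal property of skew polynomials: \<open>sp_eval h\<close> is the ring homomorphism with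
  \<open>x\<^sub>i \<mapsto> h i\<close>, provided that the values of \<open>h\<close> anticommute.
\<close>

definition sp_eval :: "(nat \<Rightarrow> 'r::ring_1) \<Rightarrow> spol \<Rightarrow> 'r"
  where "sp_eval h p = fp_eval h (SOME f. p = spol_of f)"

context
  fixes h :: "nat \<Rightarrow> 'r::ring_1"
  assumes h: "\<And>i j. i \<noteq> j \<Longrightarrow> h i * h j + h j * h i = 0"
begin

lemma sp_eval_spol_of: "sp_eval h (spol_of f) = fp_eval h f"
proof -
  define g where "g = (SOME g. spol_of f = spol_of g)"
  have "spol_of f = spol_of g" unfolding g_def by (rule someI) (rule refl)
  then have "f - g \<in> idl anticomm" by (simp flip: spol_of_eq_0_iff)
  then have "fp_eval h (f - g) = 0"
    by (rule fp_eval_idl[rotated]) (auto simp: anticomm_def h)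
  then show ?thesis by (simp add: sp_eval_def g_def)
qed

lemma sp_eval_simps:
  "sp_eval h 0 = 0" "sp_eval h 1 = 1" "sp_eval h (p + q) = sp_eval h p + sp_eval h q"
  "sp_eval h (p - q) = sp_eval h p - sp_eval h q"
  "sp_eval h (- p) = - sp_eval h p" "sp_eval h (p * q) = sp_eval h p * sp_eval h q"
  "sp_eval h (sx i) = h i"
proof -
  show "sp_eval h 0 = 0" using sp_eval_spol_of[of 0] by simp
  show "sp_eval h 1 = 1" using sp_eval_spol_of[of 1] by simp
  show "sp_eval h (sx i) = h i" using sp_eval_spol_of[of "fvar i"] by (simp add: sx_def)
  obtain f g where [simp]: "p = spol_of f" "q = spol_of g" using surj_spol_of by metis
  show "sp_eval h (p + q) = sp_eval h p + sp_eval h q"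
    "sp_eval h (p - q) = sp_eval h p - sp_eval h q"
    "sp_eval h (- p) = - sp_eval h p" "sp_eval h (p * q) = sp_eval h p * sp_eval h q"
    using sp_eval_spol_of[of "f + g"] sp_eval_spol_of[of "f - g"] sp_eval_spol_of[of "- f"]
      sp_eval_spol_of[of "f * g"] by (simp_all add: sp_eval_spol_of)
qed

end

lemma spol_induct [case_names one var diff]:
  assumes "P 1" "\<And>i p. P p \<Longrightarrow> P (sx i * p)" "\<And>p q. P p \<Longrightarrow> P q \<Longrightarrow> P (p - q)"
  shows "P p"
proof -
  obtain f where "p = spol_of f" using surj_spol_of by blast
  moreover have "P (spol_of f)"
  proof (induction f rule: fpoly_induct)
    case zero
    then show ?case using assms(3)[OF assms(1) assms(1)] by simp
  next
    case (mon w)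
    then show ?case by (induction w) (simp_all add: mon_Nil mon_Cons assms(1,2) flip: sx_def)
  qed (simp add: assms(3))
  ultimately show ?thesis by simp
qed

section \<open>The operators\<close>

definition twist :: "(nat \<Rightarrow> spol) \<Rightarrow> (nat \<Rightarrow> int) \<Rightarrow> nat \<Rightarrow> spol ut"
  where "twist s d i = UT (s i) (of_int (d i)) (sx i)"

definition s_img :: "nat \<Rightarrow> nat \<Rightarrow> spol"
  where "s_img i j = (if j = i then - sx (i+1) else if j = i+1 then - sx i else - sx j)"
definition d_img :: "nat \<Rightarrow> nat \<Rightarrow> int"
  where "d_img i j = (if j = i \<or> j = i+1 then 1 else 0)"
definition sD_img :: "nat \<Rightarrow> nat \<Rightarrow> spol"
  where "sD_img n j = (if j = n then sx (n-1) else if j = n-1 then sx n else - sx j)"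
definition dD_img :: "nat \<Rightarrow> nat \<Rightarrow> int"
  where "dD_img n j = (if j = n then -1 else if j = n-1 then 1 else 0)"

lemma twist_s: "i \<noteq> j \<Longrightarrow> twist (s_img k) (d_img k) i * twist (s_img k) (d_img k) j
    + twist (s_img k) (d_img k) j * twist (s_img k) (d_img k) i = 0"
  by (rule ut.expand) (auto simp: twist_def s_img_def d_img_def sx_anticomm[of i j] sx_anticomm[of "Suc k" k]
      sx_anticomm[of "Suc k" j] sx_anticomm[of k j] sx_anticomm[of "Suc k" i] sx_anticomm[of k i])

lemma twist_sD:
  assumes "i \<noteq> j" "n \<ge> 1"
  shows "twist (sD_img n) (dD_img n) i * twist (sD_img n) (dD_img n) j
    + twist (sD_img n) (dD_img n) j * twist (sD_img n) (dD_img n) i = 0"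
proof -
  obtain m where "n = Suc m" using assms(2) by (cases n) auto
  then show ?thesis using assms(1)
    by (intro ut.expand) (auto simp: twist_def sD_img_def dD_img_def sx_anticomm[of i j] sx_anticomm[of "Suc m" m]
      sx_anticomm[of "Suc m" j] sx_anticomm[of m j] sx_anticomm[of "Suc m" i] sx_anticomm[of m i])
qed

definition s_op :: "nat \<Rightarrow> spol \<Rightarrow> spol" where "s_op k p = ut_s (sp_eval (twist (s_img k) (d_img k)) p)"
definition del_op :: "nat \<Rightarrow> spol \<Rightarrow> spol" where "del_op k p = ut_d (sp_eval (twist (s_img k) (d_img k)) p)"
definition sD_op :: "nat \<Rightarrow> spol \<Rightarrow> spol" where "sD_op n p = ut_s (sp_eval (twist (sD_img n) (dD_img n)) p)"
definition delD_op :: "nat \<Rightarrow> spol \<Rightarrow> spol" where "delD_op n p = ut_d (sp_eval (twist (sD_img n) (dD_img n)) p)"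

lemmas tw_simps = sp_eval_simps[OF twist_s] 
lemmas twD_simps = sp_eval_simps[OF twist_sD]

lemma tw_i: "ut_i (sp_eval (twist (s_img k) (d_img k)) p) = p"
  by (induction p rule: spol_induct) (simp_all add: tw_simps, simp add: twist_def)

lemma twD_i: "n \<ge> 1 \<Longrightarrow> ut_i (sp_eval (twist (sD_img n) (dD_img n)) p) = p"
  by (induction p rule: spol_induct) (simp_all add: twD_simps, simp add: twist_def)

lemma s_op_simps [simp]:
  "s_op k 0 = 0" "s_op k 1 = 1" "s_op k (p + q) = s_op k p + s_op k q" "s_op k (p - q) = s_op k p - s_op k q"
  "s_op k (- p) = - s_op k p" "s_op k (p * q) = s_op k p * s_op k q" "s_op k (sx i) = s_img k i"
  by (simp_all add: s_op_def tw_simps uminus_ut_def) (simp add: twist_def)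

lemma del_op_simps [simp]:
  "del_op k 0 = 0" "del_op k 1 = 0" "del_op k (p + q) = del_op k p + del_op k q" "del_op k (p - q) = del_op k p - del_op k q"
  "del_op k (- p) = - del_op k p"
  by (simp_all add: del_op_def tw_simps uminus_ut_def)

lemma del_op_mult: "del_op k (p * q) = del_op k p * q + s_op k p * del_op k q"
  by (simp add: del_op_def s_op_def tw_simps tw_i)

lemma del_op_sx: "del_op k (sx j) = (if j = k \<or> j = k+1 then 1 else 0)"
  by (simp add: del_op_def tw_simps) (simp add: twist_def d_img_def)

lemma sD_op_simps [simp]:
  assumes "n \<ge> 1"
  shows "sD_op n 0 = 0" "sD_op n 1 = 1" "sD_op n (p + q) = sD_op n p + sD_op n q" "sD_op n (p - q) = sD_op n p - sD_op n q"
  "sD_op n (- p) = - sD_op n p" "sD_op n (p * q) = sD_op n p * sD_op n q" "sD_op n (sx i) = sD_img n i"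
  using assms by (simp_all add: sD_op_def twD_simps uminus_ut_def) (simp add: twist_def)

lemma delD_op_simps [simp]:
  assumes "n \<ge> 1"
  shows "delD_op n 0 = 0" "delD_op n 1 = 0" "delD_op n (p + q) = delD_op n p + delD_op n q" "delD_op n (p - q) = delD_op n p - delD_op n q"
  "delD_op n (- p) = - delD_op n p"
  using assms by (simp_all add: delD_op_def twD_simps uminus_ut_def)

lemma delD_op_mult: "n \<ge> 1 \<Longrightarrow> delD_op n (p * q) = delD_op n p * q + sD_op n p * delD_op n q"
  by (simp add: delD_op_def sD_op_def twD_simps twD_i)

lemma delD_op_sx: "n \<ge> 1 \<Longrightarrow> delD_op n (sx j) = (if j = n then -1 else if j = n-1 then 1 else 0)"
  by (simp add: delD_op_def twD_simps) (simp add: twist_def dD_img_def)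

text \<open>
  These rules determine the operators by recursion on words, which is how every relation between them
  is verified below: both sides of a relation pass a variable \<open>x\<^sub>i\<close> in the same way, and they agree on
  \<open>1\<close>.
\<close>

lemma del_op_sx_mult:
  "del_op k (sx k * p) = p - sx (k+1) * del_op k p"
  "del_op k (sx (Suc k) * p) = p - sx k * del_op k p"
  "j \<noteq> k \<Longrightarrow> j \<noteq> Suc k \<Longrightarrow> del_op k (sx j * p) = - (sx j * del_op k p)"
  by (simp_all add: del_op_mult del_op_sx s_img_def)

lemma delD_op_sx_mult:
  assumes "n \<ge> 1"
  shows "delD_op n (sx n * p) = - p + sx (n-1) * delD_op n p"
  "delD_op n (sx (n-1) * p) = p + sx n * delD_op n p"
  "j \<noteq> n - 1 \<Longrightarrow> j \<noteq> n \<Longrightarrow> delD_op n (sx j * p) = - (sx j * delD_op n p)"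
  using assms by (auto simp add: delD_op_mult delD_op_sx sD_img_def)

subsection \<open>Relations between the operators\<close>

lemma del_op_sq: "del_op k (del_op k p) = 0"
proof (induction p rule: spol_induct)
  case (var i p)
  consider "i = k" | "i = k+1" | "i \<noteq> k" "i \<noteq> k+1" by blast
  then show ?case by cases (simp_all add: del_op_sx_mult var)
qed simp_all

lemma del_op_braid: "del_op k (del_op (k+1) (del_op k p)) = del_op (k+1) (del_op k (del_op (k+1) p))"
proof (induction p rule: spol_induct)
  case (var i p)
  consider "i = k" | "i = k+1" | "i = k+2" | "i \<noteq> k" "i \<noteq> k+1" "i \<noteq> k+2" by blast
  then show ?case by cases (use var in \<open>simp_all add: del_op_sx_mult del_op_sq\<close>)
qed simp_all

lemma del_op_far: "k + 1 < l \<Longrightarrow> del_op k (del_op l p) = - del_op l (del_op k p)"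
proof (induction p rule: spol_induct)
  case (var i p)
  consider "i = k" | "i = k+1" | "i = l" | "i = l+1" | "i \<notin> {k,k+1,l,l+1}" by blast
  then show ?case by cases (use var in \<open>simp_all add: del_op_sx_mult\<close>)
qed simp_all

lemma delD_op_sq: "n \<ge> 2 \<Longrightarrow> delD_op n (delD_op n p) = 0"
proof -
  assume "n \<ge> 2"
  then obtain m where m: "n = Suc m" by (cases n) auto
  note rl = delD_op_sx_mult[of "Suc m", simplified]
  show ?thesis unfolding m
  proof (induction p rule: spol_induct)
    case (var i p)
    consider "i = m" | "i = Suc m" | "i \<noteq> m" "i \<noteq> Suc m" by blast
    then show ?case by cases (use var in \<open>simp_all add: rl\<close>)
  qed simp_all
qed

lemma delD_op_comm: "n \<ge> 2 \<Longrightarrow> delD_op n (del_op (n-1) p) = del_op (n-1) (delD_op n p)"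
proof -
  assume "n \<ge> 2"
  then obtain m where m: "n = Suc m" "m \<ge> 1" by (cases n) auto
  note rl = delD_op_sx_mult[of "Suc m", simplified]
  show ?thesis unfolding m(1)
  proof (induction p rule: spol_induct)
    case (var i p)
    consider "i = m" | "i = Suc m" | "i \<noteq> m" "i \<noteq> Suc m" by blast
    then show ?case by cases (use var in \<open>simp_all add: rl del_op_sx_mult\<close>)
  qed simp_all
qed

lemma delD_op_braid: "n \<ge> 3 \<Longrightarrow> delD_op n (del_op (n-2) (delD_op n p)) = del_op (n-2) (delD_op n (del_op (n-2) p))"
proof -
  assume "n \<ge> 3"
  then obtain m where m: "n = Suc (Suc m)" "m \<ge> 1" by (cases n; cases "n-1") auto
  note rl = delD_op_sx_mult[of "Suc (Suc m)", simplified]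
  have sq: "delD_op (Suc (Suc m)) (delD_op (Suc (Suc m)) p) = 0" for p by (rule delD_op_sq) simp
  have "delD_op n (del_op m (delD_op n p)) = del_op m (delD_op n (del_op m p))" unfolding m(1)
  proof (induction p rule: spol_induct)
    case (var i p)
    consider "i = m" | "i = Suc m" | "i = Suc (Suc m)" | "i \<noteq> m" "i \<noteq> Suc m" "i \<noteq> Suc (Suc m)" by blast
    then show ?case by cases (use var in \<open>simp_all add: rl del_op_sx_mult del_op_sq sq\<close>)
  qed simp_all
  then show ?thesis by (simp add: m)
qed

lemma delD_op_far: "i + 3 \<le> n \<Longrightarrow> delD_op n (del_op i p) = - del_op i (delD_op n p)"
proof -
  assume i: "i + 3 \<le> n"
  then obtain m where m: "n = Suc m" "i + 1 < m" by (cases n) auto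
  note rl = delD_op_sx_mult[of "Suc m", simplified]
  show ?thesis unfolding m(1)
  proof (induction p rule: spol_induct)
    case (var j p)
    consider "j = m" | "j = Suc m" | "j = i" | "j = Suc i" | "j \<notin> {m, Suc m, i, Suc i}" by blast
    then show ?case by cases (use var m(2) in \<open>simp_all add: rl del_op_sx_mult\<close>)
  qed simp_all
qed

section \<open>The representation of the free ring on skew polynomials\<close>

fun nh_op :: "nat \<Rightarrow> nh_gen \<Rightarrow> spol \<Rightarrow> spol"
  where
  "nh_op n (X i) p = sx i * p"
| "nh_op n (Del i) p = del_op i p"
| \<comment> \<open>\<open>D\<close> is a twisted derivation only for a positive index\<close>
  "nh_op n DelD p = delD_op (max n 1) p"

lemma nh_op_add: "nh_op n g (p + q) = nh_op n g p + nh_op n g q"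
  by (cases g) (simp_all add: distrib_left)

definition rep :: "nat \<Rightarrow> nh_gen fpoly \<Rightarrow> spol aend"
  where "rep n = fp_eval (\<lambda>g. Aend (nh_op n g))"

lemma ap_Aend_nh_op [simp]: "ap (Aend (nh_op n g)) = nh_op n g"
  by (rule Aend_inverse) (simp add: nh_op_add)

lemma rep_simps [simp]:
  "rep n 0 = 0" "rep n 1 = 1" "rep n (f + g) = rep n f + rep n g" "rep n (f - g) = rep n f - rep n g"
  "rep n (- f) = - rep n f" "rep n (f * g) = rep n f * rep n g" "rep n (fvar x) = Aend (nh_op n x)"
  by (simp_all add: rep_def)

lemma rep_relator:
  assumes "n \<ge> 2" "r \<in> nh_relators n"
  shows "rep n r = 0"
proof (rule aend_eqI)
  fix p
  have [simp]: "max n 1 = n" using assms(1) by simp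
  note rl = delD_op_sx_mult[of n, simplified]
  show "ap (rep n r) p = ap 0 p"
    using assms(2)
  proof cases
    case (x_x i j)
    then show ?thesis by (simp add: sx_anticomm[of i j] flip: mult.assoc)
  next
    case (del_far i j)
    then show ?thesis using del_op_far[of i j p] del_op_far[of j i p] by auto
  next
    case (x_del i)
    then show ?thesis by (simp add: del_op_sx_mult)
  next
    case (delD_braid)
    then show ?thesis using delD_op_braid[of n p] by simp
  next
    case (delD_far i)
    then show ?thesis using delD_op_far[of i n p] by simp
  next
    case delD_comm
    then show ?thesis using delD_op_comm[of n p] assms by simp
  next
    case x_delD
    then show ?thesis using rl(1)[of p] assms by simp
  next
    case delD_x
    then show ?thesis using rl(2)[of p] assms by simp
  next
    case (delD_x_far i)
    then show ?thesis using rl(3)[of i p] assms by simp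
  next
    case (del_braid i)
    then show ?thesis using del_op_braid[of i p] by simp
  next
    case delD_sq
    then show ?thesis using delD_op_sq[of n p] assms by simp
  qed (simp_all add: del_op_sx_mult del_op_sq)
qed

lemma rep_idl:
  assumes "n \<ge> 2" "f \<in> idl (nh_relators n)"
  shows "rep n f = 0"
  unfolding rep_def by (rule fp_eval_idl[OF _ assms(2)]) (use rep_relator[OF assms(1)] in \<open>simp add: rep_def\<close>)

section \<open>Rewriting words up to sign\<close>

definition word_zero :: "nat \<Rightarrow> nh_gen list \<Rightarrow> bool"
  where "word_zero n u \<longleftrightarrow> mon u \<in> idl (nh_relators n)"

text \<open>
  The relations among the \<open>\<partial>\<close>'s, and those among the \<open>x\<close>'s, identify words up to sign. Only the span of
  the words matters for normal forms, so the signs need not be tracked.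
\<close>

definition signed_eq :: "nat \<Rightarrow> nh_gen list \<Rightarrow> nh_gen list \<Rightarrow> bool"
  where "signed_eq n u v \<longleftrightarrow> mon u - mon v \<in> idl (nh_relators n) \<or> mon u + mon v \<in> idl (nh_relators n)"

lemma signed_eq_refl [simp]: "signed_eq n u u"
  by (simp add: signed_eq_def idl.zero)

lemma signed_eq_trans [trans]:
  assumes "signed_eq n u v" "signed_eq n v w" shows "signed_eq n u w"
proof -
  have "mon u - mon w = (mon u - mon v) + (mon v - mon w)" "mon u - mon w = (mon u + mon v) - (mon v + mon w)"
    "mon u + mon w = (mon u - mon v) + (mon v + mon w)" "mon u + mon w = (mon u + mon v) - (mon v - mon w)"
    by simp_all
  then show ?thesis using assms unfolding signed_eq_def by (metis idl_add idl_diff)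
qed

lemma signed_eq_ctx:
  assumes "signed_eq n u v" shows "signed_eq n (a @ u @ b) (a @ v @ b)"
proof -
  have "mon (a @ u @ b) - mon (a @ v @ b) = mon a * (mon u - mon v) * mon b"
    "mon (a @ u @ b) + mon (a @ v @ b) = mon a * (mon u + mon v) * mon b"
    by (simp_all add: mon_append algebra_simps)
  then show ?thesis using assms unfolding signed_eq_def
    by (metis idl_mult_left idl_mult_right)
qed

lemma signed_eq_ctxs:
  "signed_eq n u v \<Longrightarrow> signed_eq n (a @ u) (a @ v)" "signed_eq n u v \<Longrightarrow> signed_eq n (u @ b) (v @ b)"
  "signed_eq n u v \<Longrightarrow> signed_eq n (g # u) (g # v)"
  using signed_eq_ctx[of n u v a "[]"] signed_eq_ctx[of n u v "[]" b] signed_eq_ctx[of n u v "[g]" "[]"] by simp_all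

lemma word_zero_ctx: "word_zero n u \<Longrightarrow> word_zero n (a @ u @ b)"
  by (simp add: word_zero_def mon_append idl_mult_left idl_mult_right)

lemma word_zero_signed_eq: 
  assumes "signed_eq n u v" "word_zero n v" shows "word_zero n u"
proof -
  have "mon u = (mon u - mon v) + mon v" "mon u = (mon u + mon v) - mon v" by simp_all
  then show ?thesis using assms unfolding signed_eq_def word_zero_def by (metis idl_add idl_diff)
qed

lemma signed_eq_move:
  assumes "\<And>h. h \<in> set w \<Longrightarrow> signed_eq n [g, h] [h, g]"
  shows "signed_eq n (g # w) (w @ [g])"
  using assms
proof (induction w)
  case (Cons h w)
  have "signed_eq n (g # h # w) (h # g # w)" using signed_eq_ctxs(2)[OF Cons.prems, of h w] by simp
  also have "signed_eq n \<dots> (h # w @ [g])" by (intro signed_eq_ctxs Cons) (use Cons.prems in auto)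
  finally show ?case by simp
qed simp

lemma signed_eq_gens:
  "\<lbrakk>i \<in> {1..n}; j \<in> {1..n}; i \<noteq> j\<rbrakk> \<Longrightarrow> signed_eq n [X i, X j] [X j, X i]"
  "\<lbrakk>i \<in> {1..n-1}; j \<in> {1..n-1}; i + 1 < j \<or> j + 1 < i\<rbrakk> \<Longrightarrow> signed_eq n [Del i, Del j] [Del j, Del i]"
  "\<lbrakk>1 \<le> i; i + 3 \<le> n\<rbrakk> \<Longrightarrow> signed_eq n [DelD, Del i] [Del i, DelD]"
  "\<lbrakk>1 \<le> i; i + 3 \<le> n\<rbrakk> \<Longrightarrow> signed_eq n [Del i, DelD] [DelD, Del i]"
  "signed_eq n [DelD, Del (n-1)] [Del (n-1), DelD]"
  "signed_eq n [Del (n-1), DelD] [DelD, Del (n-1)]"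
  "\<lbrakk>1 \<le> i; i + 1 \<le> n-1\<rbrakk> \<Longrightarrow> signed_eq n [Del i, Del (i+1), Del i] [Del (i+1), Del i, Del (i+1)]"
  "\<lbrakk>1 \<le> i; i + 1 \<le> n-1\<rbrakk> \<Longrightarrow> signed_eq n [Del (i+1), Del i, Del (i+1)] [Del i, Del (i+1), Del i]"
  "n \<ge> 3 \<Longrightarrow> signed_eq n [DelD, Del (n-2), DelD] [Del (n-2), DelD, Del (n-2)]"
  "n \<ge> 3 \<Longrightarrow> signed_eq n [Del (n-2), DelD, Del (n-2)] [DelD, Del (n-2), DelD]"
  "1 \<le> i \<Longrightarrow> i \<le> n-1 \<Longrightarrow> word_zero n [Del i, Del i]"
  "word_zero n [DelD, DelD]"
proof -
  note m = mon_Cons mon_Nil mult.assoc[symmetric]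
  show "\<lbrakk>i \<in> {1..n}; j \<in> {1..n}; i \<noteq> j\<rbrakk> \<Longrightarrow> signed_eq n [X i, X j] [X j, X i]"
    using idl_gen[OF nh_relators.x_x[of i n j]] by (simp add: signed_eq_def m)
  show "\<lbrakk>i \<in> {1..n-1}; j \<in> {1..n-1}; i + 1 < j \<or> j + 1 < i\<rbrakk> \<Longrightarrow> signed_eq n [Del i, Del j] [Del j, Del i]"
    using idl_gen[OF nh_relators.del_far[of i n j]] by (simp add: signed_eq_def m)
  show "\<lbrakk>1 \<le> i; i + 3 \<le> n\<rbrakk> \<Longrightarrow> signed_eq n [DelD, Del i] [Del i, DelD]"
    using idl_gen[OF nh_relators.delD_far[of i n]] by (simp add: signed_eq_def m)
  show "\<lbrakk>1 \<le> i; i + 3 \<le> n\<rbrakk> \<Longrightarrow> signed_eq n [Del i, DelD] [DelD, Del i]"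
    using idl_gen[OF nh_relators.delD_far[of i n]] by (simp add: signed_eq_def m add.commute)
  show "signed_eq n [DelD, Del (n-1)] [Del (n-1), DelD]"
    using idl_gen[OF nh_relators.delD_comm[of n]] by (simp add: signed_eq_def m)
  show "signed_eq n [Del (n-1), DelD] [DelD, Del (n-1)]"
    using idl_uminus[OF idl_gen[OF nh_relators.delD_comm[of n]]] by (simp add: signed_eq_def m)
  show "\<lbrakk>1 \<le> i; i + 1 \<le> n-1\<rbrakk> \<Longrightarrow> signed_eq n [Del i, Del (i+1), Del i] [Del (i+1), Del i, Del (i+1)]"
    using idl_gen[OF nh_relators.del_braid[of i n]] by (simp add: signed_eq_def m)
  show "\<lbrakk>1 \<le> i; i + 1 \<le> n-1\<rbrakk> \<Longrightarrow> signed_eq n [Del (i+1), Del i, Del (i+1)] [Del i, Del (i+1), Del i]"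
    using idl_uminus[OF idl_gen[OF nh_relators.del_braid[of i n]]] by (simp add: signed_eq_def m)
  show "n \<ge> 3 \<Longrightarrow> signed_eq n [DelD, Del (n-2), DelD] [Del (n-2), DelD, Del (n-2)]"
    using idl_gen[OF nh_relators.delD_braid[of n]] by (simp add: signed_eq_def m)
  show "n \<ge> 3 \<Longrightarrow> signed_eq n [Del (n-2), DelD, Del (n-2)] [DelD, Del (n-2), DelD]"
    using idl_uminus[OF idl_gen[OF nh_relators.delD_braid[of n]]] by (simp add: signed_eq_def m)
  show "1 \<le> i \<Longrightarrow> i \<le> n-1 \<Longrightarrow> word_zero n [Del i, Del i]"
    using idl_gen[OF nh_relators.del_sq[of i n]] by (simp add: word_zero_def m)
  show "word_zero n [DelD, DelD]"
    using idl_gen[OF nh_relators.delD_sq[of n]] by (simp add: word_zero_def m)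
qed

section \<open>Chains\<close>

text \<open>
  The chains of level \<open>k\<close> follow the path of \<open>e\<^sub>k\<close> through the vectors \<open>\<plusminus>e\<^sub>j\<close>. The word \<open>desc k j\<close> ends
  at \<open>e\<^sub>j\<close>; at the fork of the diagram \<open>side_chain n k\<close> branches off to \<open>-e\<^sub>n\<close>; and \<open>long_chain n k j\<close>
  ends at \<open>-e\<^sub>j\<close> for \<open>j < n\<close>. The operator applied first is the last letter.
\<close>

definition desc :: "nat \<Rightarrow> nat \<Rightarrow> nh_gen list" where "desc k j = map Del (rev [k..<j])"
definition asc :: "nat \<Rightarrow> nat \<Rightarrow> nh_gen list" where "asc j l = map Del [j..<l]"

definition side_chain :: "nat \<Rightarrow> nat \<Rightarrow> nh_gen list" where "side_chain n k = DelD # desc k (n-1)"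
definition long_chain :: "nat \<Rightarrow> nat \<Rightarrow> nat \<Rightarrow> nh_gen list" where "long_chain n k j = asc j (n-1) @ DelD # desc k n"

lemma desc_Suc: "k \<le> j \<Longrightarrow> desc k (Suc j) = Del j # desc k j"
  by (simp add: desc_def)

lemma desc_self [simp]: "desc k k = []" by (simp add: desc_def)

lemma upt_split: "i \<le> j \<Longrightarrow> j \<le> k \<Longrightarrow> [i..<k] = [i..<j] @ [j..<k]"
  using upt_add_eq_append[of i j "k - j"] by simp

lemma desc_split: "k \<le> i \<Longrightarrow> i \<le> j \<Longrightarrow> desc k j = desc i j @ desc k i"
  unfolding desc_def by (simp add: upt_split[of k i j])

lemma asc_split: "j \<le> i \<Longrightarrow> i \<le> l \<Longrightarrow> asc j l = asc j i @ asc i l"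
  unfolding asc_def by (simp add: upt_split[of j i l])

lemma asc_Cons: "j < l \<Longrightarrow> asc j l = Del j # asc (Suc j) l"
  by (simp add: asc_def upt_conv_Cons)

lemma asc_self [simp]: "asc k k = []" by (simp add: asc_def)

lemma length_desc [simp]: "length (desc k j) = j - k" by (simp add: desc_def)
lemma length_asc [simp]: "length (asc k j) = j - k" by (simp add: asc_def)
lemma set_desc: "set (desc k j) = Del ` {k..<j}" by (simp add: desc_def)
lemma set_asc: "set (asc k j) = Del ` {k..<j}" by (simp add: asc_def)

definition chains :: "nat \<Rightarrow> nat \<Rightarrow> nh_gen list set"
  where "chains n k = desc k ` {k..n} \<union> {side_chain n k} \<union> long_chain n k ` {k..n-1}"

lemma desc_in_chains: "k \<le> j \<Longrightarrow> j \<le> n \<Longrightarrow> desc k j \<in> chains n k"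
  and side_chain_in_chains: "side_chain n k \<in> chains n k"
  and long_chain_in_chains: "k \<le> j \<Longrightarrow> j < n \<Longrightarrow> long_chain n k j \<in> chains n k"
  by (auto simp: chains_def)

text \<open>
  For \<open>k = n\<close> nothing is left of the diagram, hence \<open>D\<close> has to be excluded there.
\<close>

definition gens :: "nat \<Rightarrow> nat \<Rightarrow> nh_gen set"
  where "gens n k = Del ` {k..n-1} \<union> (if k < n then {DelD} else {})"

lemma move_past:
  assumes "1 \<le> i" "i \<le> n - 1" "w = desc a b \<or> w = asc a b" "b \<le> n" "1 \<le> a"
    "b < i \<or> i + 1 < a \<or> b \<le> a"
  shows "signed_eq n (Del i # w) (w @ [Del i])"
proof (rule signed_eq_move)
  fix h assume "h \<in> set w"
  then obtain j where j: "h = Del j" "a \<le> j" "j < b" using assms(3) by (auto simp: set_desc set_asc)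
  then show "signed_eq n [Del i, h] [h, Del i]"
    using assms by (auto intro!: signed_eq_gens(2))
qed

lemma moveD_past:
  assumes "w = desc a b \<or> w = asc a b" "b + 2 \<le> n" "1 \<le> a"
  shows "signed_eq n (DelD # w) (w @ [DelD])"
proof (rule signed_eq_move)
  fix h assume "h \<in> set w"
  then obtain j where j: "h = Del j" "a \<le> j" "j < b" using assms(1) by (auto simp: set_desc set_asc)
  then show "signed_eq n [DelD, h] [h, DelD]"
    using assms by (auto intro!: signed_eq_gens(3))
qed

text \<open>
  Moving \<open>\<partial>\<^sub>i\<close> to the right through a descending word meets one braid relation, which raises its index
  by one.
\<close>

lemma slide:
  assumes "1 \<le> k" "k \<le> i" "i + 1 < j" "j \<le> n"
  shows "signed_eq n (Del i # desc k j) (desc k j @ [Del (i+1)])"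
proof -
  have eq: "desc k j = desc (i+2) j @ [Del (i+1), Del i] @ desc k i"
    using assms desc_split[of k "i+2" j] by (simp add: desc_Suc)
  have "signed_eq n (Del i # desc k j) ((desc (i+2) j @ [Del i]) @ [Del (i+1), Del i] @ desc k i)"
    using signed_eq_ctxs(2)[OF move_past[of i n "desc (i+2) j" "i+2" j]] assms unfolding eq by simp
  also have "signed_eq n ((desc (i+2) j @ [Del i]) @ [Del (i+1), Del i] @ desc k i)
      (desc (i+2) j @ [Del (i+1), Del i, Del (i+1)] @ desc k i)"
    using signed_eq_ctx[OF signed_eq_gens(7)[of i n], of "desc (i+2) j" "desc k i"] assms by simp
  also have "signed_eq n \<dots> (desc (i+2) j @ [Del (i+1), Del i] @ desc k i @ [Del (i+1)])"
    using signed_eq_ctxs(1)[OF move_past[of "i+1" n "desc k i" k i], of "desc (i+2) j @ [Del (i+1), Del i]"] assms by simp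
  finally show ?thesis unfolding eq by simp
qed

text \<open>
  The three outcomes when a generator of level \<open>k\<close> is applied to a coset representative: the product
  is not reduced and vanishes, another representative arises, or the coset is fixed and a generator of
  level \<open>k+1\<close> comes out on the right.
\<close>

definition step_ok :: "nat \<Rightarrow> nat \<Rightarrow> nh_gen \<Rightarrow> nh_gen list \<Rightarrow> bool"
  where "step_ok n k g c \<longleftrightarrow> word_zero n (g # c) \<or>
    (\<exists>c'\<in>chains n k. length c' = Suc (length c) \<and> signed_eq n (g # c) c') \<or>
    (\<exists>g'\<in>gens n (Suc k). signed_eq n (g # c) (c @ [g']))"

lemma step_okI:
  "word_zero n (g # c) \<Longrightarrow> step_ok n k g c"
  "c' \<in> chains n k \<Longrightarrow> length c' = Suc (length c) \<Longrightarrow> signed_eq n (g # c) c' \<Longrightarrow> step_ok n k g c"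
  "g' \<in> gens n (Suc k) \<Longrightarrow> signed_eq n (g # c) (c @ [g']) \<Longrightarrow> step_ok n k g c"
  by (auto simp: step_ok_def)

lemma step_desc_Del:
  assumes n: "1 \<le> k" "k < n" and j: "k \<le> j" "j \<le> n" and i: "k \<le> i" "i \<le> n-1"
  shows "step_ok n k (Del i) (desc k j)"
proof -
  consider "i = j" | "Suc i = j" | "i > j" | "i + 1 < j" by linarith
  then show ?thesis
  proof cases
    case 1
    then show ?thesis using assms
      by (intro step_okI(2)[of "desc k (Suc j)"] desc_in_chains) (auto simp: desc_Suc)
  next
    case 2
    have eq: "Del i # desc k j = [] @ [Del i, Del i] @ desc k i" using i desc_Suc[of k i] 2 by simp
    have "word_zero n (Del i # desc k j)"
      unfolding eq by (intro word_zero_ctx signed_eq_gens(11)) (use assms in auto)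
    then show ?thesis by (rule step_okI)
  next
    case 3
    then show ?thesis using assms
      by (intro step_okI(3)[of "Del i"] move_past[of i n _ k j]) (auto simp: gens_def)
  next
    case 4
    then show ?thesis using assms
      by (intro step_okI(3)[of "Del (i+1)"] slide) (auto simp: gens_def)
  qed
qed

lemma step_desc_D:
  assumes n: "1 \<le> k" "k < n" and j: "k \<le> j" "j \<le> n"
  shows "step_ok n k DelD (desc k j)"
proof -
  consider "j = n" | "j = n-1" | "j + 2 \<le> n" using j by linarith
  then show ?thesis
  proof cases
    case 1
    then show ?thesis using assms
      by (intro step_okI(2)[of "long_chain n k (n-1)"] long_chain_in_chains) (auto simp: long_chain_def)
  next
    case 2
    then show ?thesis using assms
      by (intro step_okI(2)[of "side_chain n k"] side_chain_in_chains) (auto simp: side_chain_def)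
  next
    case 3
    then show ?thesis using assms
      by (intro step_okI(3)[of DelD] moveD_past[of _ k j]) (auto simp: gens_def)
  qed
qed

lemma step_M:
  assumes n: "1 \<le> k" "k < n" and g: "g \<in> gens n k"
  shows "step_ok n k g (side_chain n k)"
proof -
  consider "g = DelD" | "g = Del (n-1)" | "g = Del (n-2)" "k + 2 \<le> n"
    | i where "g = Del i" "k \<le> i" "i + 3 \<le> n"
  proof -
    assume a: "g = DelD \<Longrightarrow> thesis" "g = Del (n-1) \<Longrightarrow> thesis" "g = Del (n-2) \<Longrightarrow> k + 2 \<le> n \<Longrightarrow> thesis"
      "\<And>i. g = Del i \<Longrightarrow> k \<le> i \<Longrightarrow> i + 3 \<le> n \<Longrightarrow> thesis"
    show thesis
    proof (cases "g = DelD")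
      case False
      then obtain i where i: "g = Del i" "k \<le> i" "i \<le> n-1" using g by (auto simp: gens_def split: if_splits)
      consider "i = n-1" | "i = n-2" "k+2 \<le> n" | "i + 3 \<le> n" using i n by linarith
      then show thesis using a i by cases auto
    qed (use a in auto)
  qed
  then show ?thesis
  proof cases
    case 1
    then show ?thesis using word_zero_ctx[OF signed_eq_gens(12)[of n], of "[]" "desc k (n-1)"]
      by (intro step_okI(1)) (simp add: side_chain_def)
  next
    case 2
    have "signed_eq n (Del (n-1) # side_chain n k) (long_chain n k (n-1))"
      using signed_eq_ctxs(2)[OF signed_eq_gens(6)[of n], of "desc k (n-1)"] n desc_Suc[of k "n-1"]
      by (simp add: side_chain_def long_chain_def)
    then show ?thesis using 2 n by (intro step_okI(2)[of "long_chain n k (n-1)"] long_chain_in_chains) (auto simp: side_chain_def long_chain_def)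
  next
    case 3
    define m where "m = n - 2"
    have m: "n = Suc (Suc m)" "1 \<le> m" "k \<le> m" "g = Del m" using 3 n by (auto simp: m_def)
    have eq: "desc k (Suc m) = Del m # desc k m" using m by (simp add: desc_Suc)
    have "signed_eq n (Del m # side_chain n k) ([DelD, Del m, DelD] @ desc k m)"
      using signed_eq_ctxs(2)[OF signed_eq_gens(10)[of n], of "desc k m"] m by (simp add: side_chain_def eq)
    also have "signed_eq n \<dots> ([DelD, Del m] @ desc k m @ [DelD])"
      using signed_eq_ctxs(1)[OF moveD_past[of "desc k m" k m n], of "[DelD, Del m]"] m n by simp
    finally have "signed_eq n (Del m # side_chain n k) (side_chain n k @ [DelD])"
      by (simp add: side_chain_def eq m)
    then show ?thesis using m by (intro step_okI(3)[of DelD]) (auto simp: gens_def)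
  next
    case (4 i)
    have "signed_eq n (Del i # side_chain n k) (DelD # Del i # desc k (n-1))"
      using signed_eq_ctxs(2)[OF signed_eq_gens(4)[of i n], of "desc k (n-1)"] n 4 by (simp add: side_chain_def)
    also have "signed_eq n \<dots> (DelD # desc k (n-1) @ [Del (i+1)])"
      by (intro signed_eq_ctxs slide) (use 4 n in auto)
    finally have "signed_eq n (Del i # side_chain n k) (side_chain n k @ [Del (i+1)])" by (simp add: side_chain_def)
    then show ?thesis using 4 by (intro step_okI(3)[of "Del (i+1)"]) (auto simp: gens_def)
  qed
qed

lemma step_U_D:
  assumes n: "1 \<le> k" "k < n" and j: "k \<le> j" "j \<le> n-1"
  shows "step_ok n k DelD (long_chain n k j)"
proof (cases "j = n-1")
  case True
  then show ?thesis using word_zero_ctx[OF signed_eq_gens(12)[of n], of "[]" "desc k n"]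
    by (intro step_okI(1)) (simp add: long_chain_def)
next
  case False
  then have j': "j + 2 \<le> n" using j n by linarith
  define m where "m = n - 2"
  have m: "n = Suc (Suc m)" "j \<le> m" "1 \<le> m" "k \<le> m" using j' n j by (auto simp: m_def)
  have eq: "asc j (Suc m) = asc j m @ [Del m]"
    using asc_split[of j m "Suc m"] asc_Cons[of m "Suc m"] m by simp
  have "signed_eq n (DelD # long_chain n k j) ((asc j m @ [DelD]) @ [Del m, DelD] @ desc k n)"
    using signed_eq_ctxs(2)[OF moveD_past[of "asc j m" j m n], of "[Del m, DelD] @ desc k n"] n m  j
    by (simp add: long_chain_def eq)
  also have "signed_eq n \<dots> (asc j m @ [Del m, DelD, Del m] @ desc k n)"
    using signed_eq_ctx[OF signed_eq_gens(9)[of n], of "asc j m" "desc k n"] m by simp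
  also have "signed_eq n \<dots> (asc j m @ [Del m, DelD] @ desc k n @ [Del (Suc m)])"
    using signed_eq_ctxs(1)[OF slide[of k m n n], of "asc j m @ [Del m, DelD]"] n m by simp
  finally have "signed_eq n (DelD # long_chain n k j) (long_chain n k j @ [Del (Suc m)])" by (simp add: long_chain_def eq m)
  then show ?thesis using m by (intro step_okI(3)[of "Del (Suc m)"]) (auto simp: gens_def)
qed

lemma step_U_Del:
  assumes n: "1 \<le> k" "k < n" and j: "k \<le> j" "j \<le> n-1" and i: "k \<le> i" "i \<le> n-1"
  shows "step_ok n k (Del i) (long_chain n k j)"
proof -
  consider "i = j" "i = n-1" | "i = j" "i < n-1" | "Suc i = j" | "i + 1 < j" | "i > j" "i < n-1" | "i > j" "i = n-1"
    using i by linarith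
  then show ?thesis
  proof cases
    case 1
    have eq: "desc k n = Del (n-1) # desc k (n-1)" using desc_Suc[of k "n-1"] n by simp
    have "signed_eq n (Del i # long_chain n k j) ([DelD] @ [Del (n-1), Del (n-1)] @ desc k (n-1))"
      using signed_eq_ctxs(2)[OF signed_eq_gens(6)[of n], of "desc k n"] 1 by (simp add: long_chain_def eq)
    moreover have "word_zero n ([DelD] @ [Del (n-1), Del (n-1)] @ desc k (n-1))"
      by (intro word_zero_ctx signed_eq_gens(11)) (use n in auto)
    ultimately show ?thesis by (intro step_okI(1)) (rule word_zero_signed_eq)
  next
    case 2
    have eq: "Del i # long_chain n k j = [] @ [Del i, Del i] @ asc (Suc i) (n-1) @ DelD # desc k n"
      using 2 by (simp add: long_chain_def asc_Cons)
    have "word_zero n (Del i # long_chain n k j)" unfolding eq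
      by (intro word_zero_ctx signed_eq_gens(11)) (use n i in auto)
    then show ?thesis by (rule step_okI)
  next
    case 3
    have "asc i (n-1) = Del i # asc j (n-1)" using asc_Cons[of i "n-1"] 3 j by simp
    then have "signed_eq n (Del i # long_chain n k j) (long_chain n k i)" by (simp add: long_chain_def)
    moreover have "length (long_chain n k i) = Suc (length (long_chain n k j))" using 3 j by (simp add: long_chain_def)
    ultimately show ?thesis using assms 3 by (intro step_okI(2)[of "long_chain n k i"] long_chain_in_chains) auto
  next
    case 4
    have "signed_eq n (Del i # long_chain n k j) ((asc j (n-1) @ [Del i]) @ DelD # desc k n)"
      using signed_eq_ctxs(2)[OF move_past[of i n "asc j (n-1)" j "n-1"], of "DelD # desc k n"] n i j 4 by (simp add: long_chain_def)
    also have "signed_eq n \<dots> (asc j (n-1) @ [DelD, Del i] @ desc k n)"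
      using signed_eq_ctx[OF signed_eq_gens(4)[of i n], of "asc j (n-1)" "desc k n"] n i j 4 by simp
    also have "signed_eq n \<dots> (asc j (n-1) @ [DelD] @ desc k n @ [Del (i+1)])"
      using signed_eq_ctxs(1)[OF slide[of k i n n], of "asc j (n-1) @ [DelD]"] n i j 4 by simp
    finally have "signed_eq n (Del i # long_chain n k j) (long_chain n k j @ [Del (i+1)])" by (simp add: long_chain_def)
    then show ?thesis using 4 i j by (intro step_okI(3)[of "Del (i+1)"]) (auto simp: gens_def)
  next
    case 5
    define m where "m = i - 1"
    have m: "i = m + 1" "j \<le> m" "m + 2 < n" "1 \<le> m" "k \<le> m" using 5 n j by (auto simp: m_def)
    have eq: "asc j (n-1) = asc j m @ [Del m, Del (m+1)] @ asc (m+2) (n-1)"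
      using asc_split[of j m "n-1"] asc_Cons[of m "n-1"] asc_Cons[of "Suc m" "n-1"] m by simp
    let ?r = "DelD # desc k n"
    have eqU: "long_chain n k j = asc j m @ [Del m, Del (m+1)] @ asc (m+2) (n-1) @ ?r"
      by (simp only: long_chain_def eq append_assoc)
    have "signed_eq n (Del i # long_chain n k j) ((asc j m @ [Del (m+1)]) @ [Del m, Del (m+1)] @ asc (m+2) (n-1) @ ?r)"
      using signed_eq_ctxs(2)[OF move_past[of i n "asc j m" j m], of "[Del m, Del (m+1)] @ asc (m+2) (n-1) @ ?r"] n i j m
      by (simp add: eqU)
    also have "signed_eq n \<dots> (asc j m @ [Del m, Del (m+1), Del m] @ asc (m+2) (n-1) @ ?r)"
      using signed_eq_ctx[OF signed_eq_gens(8)[of m n], of "asc j m" "asc (m+2) (n-1) @ ?r"] n i j m by simp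
    also have "signed_eq n \<dots> (asc j m @ [Del m, Del (m+1)] @ (asc (m+2) (n-1) @ [Del m]) @ ?r)"
      using signed_eq_ctx[OF move_past[of m n "asc (m+2) (n-1)" "m+2" "n-1"], of "asc j m @ [Del m, Del (m+1)]" ?r] n i j m by simp
    also have "signed_eq n \<dots> (asc j m @ [Del m, Del (m+1)] @ asc (m+2) (n-1) @ [DelD, Del m] @ desc k n)"
      using signed_eq_ctx[OF signed_eq_gens(4)[of m n], of "asc j m @ [Del m, Del (m+1)] @ asc (m+2) (n-1)" "desc k n"] n i j m by simp
    also have "signed_eq n \<dots> (asc j m @ [Del m, Del (m+1)] @ asc (m+2) (n-1) @ [DelD] @ desc k n @ [Del (m+1)])"
      using signed_eq_ctxs(1)[OF slide[of k m n n], of "asc j m @ [Del m, Del (m+1)] @ asc (m+2) (n-1) @ [DelD]"] n i j m by simp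
    finally have "signed_eq n (Del i # long_chain n k j) (long_chain n k j @ [Del i])" by (simp add: eqU m)
    then show ?thesis using 5 i j by (intro step_okI(3)[of "Del i"]) (auto simp: gens_def)
  next
    case 6
    define m where "m = n - 2"
    have m: "n = Suc (Suc m)" "n - 1 = Suc m" "j \<le> m" "1 \<le> m" "k \<le> m" "i = Suc m" using 6 n j by (auto simp: m_def)
    have eq: "asc j (Suc m) = asc j m @ [Del m]"
      using asc_split[of j m "Suc m"] asc_Cons[of m "Suc m"] m by simp
    have eqU': "long_chain (Suc (Suc m)) k j = asc j m @ [Del m, DelD] @ desc k (Suc (Suc m))"
      using eq by (simp add: long_chain_def)
    note eqU = eqU' eqU'[folded m(1)]
    have eq2': "desc k (Suc (Suc m)) = Del (Suc m) # Del m # desc k m" using m by (simp add: desc_Suc)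
    note eq2 = eq2' eq2'[folded m(1)]
    have "signed_eq n (Del i # long_chain n k j) ((asc j m @ [Del (Suc m)]) @ [Del m, DelD] @ desc k n)"
      using signed_eq_ctxs(2)[OF move_past[of i n "asc j m" j m], of "[Del m, DelD] @ desc k n"] n i j m
      by (simp add: eqU)
    also have "signed_eq n \<dots> ((asc j m @ [Del (Suc m), Del m]) @ [Del (Suc m), DelD] @ Del m # desc k m)"
      using signed_eq_ctx[OF signed_eq_gens(5)[of n], of "asc j m @ [Del (Suc m), Del m]" "Del m # desc k m"] m
      by (simp add: eq2)
    also have "signed_eq n \<dots> (asc j m @ [Del m, Del (Suc m), Del m] @ DelD # Del m # desc k m)"
      using signed_eq_ctx[OF signed_eq_gens(8)[of m n], of "asc j m" "DelD # Del m # desc k m"] m by simp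
    also have "signed_eq n \<dots> ((asc j m @ [Del m, Del (Suc m)]) @ [DelD, Del m, DelD] @ desc k m)"
      using signed_eq_ctx[OF signed_eq_gens(10)[of n], of "asc j m @ [Del m, Del (Suc m)]" "desc k m"] m by simp
    also have "signed_eq n \<dots> ((asc j m @ [Del m, Del (Suc m), DelD, Del m]) @ desc k m @ [DelD])"
      using signed_eq_ctxs(1)[OF moveD_past[of "desc k m" k m n], of "asc j m @ [Del m, Del (Suc m), DelD, Del m]"] m n by simp
    also have "signed_eq n \<dots> ((asc j m @ [Del m]) @ [DelD, Del (Suc m)] @ Del m # desc k m @ [DelD])"
      using signed_eq_ctx[OF signed_eq_gens(6)[of n], of "asc j m @ [Del m]" "Del m # desc k m @ [DelD]"] m by simp
    finally have "signed_eq n (Del i # long_chain n k j) (long_chain n k j @ [DelD])" by (simp add: eqU eq2)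
    then show ?thesis using 6 i j by (intro step_okI(3)[of DelD]) (auto simp: gens_def)
  qed
qed

lemma chain_step:
  assumes "1 \<le> k" "k < n" "g \<in> gens n k" "c \<in> chains n k"
  shows "step_ok n k g c"
  using assms step_desc_Del step_desc_D step_M step_U_D step_U_Del
  by (auto simp: gens_def chains_def)

text \<open>
  The second argument is \<open>n - k\<close>, so that the recursion runs through the levels
  \<open>k = n, n-1, \<dots>, 1\<close>.
\<close>

fun nc_words :: "nat \<Rightarrow> nat \<Rightarrow> nh_gen list set"
  where
  "nc_words n 0 = {[]}"
| "nc_words n (Suc d) = {c @ u | c u. c \<in> chains n (n - Suc d) \<and> u \<in> nc_words n d}"

lemma Nil_in_chains: "k \<le> n \<Longrightarrow> [] \<in> chains n k"
  by (force simp: chains_def)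

lemma Nil_in_nc_words: "[] \<in> nc_words n d"
  by (induction d) (auto simp: Nil_in_chains)

lemma nc_words_step:
  assumes "d < n" "g \<in> gens n (n - d)" "u \<in> nc_words n d"
  shows "word_zero n (g # u) \<or> (\<exists>u'\<in>nc_words n d. length u' = Suc (length u) \<and> signed_eq n (g # u) u')"
  using assms
proof (induction d arbitrary: g u)
  case 0
  then show ?case by (auto simp: gens_def)
next
  case (Suc d)
  obtain c v where u: "u = c @ v" "c \<in> chains n (n - Suc d)" "v \<in> nc_words n d" using Suc.prems by auto
  have s: "Suc (n - Suc d) = n - d" using Suc.prems by simp
  have "step_ok n (n - Suc d) g c"
    using Suc.prems u by (intro chain_step) auto
  then consider "word_zero n (g # c)"
    | c' where "c' \<in> chains n (n - Suc d)" "length c' = Suc (length c)" "signed_eq n (g # c) c'"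
    | g' where "g' \<in> gens n (n - d)" "signed_eq n (g # c) (c @ [g'])"
    unfolding step_ok_def s by blast
  then show ?case
  proof cases
    case 1
    then show ?thesis using word_zero_ctx[of n "g # c" "[]" v] u by simp
  next
    case 2
    then show ?thesis using signed_eq_ctxs(2)[of n "g # c" c' v] u 
      by (intro disjI2 bexI[of _ "c' @ v"]) auto
  next
    case 3
    have s1: "signed_eq n (g # u) (c @ g' # v)" using signed_eq_ctxs(2)[OF 3(2), of v] u by simp
    from Suc.IH[of g' v] 3(1) u(3) Suc.prems
    consider "word_zero n (g' # v)" | v' where "v' \<in> nc_words n d" "length v' = Suc (length v)" "signed_eq n (g' # v) v'" by auto
    then show ?thesis
    proof cases
      case 1
      then have "word_zero n (c @ g' # v)" using word_zero_ctx[of n "g' # v" c "[]"] by simp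
      then show ?thesis using word_zero_signed_eq[OF s1] by blast
    next
      case 2
      then have "signed_eq n (g # u) (c @ v')" using signed_eq_trans[OF s1 signed_eq_ctxs(1)[OF 2(3)]] by simp
      then show ?thesis using 2 u by (intro disjI2 bexI[of _ "c @ v'"]) auto
    qed
  qed
qed

section \<open>Spanning\<close>

fun x_words :: "nat \<Rightarrow> nh_gen list set"
  where
  "x_words 0 = {[]}"
| "x_words (Suc m) = {w @ replicate k (X (Suc m)) | w k. w \<in> x_words m}"

lemma set_x_words: "w \<in> x_words m \<Longrightarrow> set w \<subseteq> X ` {1..m}"
  by (induction m arbitrary: w) (fastforce split: if_splits)+

lemma Nil_in_x_words: "[] \<in> x_words m"
  by (induction m) (auto intro: exI[of _ 0])

lemma x_words_step:
  assumes "m \<le> n" "1 \<le> i" "i \<le> m" "w \<in> x_words m"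
  shows "\<exists>w'\<in>x_words m. length w' = Suc (length w) \<and> signed_eq n (X i # w) w'"
  using assms
proof (induction m arbitrary: w)
  case (Suc m)
  obtain v k where w: "w = v @ replicate k (X (Suc m))" "v \<in> x_words m" using Suc.prems by auto
  show ?case
  proof (cases "i = Suc m")
    case True
    have "signed_eq n [X i, h] [h, X i]" if "h \<in> set v" for h
    proof -
      have "h \<in> X ` {1..m}" using set_x_words[OF w(2)] that by blast
      then obtain j where "h = X j" "1 \<le> j" "j \<le> m" by auto
      then show ?thesis using True Suc.prems by (auto intro: signed_eq_gens(1))
    qed
    then have "signed_eq n (X i # v) (v @ [X i])" by (rule signed_eq_move)
    from signed_eq_ctxs(2)[OF this, of "replicate k (X (Suc m))"]
    have "signed_eq n (X i # w) (v @ replicate (Suc k) (X (Suc m)))" by (simp add: w True)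
    then show ?thesis using w by (intro bexI[of _ "v @ replicate (Suc k) (X (Suc m))"]) (auto intro!: exI[of _ "Suc k"])
  next
    case False
    then obtain v' where "v' \<in> x_words m" "length v' = Suc (length v)" "signed_eq n (X i # v) v'"
      using Suc.IH[OF _ _ _ w(2)] Suc.prems by auto
    then show ?thesis using signed_eq_ctxs(2)[of n "X i # v" v' "replicate k (X (Suc m))"] w
      by (intro bexI[of _ "v' @ replicate k (X (Suc m))"]) auto
  qed
qed simp

definition bideg :: "nh_gen list \<Rightarrow> int \<times> bit"
  where "bideg w = (sum_list (map gen_deg w), of_nat (length w))"

lemma bideg_Cons: "bideg (g # w) = bideg [g] + bideg w"
  by (simp add: bideg_def)

lemma bideg_Nil [simp]: "bideg [] = 0"
  by (simp add: bideg_def zero_prod_def)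

lemma bideg_append: "bideg (u @ w) = bideg u + bideg w"
  by (simp add: bideg_def)

lemma bideg_eq_of_length:
  assumes "set u \<subseteq> range X \<and> set v \<subseteq> range X \<or> (set u \<union> set v) \<inter> range X = {}" "length u = length v"
  shows "bideg u = bideg v"
proof -
  have x: "sum_list (map gen_deg w) = 2 * int (length w)" if "set w \<subseteq> range X" for w
    using that by (induction w) auto
  have d: "sum_list (map gen_deg w) = - 2 * int (length w)" if "set w \<inter> range X = {}" for w
    using that
  proof (induction w)
    case (Cons g w)
    then show ?case by (cases g) auto
  qed simp
  show ?thesis using assms x[of u] x[of v] d[of u] d[of v] by (auto simp: bideg_def Int_Un_distrib2)
qed

lemma set_chains: "c \<in> chains n k \<Longrightarrow> k < n \<Longrightarrow> set c \<subseteq> gens n k"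
  by (auto simp: chains_def side_chain_def long_chain_def set_desc set_asc gens_def)

lemma gens_mono: "k \<le> l \<Longrightarrow> gens n l \<subseteq> gens n k"
  by (auto simp: gens_def split: if_splits)

lemma set_nc_words: "d < n \<Longrightarrow> u \<in> nc_words n d \<Longrightarrow> set u \<subseteq> gens n (n - d)"
proof (induction d arbitrary: u)
  case (Suc d)
  then obtain c v where "u = c @ v" "c \<in> chains n (n - Suc d)" "v \<in> nc_words n d" by auto
  then show ?case using Suc set_chains[of c n "n - Suc d"] gens_mono[of "n - Suc d" "n - d" n] by fastforce
qed simp

definition NC_words :: "nat \<Rightarrow> nh_gen list set" where "NC_words n = nc_words n (n-1)"
definition normal_words :: "nat \<Rightarrow> nh_gen list set" where "normal_words n = {w @ u | w u. w \<in> x_words n \<and> u \<in> NC_words n}"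

text \<open>
  The polynomials that are congruent to integer combinations of the words in \<open>K\<close>.
\<close>

definition span_mod :: "nat \<Rightarrow> nh_gen list set \<Rightarrow> nh_gen fpoly set"
  where "span_mod n K = {f. \<exists>g. keys g \<subseteq> Word ` K \<and> f - g \<in> idl (nh_relators n)}"

lemma span_mod_mono: "K \<subseteq> K' \<Longrightarrow> span_mod n K \<subseteq> span_mod n K'"
  by (auto simp: span_mod_def) (meson image_mono subset_trans)

lemma NC_words_subset_normal_words: "NC_words n \<subseteq> normal_words n"
proof
  fix u assume "u \<in> NC_words n"
  then have "[] @ u \<in> normal_words n" using Nil_in_x_words[of n] unfolding normal_words_def by blast
  then show "u \<in> normal_words n" by simp
qed

lemma span_mod_0: "0 \<in> span_mod n K"
  by (auto simp: span_mod_def idl.zero intro!: exI[of _ 0])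

lemma span_mod_idl: "f \<in> idl (nh_relators n) \<Longrightarrow> f \<in> span_mod n K"
  by (auto simp: span_mod_def intro!: exI[of _ 0])

lemma span_mod_mon: "w \<in> K \<Longrightarrow> mon w \<in> span_mod n K"
  by (auto simp: span_mod_def idl.zero intro!: exI[of _ "mon w"])

lemma span_mod_diff: 
  assumes "f \<in> span_mod n K" "g \<in> span_mod n K" shows "f - g \<in> span_mod n K"
proof -
  obtain f' g' where *: "keys f' \<subseteq> Word ` K" "f - f' \<in> idl (nh_relators n)"
    "keys g' \<subseteq> Word ` K" "g - g' \<in> idl (nh_relators n)"
    using assms by (auto simp: span_mod_def)
  have "(f - g) - (f' - g') = (f - f') - (g - g')" by simp
  then have "(f - g) - (f' - g') \<in> idl (nh_relators n)" using * by (metis idl_diff)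
  then show ?thesis using * keys_diff[of f' g'] by (auto simp: span_mod_def intro!: exI[of _ "f' - g'"])
qed

lemma span_mod_uminus: "f \<in> span_mod n K \<Longrightarrow> - f \<in> span_mod n K"
  using span_mod_diff[OF span_mod_0] by fastforce

lemma span_mod_add: "f \<in> span_mod n K \<Longrightarrow> g \<in> span_mod n K \<Longrightarrow> f + g \<in> span_mod n K"
  using span_mod_diff[OF _ span_mod_uminus] by fastforce

lemma span_mod_shift: "f - g \<in> idl (nh_relators n) \<Longrightarrow> g \<in> span_mod n K \<Longrightarrow> f \<in> span_mod n K"
  using span_mod_add[OF span_mod_idl] by fastforce

lemma span_mod_signed_eq: "signed_eq n u v \<Longrightarrow> v \<in> K \<Longrightarrow> mon u \<in> span_mod n K"
proof -
  assume a: "signed_eq n u v" "v \<in> K"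
  have "mon u - mon v \<in> idl (nh_relators n) \<or> mon u - - mon v \<in> idl (nh_relators n)"
    using a(1) by (simp add: signed_eq_def)
  then show ?thesis using span_mod_shift span_mod_mon[OF a(2)] span_mod_uminus by blast
qed

lemma span_mod_mult:
  assumes "f \<in> span_mod n K" "\<And>w. w \<in> K \<Longrightarrow> a * mon w \<in> span_mod n K'"
  shows "a * f \<in> span_mod n K'"
proof -
  obtain g where g: "keys g \<subseteq> Word ` K" "f - g \<in> idl (nh_relators n)"
    using assms by (auto simp: span_mod_def)
  have "a * g \<in> span_mod n K'" using g(1)
  proof (induction g rule: frag_induction)
    case (diff b c)
    then show ?case by (simp add: span_mod_diff algebra_simps)
  qed (use assms(2) span_mod_0 in auto)
  moreover have "a * f - a * g \<in> idl (nh_relators n)"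
    using idl_mult_left[OF g(2), of a] by (simp add: algebra_simps)
  ultimately show ?thesis by (rule span_mod_shift[rotated])
qed

lemma span_mod_mult_mon:
  assumes "d < n" "g \<in> gens n (n - d)" "u \<in> nc_words n d"
  shows "mon (g # u) \<in> span_mod n {v \<in> nc_words n d. bideg v = bideg (g # u)}"
proof -
  from nc_words_step[OF assms] consider "word_zero n (g # u)"
    | v where "v \<in> nc_words n d" "length v = Suc (length u)" "signed_eq n (g # u) v" by blast
  then show ?thesis
  proof cases
    case 1
    then show ?thesis by (intro span_mod_idl) (simp add: word_zero_def)
  next
    case 2
    have "gens n (n - d) \<inter> range X = {}" by (auto simp: gens_def)
    then have "bideg v = bideg (g # u)"
      using set_nc_words[OF assms(1)] assms(2,3) 2 by (intro bideg_eq_of_length) auto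
    then show ?thesis using 2 by (intro span_mod_signed_eq[of n _ v]) auto
  qed
qed

definition normal_words_of :: "nat \<Rightarrow> int \<times> bit \<Rightarrow> nh_gen list set"
  where "normal_words_of n e = {w \<in> normal_words n. bideg w = e}"

lemma span_mod_X:
  assumes "i \<in> {1..n}" "f \<in> span_mod n (normal_words_of n e)"
  shows "xg i * f \<in> span_mod n (normal_words_of n (bideg [X i] + e))"
proof (rule span_mod_mult[OF assms(2)])
  fix w assume "w \<in> normal_words_of n e"
  then obtain v u where w: "w = v @ u" "v \<in> x_words n" "u \<in> NC_words n" "bideg w = e" by (auto simp: normal_words_of_def normal_words_def)
  obtain v' where v': "v' \<in> x_words n" "length v' = Suc (length v)" "signed_eq n (X i # v) v'"
    using x_words_step[of n n i v] assms w by auto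
  have "bideg v' = bideg (X i # v)"
    using set_x_words[OF w(2)] set_x_words[OF v'(1)] v' by (intro bideg_eq_of_length) auto
  then have "v' @ u \<in> normal_words_of n (bideg [X i] + e)"
    using w v' by (auto simp: normal_words_of_def normal_words_def bideg_append bideg_Cons[of "X i" v])
  moreover have "signed_eq n (X i # w) (v' @ u)" using signed_eq_ctxs(2)[OF v'(3), of u] by (simp add: w)
  ultimately show "xg i * mon w \<in> span_mod n (normal_words_of n (bideg [X i] + e))"
    unfolding mon_Cons[symmetric] by (rule span_mod_signed_eq[rotated])
qed

lemma span_mod_Xs:
  assumes "set v \<subseteq> X ` {1..n}" "f \<in> span_mod n (normal_words_of n e)"
  shows "mon v * f \<in> span_mod n (normal_words_of n (bideg v + e))"
  using assms(1)
proof (induction v)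
  case Nil
  then show ?case using assms(2) by (simp add: mon_Nil)
next
  case (Cons g v)
  then obtain i where "g = X i" "i \<in> {1..n}" by auto
  then show ?case using span_mod_X[of i n "mon v * f"] Cons
    by (simp add: mon_Cons mult.assoc bideg_Cons[of "X i" v] add.assoc)
qed

text \<open>
  Moving a \<open>\<partial>\<close> past an \<open>x\<close> yields a signed term with both letters interchanged and a constant that is
  \<open>0\<close> or \<open>\<plusminus>1\<close>; only these five sign patterns occur.
\<close>

lemma del_past_x:
  assumes "n \<ge> 2" "g \<in> gens n 1" "j \<in> {1..n}"
  shows "\<exists>l\<in>{1..n}. fvar g * xg j - xg l * fvar g \<in> idl (nh_relators n)
    \<or> fvar g * xg j + xg l * fvar g \<in> idl (nh_relators n)
    \<or> fvar g * xg j - xg l * fvar g - 1 \<in> idl (nh_relators n)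
    \<or> fvar g * xg j - xg l * fvar g + 1 \<in> idl (nh_relators n)
    \<or> fvar g * xg j + xg l * fvar g - 1 \<in> idl (nh_relators n)"
proof (cases "g = DelD")
  case True
  consider "j = n - 1" | "j = n" | "j \<noteq> n" "j \<noteq> n - 1" by blast
  then show ?thesis
  proof cases
    case 1
    then show ?thesis using assms True idl_gen[OF nh_relators.delD_x[of n]] by (intro bexI[of _ n]) auto
  next
    case 2
    then show ?thesis using assms True idl_uminus[OF idl_gen[OF nh_relators.x_delD[of n]]]
      by (intro bexI[of _ "n-1"]) (auto simp: algebra_simps)
  next
    case 3
    then have "j + 2 \<le> n" using assms by auto
    then show ?thesis using assms True idl_gen[OF nh_relators.delD_x_far[of j n]] by (intro bexI[of _ j]) auto
  qed
next
  case False
  then obtain i where i: "g = Del i" "i \<in> {1..n-1}" using assms by (auto simp: gens_def split: if_splits)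
  consider "j = i" | "j = i + 1" | "j \<noteq> i" "j \<noteq> i + 1" by blast
  then show ?thesis
  proof cases
    case 1
    then show ?thesis using assms i idl_gen[OF nh_relators.del_x[of i n]] by (intro bexI[of _ "i+1"]) auto
  next
    case 2
    then show ?thesis using assms i idl_gen[OF nh_relators.x_del[of i n]]
      by (intro bexI[of _ i]) (auto simp: algebra_simps)
  next
    case 3
    then show ?thesis using assms i idl_gen[OF nh_relators.del_x_far[of i n j]] by (intro bexI[of _ j]) auto
  qed
qed

lemma span_mod_del:
  assumes "n \<ge> 2" "g \<in> gens n 1" "set v \<subseteq> X ` {1..n}" "u \<in> NC_words n"
  shows "mon (g # v @ u) \<in> span_mod n (normal_words_of n (bideg (g # v @ u)))"
  using assms(3)
proof (induction v)
  case Nil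
  have "mon (g # u) \<in> span_mod n {v \<in> nc_words n (n-1). bideg v = bideg (g # u)}"
    using span_mod_mult_mon[of "n-1" n g u] assms(1,2,4) by (simp add: NC_words_def)
  moreover have "{v \<in> nc_words n (n-1). bideg v = bideg (g # u)} \<subseteq> normal_words_of n (bideg (g # u))"
    using NC_words_subset_normal_words[of n] by (auto simp: normal_words_of_def NC_words_def)
  ultimately show ?case using subsetD[OF span_mod_mono] by (metis append_Nil)
next
  case (Cons h v)
  then obtain j where j: "h = X j" "j \<in> {1..n}" by auto
  let ?r = "mon (v @ u)"
  let ?e = "bideg (g # (h # v) @ u)"
  have dg: "bideg [X l] + bideg (g # v @ u) = ?e" for l
    by (simp add: j bideg_def)
  have "bideg [g] + bideg [X j] = 0"
    using assms(2) by (auto simp: bideg_def gens_def zero_prod_def split: if_splits)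
  moreover have "?e = (bideg [g] + bideg [X j]) + bideg (v @ u)" by (simp add: j bideg_def)
  ultimately have dg2: "bideg (v @ u) = ?e" by simp
  have "mon u \<in> span_mod n (normal_words_of n (bideg u))"
    using NC_words_subset_normal_words[of n] assms(4) by (intro span_mod_mon) (auto simp: normal_words_of_def)
  then have r: "?r \<in> span_mod n (normal_words_of n ?e)"
    using span_mod_Xs[of v n "mon u" "bideg u"] Cons.prems dg2 unfolding mon_append bideg_append by auto
  have x: "xg l * fvar g * ?r \<in> span_mod n (normal_words_of n ?e)" if "l \<in> {1..n}" for l
    using span_mod_X[OF that Cons.IH] Cons.prems unfolding dg by (simp add: mon_Cons mult.assoc)
  obtain l where l: "l \<in> {1..n}" and
    disj: "fvar g * xg j - xg l * fvar g \<in> idl (nh_relators n)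
    \<or> fvar g * xg j + xg l * fvar g \<in> idl (nh_relators n)
    \<or> fvar g * xg j - xg l * fvar g - 1 \<in> idl (nh_relators n)
    \<or> fvar g * xg j - xg l * fvar g + 1 \<in> idl (nh_relators n)
    \<or> fvar g * xg j + xg l * fvar g - 1 \<in> idl (nh_relators n)"
    using del_past_x[OF assms(1,2) j(2)] by blast
  have eq: "mon (g # (h # v) @ u) = fvar g * xg j * ?r" by (simp add: mon_Cons j mult.assoc)
  let ?x = "xg l * fvar g * ?r"
  let ?a = "fvar g * xg j" and ?b = "xg l * fvar g"
  have sh: "mon (g # (h # v) @ u) \<in> span_mod n (normal_words_of n ?e)" if "c \<in> idl (nh_relators n)" "c * ?r = ?a * ?r - f" "f \<in> span_mod n (normal_words_of n ?e)" for c f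
    using span_mod_shift[of "?a * ?r" f] idl_mult_right[OF that(1), of ?r] that unfolding eq by simp
  note xl = x[OF l] and alg = left_diff_distrib distrib_right
  from disj show ?case
  proof (elim disjE)
    assume "?a - ?b \<in> idl (nh_relators n)"
    then show ?thesis by (rule sh[of _ ?x]) (simp_all only: alg xl)
  next
    assume "?a + ?b \<in> idl (nh_relators n)"
    then show ?thesis by (rule sh[of _ "- ?x"]) (simp_all only: alg span_mod_uminus[OF xl], simp)
  next
    assume "?a - ?b - 1 \<in> idl (nh_relators n)"
    then show ?thesis by (rule sh[of _ "?x + ?r"]) (simp_all only: alg span_mod_add[OF xl r], simp)
  next
    assume "?a - ?b + 1 \<in> idl (nh_relators n)"
    then show ?thesis by (rule sh[of _ "?x - ?r"]) (simp_all only: alg span_mod_diff[OF xl r], simp)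
  next
    assume "?a + ?b - 1 \<in> idl (nh_relators n)"
    then show ?thesis by (rule sh[of _ "- ?x + ?r"]) (simp_all only: alg span_mod_add[OF span_mod_uminus[OF xl] r], simp)
  qed
qed

lemma nh_gens_cases: "nh_gens n = X ` {1..n} \<union> gens n 1" if "n \<ge> 2"
  using that by (auto simp: nh_gens_def gens_def)

text \<open>
  Each rewriting step preserves degree and parity, so normal forms exist inside each bidegree; this
  is what later shows that the graded pieces are spanned by normal words.
\<close>

lemma spanning_word:
  assumes "n \<ge> 2" "set w \<subseteq> nh_gens n"
  shows "mon w \<in> span_mod n (normal_words_of n (bideg w))"
  using assms(2)
proof (induction w)
  case Nil
  have "[] \<in> normal_words n" using NC_words_subset_normal_words[of n] Nil_in_nc_words[of n "n-1"] by (auto simp: NC_words_def)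
  then show ?case by (intro span_mod_mon) (auto simp: normal_words_of_def)
next
  case (Cons g w)
  then have IH: "mon w \<in> span_mod n (normal_words_of n (bideg w))" by simp
  show ?case
  proof (cases "g \<in> X ` {1..n}")
    case True
    then obtain i where i: "g = X i" "i \<in> {1..n}" by blast
    show ?thesis using span_mod_X[OF i(2) IH] unfolding i(1) mon_Cons bideg_Cons[of _ w] .
  next
    case False
    then have g: "g \<in> gens n 1" using Cons.prems nh_gens_cases[OF assms(1)] by auto
    show ?thesis unfolding mon_Cons
    proof (rule span_mod_mult[OF IH])
      fix b assume "b \<in> normal_words_of n (bideg w)"
      then obtain v u where b: "b = v @ u" "v \<in> x_words n" "u \<in> NC_words n" "bideg b = bideg w"
        by (auto simp: normal_words_of_def normal_words_def)
      then show "fvar g * mon b \<in> span_mod n (normal_words_of n (bideg (g # w)))"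
        using span_mod_del[OF assms(1) g set_x_words[OF b(2)] b(3)] unfolding b(1)[symmetric] mon_Cons
        by (metis b(4) bideg_Cons)
    qed
  qed
qed

lemma spanning_NC_word:
  assumes "n \<ge> 2" "set w \<subseteq> gens n 1" "f \<in> span_mod n (NC_words n)"
  shows "mon w * f \<in> span_mod n (NC_words n)"
  using assms(2)
proof (induction w)
  case Nil
  then show ?case using assms(3) by (simp add: mon_Nil)
next
  case (Cons g w)
  have "mon (g # u) \<in> span_mod n (NC_words n)" if "u \<in> NC_words n" for u
  proof -
    have "mon (g # u) \<in> span_mod n {v \<in> nc_words n (n-1). bideg v = bideg (g # u)}"
      using span_mod_mult_mon[of "n-1" n g u] Cons.prems assms(1) that by (simp add: NC_words_def)
    moreover have "{v \<in> nc_words n (n-1). bideg v = bideg (g # u)} \<subseteq> NC_words n" by (auto simp: NC_words_def)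
    ultimately show ?thesis by (rule subsetD[OF span_mod_mono, rotated])
  qed
  then show ?case using span_mod_mult[of "mon w * f" n "NC_words n" "fvar g" "NC_words n"] Cons by (simp add: mon_Cons mult.assoc)
qed

section \<open>Constant terms and degrees\<close>

definition eps :: "spol \<Rightarrow> int" where "eps = sp_eval (\<lambda>_. 0)"

lemma eps_simps [simp]:
  "eps 0 = 0" "eps 1 = 1" "eps (p + q) = eps p + eps q" "eps (p - q) = eps p - eps q"
  "eps (- p) = - eps p" "eps (p * q) = eps p * eps q" "eps (sx i) = 0"
  by (simp_all add: eps_def sp_eval_simps)

lemma eps_of_int [simp]: "eps (of_int c) = c"
  by (induction c rule: int_induct[where k = 0]) simp_all

lemma of_int_spol_eq_iff: "(of_int a :: spol) = of_int b \<longleftrightarrow> a = b"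
  by (metis eps_of_int)

text \<open>
  \<open>homog V d\<close> consists of the homogeneous polynomials in the variables from \<open>V\<close>, each variable counted
  with degree \<open>1\<close>. The set \<open>V\<close> is a parameter because the nonvanishing argument needs a polynomial
  that involves only the variables of one level.
\<close>

inductive homog :: "nat set \<Rightarrow> nat \<Rightarrow> spol \<Rightarrow> bool" for V
  where
  zero: "homog V d 0"
| one: "homog V 0 1"
| var: "i \<in> V \<Longrightarrow> homog V d p \<Longrightarrow> homog V (Suc d) (sx i * p)"
| diff: "homog V d p \<Longrightarrow> homog V d q \<Longrightarrow> homog V d (p - q)"

lemma homog_uminus: "homog V d p \<Longrightarrow> homog V d (- p)"
  using homog.diff[OF homog.zero] by fastforce

lemma homog_add: "homog V d p \<Longrightarrow> homog V d q \<Longrightarrow> homog V d (p + q)"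
  using homog.diff[OF _ homog_uminus] by fastforce

lemma homog_mult: "homog V d p \<Longrightarrow> homog V e q \<Longrightarrow> homog V (d + e) (p * q)"
  by (induction rule: homog.induct) (auto intro: homog.intros simp: mult.assoc left_diff_distrib)

lemma homog_power: "i \<in> V \<Longrightarrow> homog V j (sx i ^ j)"
  by (induction j) (auto intro: homog.intros)

lemma homog_0_eq: "homog V 0 p \<Longrightarrow> p = of_int (eps p)"
proof -
  have "homog V d p \<Longrightarrow> d = 0 \<longrightarrow> p = of_int (eps p)" for d
  proof (induction rule: homog.induct)
    case (diff d p q)
    then show ?case by (metis eps_simps(4) of_int_diff)
  qed simp_all
  then show "homog V 0 p \<Longrightarrow> p = of_int (eps p)" by blast
qed

lemma homog_1_eq:
  assumes "finite V" "homog V 1 p"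
  shows "\<exists>c. p = (\<Sum>i\<in>V. of_int (c i) * sx i)"
proof -
  have "homog V d p \<Longrightarrow> d = 1 \<longrightarrow> (\<exists>c. p = (\<Sum>i\<in>V. of_int (c i) * sx i))" for d
  proof (induction rule: homog.induct)
    case (zero d)
    show ?case by (auto intro: exI[of _ "\<lambda>_. 0"])
  next
    case (var i d p)
    show ?case
    proof
      assume "Suc d = 1"
      then have p: "p = of_int (eps p)" using homog_0_eq var by simp
      have "sx i * p = of_int (eps p) * sx i" by (subst p) (simp add: mult_of_int_commute)
      also have "\<dots> = (\<Sum>j\<in>V. if j = i then of_int (eps p) * sx j else 0)"
        using assms var by simp
      also have "\<dots> = (\<Sum>j\<in>V. of_int (if j = i then eps p else 0) * sx j)"
        by (rule sum.cong) auto
      finally show "\<exists>c. sx i * p = (\<Sum>j\<in>V. of_int (c j) * sx j)"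
        by (intro exI[of _ "\<lambda>j. if j = i then eps p else 0"])
    qed
  next
    case (diff d p q)
    show ?case
    proof
      assume "d = 1"
      then obtain a b where "p = (\<Sum>i\<in>V. of_int (a i) * sx i)" "q = (\<Sum>i\<in>V. of_int (b i) * sx i)"
        using diff by blast
      then have "p - q = (\<Sum>i\<in>V. of_int (a i - b i) * sx i)"
        by (simp add: left_diff_distrib sum_subtractf)
      then show "\<exists>c. p - q = (\<Sum>j\<in>V. of_int (c j) * sx j)" by (intro exI[of _ "\<lambda>i. a i - b i"])
    qed
  qed simp
  then show ?thesis using assms by blast
qed

lemma homog_del_op:
  assumes "homog V d p" "k \<in> V" "Suc k \<in> V"
  shows "if d = 0 then del_op k p = 0 else homog V (d - 1) (del_op k p)"
  using assms(1)
proof (induction rule: homog.induct)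
  case (var i d p)
  have dp: "homog V d (sx j * del_op k p)" if "j \<in> V" for j
    using var.IH homog.var[OF that, of "d - 1" "del_op k p"] by (auto split: if_splits intro: homog.zero)
  consider "i = k" | "i = Suc k" | "i \<noteq> k" "i \<noteq> Suc k" by blast
  then show ?case
    by cases (use var dp assms in \<open>auto simp: del_op_sx_mult intro: homog.diff homog_uminus\<close>)
qed (auto intro: homog.intros)

lemma homog_delD_op:
  assumes "homog V d p" "n \<ge> 2" "n \<in> V" "n - 1 \<in> V"
  shows "if d = 0 then delD_op n p = 0 else homog V (d - 1) (delD_op n p)"
  using assms(1)
proof (induction rule: homog.induct)
  case (var i d p)
  have dp: "homog V d (sx j * delD_op n p)" if "j \<in> V" for j
    using var.IH homog.var[OF that, of "d - 1" "delD_op n p"] by (auto split: if_splits intro: homog.zero)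
  note rl = delD_op_sx_mult[of n]
  consider "i = n" | "i = n - 1" | "i \<noteq> n" "i \<noteq> n - 1" by blast
  then show ?case
    by cases (use var dp assms rl in \<open>auto intro: homog.diff homog_uminus homog_add\<close>)
qed (use assms in \<open>auto intro: homog.intros\<close>)

section \<open>Words as operators\<close>

definition word_op :: "nat \<Rightarrow> nh_gen list \<Rightarrow> spol \<Rightarrow> spol" where "word_op n w = foldr (nh_op n) w"

lemma word_op_simps [simp]: "word_op n [] p = p" "word_op n (g # w) p = nh_op n g (word_op n w p)"
  "word_op n (u @ w) p = word_op n u (word_op n w p)"
  by (simp_all add: word_op_def)

lemma rep_mon: "ap (rep n (mon w)) p = word_op n w p"
  by (induction w) (simp_all add: mon_Nil mon_Cons)

lemma word_op_linear [simp]: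
  "word_op n w 0 = 0" "word_op n w (p + q) = word_op n w p + word_op n w q" "word_op n w (p - q) = word_op n w p - word_op n w q"
  "word_op n w (- p) = - word_op n w p" "word_op n w (of_int c * p) = of_int c * word_op n w p"
  by (simp_all flip: rep_mon)

lemma word_op_sign [simp]: "word_op n w ((-1) ^ j * p) = (-1) ^ j * word_op n w p"
  using word_op_linear(5)[of n w "(-1) ^ j" p] by simp

lemma word_op_word_zero: "n \<ge> 2 \<Longrightarrow> word_zero n w \<Longrightarrow> word_op n w p = 0"
  using rep_idl[of n "mon w"] by (simp add: word_zero_def flip: rep_mon)

lemma word_op_signed_eq: 
  assumes "n \<ge> 2" "signed_eq n u v" shows "word_op n u p = word_op n v p \<or> word_op n u p = - word_op n v p"
proof -
  have "rep n (mon u - mon v) = 0 \<or> rep n (mon u + mon v) = 0"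
    using assms rep_idl[of n] unfolding signed_eq_def by blast
  then have "rep n (mon u) = rep n (mon v) \<or> rep n (mon u) = - rep n (mon v)"
    by (simp add: eq_neg_iff_add_eq_0)
  then show ?thesis unfolding rep_mon[symmetric] by auto
qed

lemma homog_gen:
  assumes "g \<in> gens n k" "{k..n} \<subseteq> V" "1 \<le> k" "homog V d p"
  shows "if d = 0 then nh_op n g p = 0 else homog V (d - 1) (nh_op n g p)"
proof (cases "g = DelD")
  case True
  then have "k < n" using assms by (auto simp: gens_def split: if_splits)
  then show ?thesis using homog_delD_op[OF assms(4), of n] True assms
    by (auto simp: subset_iff max_def)
next
  case False
  then obtain i where "g = Del i" "k \<le> i" "i \<le> n-1" using assms by (auto simp: gens_def split: if_splits)
  moreover have "i \<in> V" "Suc i \<in> V" using calculation assms by (auto simp: subset_iff)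
  ultimately show ?thesis using homog_del_op[OF assms(4), of i] by (cases "d = 0") simp_all
qed

lemma homog_word_op:
  assumes "set w \<subseteq> gens n k" "{k..n} \<subseteq> V" "1 \<le> k" "homog V d p"
  shows "if length w \<le> d then homog V (d - length w) (word_op n w p) else word_op n w p = 0"
  using assms(1)
proof (induction w)
  case (Cons g w)
  show ?case
  proof (cases "length w \<le> d")
    case True
    then have "homog V (d - length w) (word_op n w p)" using Cons by simp
    from homog_gen[OF _ assms(2,3) this, of g] show ?thesis using Cons.prems True
      by (auto split: if_splits simp: Suc_le_eq)
  next
    case False
    then have "word_op n w p = 0" using Cons by (simp split: if_splits)
    then show ?thesis using False ap_zero[of "Aend (nh_op n g)"] by simp
  qed
qed (use assms in simp)

text \<open>
  Twisted derivations satisfy \<open>d(p e) = d(p) e + s(p) d(e)\<close>. Multiplying on the right by an element that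
  is killed therefore commutes with the operators, without any signs.
\<close>

lemma word_op_mult_right:
  assumes "set w \<subseteq> gens n k" "\<And>g. g \<in> gens n k \<Longrightarrow> nh_op n g e = 0"
  shows "word_op n w (p * e) = word_op n w p * e"
  using assms(1)
proof (induction w)
  case (Cons g w)
  then have g: "nh_op n g e = 0" and gk: "g \<in> gens n k" using assms(2) by auto
  have "nh_op n g (q * e) = nh_op n g q * e" for q
  proof (cases "g = DelD")
    case True
    then show ?thesis using g by (simp add: delD_op_mult)
  next
    case False
    then obtain i where "g = Del i" using gk by (auto simp: gens_def split: if_splits)
    then show ?thesis using g by (simp add: del_op_mult)
  qed
  then show ?case using Cons by simp
qed simp

lemma gens_kill_power:
  assumes "g \<in> gens n (Suc k)" "k < n"
  shows "nh_op n g (sx k ^ j) = 0"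
proof -
  have 1: "nh_op n g (sx k) = 0"
    using assms by (auto simp: gens_def del_op_sx delD_op_sx split: if_splits)
  have "word_op n [g] (sx k ^ j) = 0"
  proof (induction j)
    case 0
    show ?case using assms by (auto simp: gens_def split: if_splits)
  next
    case (Suc j)
    have "word_op n [g] (sx k ^ Suc j) = word_op n [g] (sx k ^ j * sx k)" by (simp add: power_commutes)
    also have "\<dots> = 0"
    proof (cases "g = DelD")
      case True
      then show ?thesis using Suc 1 by (simp add: delD_op_mult)
    next
      case False
      then obtain i where "g = Del i" using assms by (auto simp: gens_def split: if_splits)
      then show ?thesis using Suc 1 by (simp add: del_op_mult)
    qed
    finally show ?case .
  qed
  then show ?thesis by simp
qed

subsection \<open>The Euler classes\<close>

text \<open>
  The analogue of the Pfaffian invariant of type \<open>D\<close> for level \<open>k+1\<close>. It supplies a second test element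
  of degree \<open>n-k\<close>, besides the power of \<open>x\<^sub>k\<close>.
\<close>

definition euler :: "nat \<Rightarrow> nat \<Rightarrow> spol" where "euler n k = prod_list (map sx [Suc k..<Suc n])"

lemma euler_self: "euler n n = 1" by (simp add: euler_def)
lemma euler_step: "k < n \<Longrightarrow> euler n k = sx (Suc k) * euler n (Suc k)"
  by (simp add: euler_def upt_conv_Cons del: upt_Suc)

lemma homog_euler:
  assumes "a \<le> Suc k" "k \<le> n" shows "homog {a..n} (n - k) (euler n k)"
  using assms(2,1)
proof (induction k rule: inc_induct)
  case base
  show ?case by (simp add: euler_self homog.one)
next
  case (step k)
  have "homog {a..n} (Suc (n - Suc k)) (sx (Suc k) * euler n (Suc k))"
    by (rule homog.var) (use step in auto)
  then show ?case using step by (simp add: euler_step Suc_diff_Suc)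
qed

lemma del_op_euler: "k \<le> n \<Longrightarrow> i < n \<Longrightarrow> i \<noteq> k \<Longrightarrow> del_op i (euler n k) = 0"
proof (induction "n - k" arbitrary: k rule: less_induct)
  case less
  show ?case
  proof (cases "k = n")
    case True
    then show ?thesis by (simp add: euler_self)
  next
    case False
    then have k: "k < n" using less.prems by simp
    show ?thesis
    proof (cases "i = Suc k")
      case True
      then have "del_op i (euler n (Suc (Suc k))) = 0"
        using less.prems by (intro less.hyps) auto
      then show ?thesis using True k less.prems by (simp add: euler_step del_op_sx_mult)
    next
      case False
      then have "del_op i (euler n (Suc k)) = 0" using less.prems k by (intro less.hyps) auto
      then show ?thesis using False k less.prems by (simp add: euler_step del_op_sx_mult)
    qed
  qed
qed

lemma del_op_euler_self: "k < n \<Longrightarrow> del_op k (euler n k) = euler n (Suc k)"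
  using del_op_euler[of "Suc k" n k] by (simp add: euler_step del_op_sx_mult)

lemma delD_op_euler: "k + 2 \<le> n \<Longrightarrow> delD_op n (euler n k) = 0"
proof (induction "n - k" arbitrary: k rule: less_induct)
  case less
  then obtain m where m: "n = Suc (Suc m)" "k \<le> m" by (cases n; cases "n - 1") auto
  note rl = delD_op_sx_mult[of "Suc (Suc m)", simplified]
  show ?case
  proof (cases "k = m")
    case True
    then show ?thesis using rl(1)[of 1] by (simp add: m euler_step euler_self rl)
  next
    case False
    then have "delD_op n (euler n (Suc k)) = 0" using less m by (intro less.hyps) auto
    then show ?thesis using False m by (simp add: euler_step rl)
  qed
qed

lemma gens_kill_euler:
  assumes "g \<in> gens n (Suc k)" "k < n"
  shows "nh_op n g (euler n k) = 0"
  using assms del_op_euler[of k n] delD_op_euler[of k n]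
  by (auto simp: gens_def max_def split: if_splits)

section \<open>Values of chains\<close>

text \<open>
  Splitting off the last factor of \<open>x\<^sub>k\<^sup>j\<^sup>+\<^sup>1\<close> gives
  \<open>\<partial>\<^sub>k(x\<^sub>k\<^sup>j\<^sup>+\<^sup>1) = \<partial>\<^sub>k(x\<^sub>k\<^sup>j) x\<^sub>k + (-x\<^sub>k\<^sub>+\<^sub>1)\<^sup>j\<close>, and the right factor \<open>x\<^sub>k\<close> passes
  through operators of level \<open>k+1\<close>.
\<close>

lemma word_op_del_op_power:
  assumes "set z \<subseteq> gens n (Suc k)" "k < n"
  shows "word_op n z (del_op k (sx k ^ Suc j)) = word_op n z (del_op k (sx k ^ j)) * sx k + of_int ((-1) ^ j) * word_op n z (sx (Suc k) ^ j)"
proof -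
  have "s_op k (sx k ^ j) = of_int ((-1) ^ j) * sx (Suc k) ^ j"
  proof (induction j)
    case (Suc j)
    then show ?case by (cases "even j") (simp_all add: s_img_def)
  qed simp
  then have "del_op k (sx k ^ Suc j) = del_op k (sx k ^ j) * sx k + of_int ((-1) ^ j) * sx (Suc k) ^ j"
    by (simp only: power_Suc2 del_op_mult) (simp add: del_op_sx)
  moreover have "word_op n z (del_op k (sx k ^ j) * sx k) = word_op n z (del_op k (sx k ^ j)) * sx k"
    by (rule word_op_mult_right[OF assms(1)]) (use gens_kill_power[of _ n k 1] assms in simp)
  ultimately show ?thesis by simp
qed

lemma del_op_power_homog:
  assumes "1 \<le> k" "k < n"
  shows "if j = 0 then del_op k (sx k ^ j) = 0 else homog {k..n} (j - 1) (del_op k (sx k ^ j))"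
  using homog_del_op[OF homog_power[of k "{k..n}" j], of k] assms by (auto split: if_splits)

text \<open>
  When the length of \<open>z\<close> is \<open>j\<close>, the first term of the previous lemma dies for degree reasons. This
  reduces values of chains of level \<open>k\<close> to values of chains of level \<open>k+1\<close>.
\<close>

lemma word_op_del_op_power_exact:
  assumes "set z \<subseteq> gens n (Suc k)" "1 \<le> k" "k < n" "length z = j"
  shows "word_op n z (del_op k (sx k ^ Suc j)) = of_int ((-1) ^ j) * word_op n z (sx (Suc k) ^ j)"
proof -
  have "word_op n z (del_op k (sx k ^ j)) = 0"
  proof (cases j)
    case 0
    then show ?thesis by simp
  next
    case (Suc i)
    then show ?thesis
      using homog_word_op[OF assms(1), of "{k..n}" i "del_op k (sx k ^ j)"] del_op_power_homog[OF assms(2,3), of j] assms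
      by simp
  qed
  then show ?thesis using word_op_del_op_power[OF assms(1,3), of j] by simp
qed

lemma eps_sign [simp]: "eps ((-1) ^ j) = (-1) ^ j"
  by (cases "even j") simp_all

lemma desc_snoc: "k < j \<Longrightarrow> desc k j = desc (Suc k) j @ [Del k]"
  using desc_split[of k "Suc k" j] by (simp add: desc_Suc)

lemma set_desc_gens: "1 \<le> k \<Longrightarrow> j \<le> n \<Longrightarrow> set (desc k j) \<subseteq> gens n k"
  by (auto simp: set_desc gens_def)

lemma desc_value:
  assumes "1 \<le> k" "k \<le> j" "j \<le> n"
  shows "eps (word_op n (desc k j) (sx k ^ (j - k))) \<noteq> 0"
  using assms(2,1)
proof (induction k rule: inc_induct)
  case (step k)
  have "word_op n (desc k j) (sx k ^ (j - k)) = of_int ((-1) ^ (j - Suc k)) * word_op n (desc (Suc k) j) (sx (Suc k) ^ (j - Suc k))"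
    using word_op_del_op_power_exact[of "desc (Suc k) j" n k "j - Suc k"] step assms set_desc_gens[of "Suc k" j n]
    by (simp add: desc_snoc Suc_diff_Suc)
  then show ?case using step by simp
qed simp

lemma side_chain_snoc: "k + 2 \<le> n \<Longrightarrow> side_chain n k = side_chain n (Suc k) @ [Del k]"
  by (simp add: side_chain_def desc_snoc)

text \<open>
  Both chains of length \<open>n-k\<close> reduce by the same recursion to \<open>\<partial>\<^sub>n\<^sub>-\<^sub>1(x\<^sub>n\<^sub>-\<^sub>1) = D(x\<^sub>n\<^sub>-\<^sub>1) = 1\<close>.
\<close>

lemma side_chain_value:
  assumes "1 \<le> k" "k < n"
  shows "eps (word_op n (side_chain n k) (sx k ^ (n - k))) = eps (word_op n (desc k n) (sx k ^ (n - k)))"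
proof -
  have "k \<le> n - 1" using assms by simp
  then show ?thesis using assms(1)
  proof (induction k rule: inc_induct)
    case base
    have "n - (n - 1) = 1" "desc (n-1) n = [Del (n-1)]" using assms desc_Suc[of "n-1" "n-1"] by auto
    then show ?case using assms by (simp add: side_chain_def del_op_sx delD_op_sx)
  next
    case (step k)
    have s: "Suc (n - Suc k) = n - k" using step by simp
    have 1: "word_op n (side_chain n k) (sx k ^ (n - k)) = of_int ((-1) ^ (n - Suc k)) * word_op n (side_chain n (Suc k)) (sx (Suc k) ^ (n - Suc k))"
      using word_op_del_op_power_exact[of "side_chain n (Suc k)" n k "n - Suc k"] step assms set_desc_gens[of "Suc k" "n-1" n] s
      by (simp add: side_chain_snoc) (auto simp: side_chain_def gens_def)
    have 2: "word_op n (desc k n) (sx k ^ (n - k)) = of_int ((-1) ^ (n - Suc k)) * word_op n (desc (Suc k) n) (sx (Suc k) ^ (n - Suc k))"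
      using word_op_del_op_power_exact[of "desc (Suc k) n" n k "n - Suc k"] step assms set_desc_gens[of "Suc k" n n] s
      by (simp add: desc_snoc)
    show ?case unfolding 1 2 using step by simp
  qed
qed

text \<open>
  The opposite signs come from \<open>\<partial>\<^sub>n\<^sub>-\<^sub>1(x\<^sub>n) = 1\<close> and \<open>D(x\<^sub>n) = -1\<close>; they are what separates the two
  chains.
\<close>

lemma euler_value:
  assumes "1 \<le> k" "k < n"
  shows "word_op n (desc k n) (euler n k) = 1" "word_op n (side_chain n k) (euler n k) = - 1"
proof -
  have *: "word_op n (desc k j) (euler n k) = euler n j" if "k \<le> j" "j \<le> n" for j
    using that
  proof (induction j rule: dec_induct)
    case (step j)
    then show ?case by (simp add: desc_Suc del_op_euler_self)
  qed simp
  show "word_op n (desc k n) (euler n k) = 1" using *[of n] assms by (simp add: euler_self)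
  have "euler n (n-1) = sx n" using euler_step[of "n-1" n] assms by (simp add: euler_self)
  then show "word_op n (side_chain n k) (euler n k) = - 1" using *[of "n-1"] assms
    by (simp add: side_chain_def delD_op_sx)
qed

lemma long_chain_snoc: "k < j \<Longrightarrow> j < n \<Longrightarrow> long_chain n k j = long_chain n (Suc k) j @ [Del k]"
  by (simp add: long_chain_def desc_snoc)

lemma long_chain_top: "k + 2 \<le> n \<Longrightarrow> long_chain n k k = Del k # long_chain n (Suc k) (Suc k) @ [Del k]"
  by (simp add: long_chain_def desc_snoc asc_Cons)

lemma set_long_chain: "k \<le> j \<Longrightarrow> j < n \<Longrightarrow> set (long_chain n k j) \<subseteq> gens n k"
  by (auto simp: long_chain_def set_asc set_desc gens_def)

lemma length_long_chain: "k \<le> j \<Longrightarrow> j < n \<Longrightarrow> length (long_chain n k j) = 2 * n - j - k"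
  by (simp add: long_chain_def)

text \<open>
  Vanishing under the \<open>\<partial>\<^sub>i\<close> makes consecutive coefficients opposite, vanishing under \<open>D\<close> makes the last
  two equal; so twice the last coefficient is zero.
\<close>

lemma linear_invariant_zero:
  assumes "1 \<le> a" "a < n" "homog {a..n} 1 p" "\<And>g. g \<in> gens n a \<Longrightarrow> nh_op n g p = 0"
  shows "p = 0"
proof -
  obtain c where p: "p = (\<Sum>i\<in>{a..n}. of_int (c i) * sx i)" using homog_1_eq[of "{a..n}" p] assms by auto
  have dls: "del_op k (sum f S) = (\<Sum>i\<in>S. del_op k (f i))" for k f and S :: "nat set"
    by (induction S rule: infinite_finite_induct) simp_all
  have dlDs: "delD_op n (sum f S) = (\<Sum>i\<in>S. delD_op n (f i))" for f and S :: "nat set"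
    using assms by (induction S rule: infinite_finite_induct) simp_all
  have dli: "del_op k (of_int b * q) = of_int b * del_op k q" for k b q
    using ap_of_int_mult[of "Aend (nh_op n (Del k))" b q] by simp
  have dlDi: "delD_op n (of_int b * q) = of_int b * delD_op n q" for b q
    using ap_of_int_mult[of "Aend (nh_op n DelD)" b q] assms by (simp add: max_def)
  have 1: "c k + c (Suc k) = 0" if "a \<le> k" "k < n" for k
  proof -
    have "del_op k p = (\<Sum>i\<in>{a..n}. (if i = k then of_int (c i) else 0) + (if i = Suc k then of_int (c i) else 0))"
      unfolding p dls by (rule sum.cong) (auto simp: dli del_op_sx)
    also have "\<dots> = of_int (c k + c (Suc k))" using that by (simp add: sum.distrib)
    finally have "of_int (c k + c (Suc k)) = (of_int 0 :: spol)"
      using assms(4)[of "Del k"] that by (auto simp: gens_def)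
    then show ?thesis unfolding of_int_spol_eq_iff .
  qed
  have 2: "c (n-1) - c n = 0"
  proof -
    have "delD_op n p = (\<Sum>i\<in>{a..n}. (if i = n - 1 then of_int (c i) else 0) + (if i = n then - of_int (c i) else 0))"
      unfolding p dlDs using assms by (intro sum.cong) (auto simp: dlDi delD_op_sx)
    also have "\<dots> = of_int (c (n-1) - c n)"
    proof -
      have "a \<le> n - Suc 0" using assms(2) by simp
      then show ?thesis using assms by (simp add: sum.distrib)
    qed
    finally have "of_int (c (n-1) - c n) = (of_int 0 :: spol)"
      using assms(4)[of "DelD"] assms(1,2) by (auto simp: gens_def max_def)
    then show ?thesis unfolding of_int_spol_eq_iff .
  qed
  have cn: "c n = 0" using 2 1[of "n-1"] assms by simp
  have "c k = 0" if "a \<le> k" "k \<le> n" for k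
    using that(2,1)
  proof (induction k rule: inc_induct)
    case (step k)
    then show ?case using 1[of k] by simp
  qed (rule cn)
  then show ?thesis unfolding p by simp
qed

lemma length_chain_le: "c \<in> chains n k \<Longrightarrow> 1 \<le> k \<Longrightarrow> k < n \<Longrightarrow> length c \<le> 2 * n - 2 * k"
  by (auto simp: chains_def length_long_chain) (auto simp: side_chain_def)

text \<open>
  A generator cannot lengthen the longest chain, so by \<open>chain_step\<close> it annihilates the chain or passes
  to its right, where it meets a power of \<open>x\<^sub>k\<close>.
\<close>

lemma top_chain_killed:
  assumes "1 \<le> k" "k < n" "g \<in> gens n k"
  shows "nh_op n g (word_op n (long_chain n k k) (sx k ^ j)) = 0"
proof -
  have n: "n \<ge> 2" using assms by simp
  have c: "long_chain n k k \<in> chains n k" using assms by (auto simp: chains_def)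
  from chain_step[OF assms c] consider "word_zero n (g # long_chain n k k)"
    | c' where "c' \<in> chains n k" "length c' = Suc (length (long_chain n k k))"
    | g' where "g' \<in> gens n (Suc k)" "signed_eq n (g # long_chain n k k) (long_chain n k k @ [g'])"
    unfolding step_ok_def by blast
  then show ?thesis
  proof cases
    case 1
    then show ?thesis using word_op_word_zero[OF n 1, of "sx k ^ j"] by simp
  next
    case 2
    then show ?thesis using length_chain_le[of c' n k] assms by (simp add: length_long_chain)
  next
    case 3
    have "nh_op n g' (sx k ^ j) = 0" by (rule gens_kill_power[OF 3(1) assms(2)])
    then show ?thesis using word_op_signed_eq[OF n 3(2), of "sx k ^ j"] by auto
  qed
qed

text \<open>
  A long chain that does not return to \<open>-e\<^sub>k\<close> is a long chain of level \<open>k+1\<close> followed on the right by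
  \<open>\<partial>\<^sub>k\<close>, and the value is inherited up to sign. The longest chain is \<open>\<partial>\<^sub>k z \<partial>\<^sub>k\<close> with \<open>z\<close> the longest
  chain of level \<open>k+1\<close>; here the Leibniz rule leaves a linear term, which is invariant under level
  \<open>k+1\<close> and hence zero, so that the value is again inherited. The recursion ends with
  \<open>D \<partial>\<^sub>n\<^sub>-\<^sub>1 (x\<^sub>n\<^sub>-\<^sub>1\<^sup>2) = D(x\<^sub>n\<^sub>-\<^sub>1 - x\<^sub>n) = 2\<close>.
\<close>

lemma long_chain_value:
  assumes "1 \<le> k" "k \<le> j" "j < n"
  shows "eps (word_op n (long_chain n k j) (sx k ^ (2 * n - j - k))) \<noteq> 0"
  using assms
proof (induction "n - k" arbitrary: k j)
  case 0
  then show ?case by simp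
next
  case (Suc d)
  have d: "d = n - Suc k" using Suc.hyps(2) by simp
  show ?case
  proof (cases "k < j")
    case True
    define e where "e = 2 * n - j - Suc k"
    have s: "2 * n - j - k = Suc e" using True Suc.prems by (simp add: e_def)
    have "length (long_chain n (Suc k) j) = e" using True Suc.prems by (simp add: length_long_chain e_def)
    then have "word_op n (long_chain n k j) (sx k ^ Suc e) = of_int ((-1) ^ e) * word_op n (long_chain n (Suc k) j) (sx (Suc k) ^ e)"
      using word_op_del_op_power_exact[of "long_chain n (Suc k) j" n k e] True Suc.prems
        set_long_chain[of "Suc k" j n] by (simp add: long_chain_snoc)
    moreover have "eps (word_op n (long_chain n (Suc k) j) (sx (Suc k) ^ e)) \<noteq> 0"
      unfolding e_def
      using Suc.hyps(1)[of "Suc k" j] Suc.prems True d by simp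
    ultimately show ?thesis unfolding s by simp
  next
    case False
    then have j: "j = k" using Suc.prems by simp
    show ?thesis
    proof (cases "k = n - 1")
      case True
      then obtain m where m: "n = Suc m" "k = m" "m \<ge> 1" using Suc.prems by (cases n) auto
      have "word_op n (long_chain n k k) (sx k ^ (2 * n - k - k)) = 2"
        using m delD_op_sx[of "Suc m"] desc_Suc[of m m] by (simp add: long_chain_def numeral_2_eq_2[of] del_op_sx_mult del_op_sx) 
      then have "word_op n (long_chain n k k) (sx k ^ (2 * n - k - k)) = of_int 2" by simp
      then show ?thesis unfolding j by (simp only: eps_of_int)
    next
      case False
      then have k2: "k + 2 \<le> n" using Suc.prems by simp
      define m where "m = 2 * n - Suc k - Suc k"
      have jm: "2 * n - j - k = Suc (Suc m)" using j k2 by (simp add: m_def)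
      let ?t = "long_chain n (Suc k) (Suc k)"
      have t: "set ?t \<subseteq> gens n (Suc k)" "length ?t = m"
        using set_long_chain[of "Suc k" "Suc k" n] length_long_chain[of "Suc k" "Suc k" n] k2 by (simp_all add: m_def)
      \<comment> \<open>the linear term left by the Leibniz rule\<close>
      let ?l = "word_op n ?t (sx (Suc k) ^ Suc m)"
      have "homog {Suc k..n} 1 ?l"
        using homog_word_op[OF t(1), of "{Suc k..n}" "Suc m" "sx (Suc k) ^ Suc m"] t(2) k2
          homog_power[of "Suc k" "{Suc k..n}" "Suc m"] by simp
      then have l0: "?l = 0"
      proof (rule linear_invariant_zero[rotated 2])
        show "1 \<le> Suc k" "Suc k < n" using k2 by auto
        then show "nh_op n g ?l = 0" if "g \<in> gens n (Suc k)" for g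
          using top_chain_killed[of "Suc k" n g "Suc m"] that by blast
      qed
      have "homog {Suc k..n} 0 (word_op n ?t (sx (Suc k) ^ m))"
        using homog_word_op[OF t(1), of "{Suc k..n}" "m" "sx (Suc k) ^ m"] t(2) k2
          homog_power[of "Suc k" "{Suc k..n}" "m"] by simp
      then obtain C where C: "word_op n ?t (sx (Suc k) ^ m) = of_int C" "C = eps (word_op n ?t (sx (Suc k) ^ m))"
        using homog_0_eq by blast
      have C0: "C \<noteq> 0" using Suc.hyps(1)[of "Suc k" "Suc k"] d k2 unfolding C(2) by (simp add: m_def)
      have "word_op n ?t (del_op k (sx k ^ Suc m)) = of_int ((-1) ^ m * C)"
        using word_op_del_op_power_exact[of ?t n k m] t Suc.prems C(1) by simp
      then have "word_op n ?t (del_op k (sx k ^ Suc (Suc m))) = of_int ((-1) ^ m * C) * sx k"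
        using word_op_del_op_power[of ?t n k "Suc m"] t Suc.prems l0 by simp
      then have "word_op n (long_chain n k j) (sx k ^ (2 * n - j - k)) = word_op n [Del k] (of_int ((-1) ^ m * C) * sx k)"
        unfolding jm by (simp add: j long_chain_top[OF k2])
      also have "\<dots> = of_int ((-1) ^ m * C)" unfolding word_op_linear(5) by (simp add: del_op_sx)
      finally show ?thesis using C0 by (simp only: eps_of_int) simp
    qed
  qed
qed

section \<open>Monomials in the skew polynomials\<close>

text \<open>
  Left multiplication by \<open>x\<^sub>i\<close> on ordered monomials, with the sign from moving \<open>x\<^sub>i\<close> past the variables
  of smaller index. The resulting module of skew polynomials shows that ordered monomials are
  independent.
\<close>

definition xi :: "nat \<Rightarrow> (nat \<Rightarrow>\<^sub>0 nat) \<Rightarrow> ((nat \<Rightarrow>\<^sub>0 nat) \<Rightarrow>\<^sub>0 int)"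
  where "xi i a = frag_cmul ((-1) ^ (\<Sum>j<i. lookup a j)) (frag_of (a + single i 1))"

definition xiop :: "nat \<Rightarrow> ((nat \<Rightarrow>\<^sub>0 nat) \<Rightarrow>\<^sub>0 int) aend"
  where "xiop i = Aend (frag_extend (xi i))"

lemma ap_xiop [simp]: "ap (xiop i) = frag_extend (xi i)"
  unfolding xiop_def by (rule Aend_inverse) (simp add: frag_extend_add)

lemma xi_anticomm: "i < j \<Longrightarrow> frag_extend (xi i) (xi j a) = - frag_extend (xi j) (xi i a)"
proof -
  assume ij: "i < j"
  have s1: "(\<Sum>l<i. lookup (a + single j 1) l) = (\<Sum>l<i. lookup a l)"
    using ij by (intro sum.cong) (auto simp: lookup_add lookup_single)
  have s2: "(\<Sum>l<j. lookup (a + single i 1) l) = Suc (\<Sum>l<j. lookup a l)"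
    using ij by (simp add: lookup_add sum.distrib lookup_single when_def)
  show ?thesis unfolding xi_def
    by (simp only: frag_extend_cmul frag_extend_of xi_def s1 s2)
       (simp add: ac_simps)
qed

lemma xiop_anticomm: "i \<noteq> j \<Longrightarrow> xiop i * xiop j + xiop j * xiop i = 0"
proof (rule aend_eqI)
  fix p :: "(nat \<Rightarrow>\<^sub>0 nat) \<Rightarrow>\<^sub>0 int" assume ij: "i \<noteq> j"
  have "keys p \<subseteq> UNIV" by simp
  then have "frag_extend (xi i) (frag_extend (xi j) p) + frag_extend (xi j) (frag_extend (xi i) p) = 0"
  proof (induction p rule: frag_induction)
    case (one x)
    then show ?case using xi_anticomm[of i j x] xi_anticomm[of j i x] ij by (cases "i < j") auto
  next
    case (diff a b)
    then show ?case by (simp only: frag_extend_diff) (metis add_diff_add diff_self)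
  qed simp
  then show "ap (xiop i * xiop j + xiop j * xiop i) p = ap 0 p" by simp
qed

definition xcnt :: "nh_gen list \<Rightarrow> nat \<Rightarrow>\<^sub>0 nat"
  where "xcnt w = sum_list (map (\<lambda>g. case g of X i \<Rightarrow> single i 1 | _ \<Rightarrow> 0) w)"

definition xcoef :: "nh_gen list \<Rightarrow> spol \<Rightarrow> int"
  where "xcoef w p = lookup (ap (sp_eval xiop p) (frag_of 0)) (xcnt w)"

lemmas xi_eval = sp_eval_simps[OF xiop_anticomm]

lemma xcnt_append: "xcnt (u @ w) = xcnt u + xcnt w"
  by (simp add: xcnt_def)

lemma lookup_xcnt: "set w \<subseteq> X ` I \<Longrightarrow> i \<notin> I \<Longrightarrow> lookup (xcnt w) i = 0"
  by (induction w) (auto simp: xcnt_def lookup_add lookup_single when_def)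

lemma xcnt_replicate: "xcnt (replicate k (X i)) = single i k"
  by (induction k) (simp_all add: xcnt_def flip: single_add)

lemma xcnt_inj: "w \<in> x_words m \<Longrightarrow> w' \<in> x_words m \<Longrightarrow> xcnt w = xcnt w' \<Longrightarrow> w = w'"
proof (induction m arbitrary: w w')
  case (Suc m)
  obtain v k v' k' where w: "w = v @ replicate k (X (Suc m))" "v \<in> x_words m"
    "w' = v' @ replicate k' (X (Suc m))" "v' \<in> x_words m" using Suc.prems by auto
  have eq: "xcnt v + single (Suc m) k = xcnt v' + single (Suc m) k'"
    using Suc.prems w by (simp add: xcnt_append xcnt_replicate)
  have "k = k'" using arg_cong[OF eq, of "\<lambda>a. lookup a (Suc m)"]
      lookup_xcnt[OF set_x_words[OF w(2)], of "Suc m"] lookup_xcnt[OF set_x_words[OF w(4)], of "Suc m"]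
    by (simp add: lookup_add)
  then show ?case using eq Suc.IH[of v v'] w by simp
qed simp

lemma xi_replicate:
  assumes "\<And>j. j < i \<Longrightarrow> lookup a j = 0"
  shows "ap (sp_eval xiop (word_op n (replicate k (X i)) 1)) (frag_of a) = frag_of (a + single i k)"
proof (induction k)
  case 0
  show ?case by (simp add: xi_eval)
next
  case (Suc k)
  have z: "(\<Sum>j<i. lookup (a + single i k) j) = 0"
    using assms by (intro sum.neutral) (auto simp: lookup_add lookup_single)
  have s: "single i k + single i 1 = single i (Suc k)"
    by (simp flip: single_add)
  have "ap (sp_eval xiop (word_op n (replicate (Suc k) (X i)) 1)) (frag_of a) =
    frag_extend (xi i) (ap (sp_eval xiop (word_op n (replicate k (X i)) 1)) (frag_of a))"
    by (simp add: xi_eval)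
  also have "\<dots> = xi i (a + single i k)" unfolding Suc.IH by simp
  also have "\<dots> = frag_of (a + single i (Suc k))"
    unfolding xi_def z add.assoc s by simp
  finally show ?case .
qed

lemma word_op_X_mult:
  assumes "set w \<subseteq> range X" shows "word_op n w p = word_op n w 1 * p"
  using assms by (induction w) (auto simp: mult.assoc)

lemma set_x_words_range: "w \<in> x_words m \<Longrightarrow> set w \<subseteq> range X"
  using set_x_words by fastforce

lemma xi_prod:
  assumes "w \<in> x_words m" "\<And>j. j \<le> m \<Longrightarrow> lookup a j = 0"
  shows "ap (sp_eval xiop (word_op n w 1)) (frag_of a) = frag_of (a + xcnt w)"
  using assms
proof (induction m arbitrary: w a)
  case 0
  then show ?case by (simp add: xi_eval xcnt_def)
next
  case (Suc m)
  obtain v k where w: "w = v @ replicate k (X (Suc m))" "v \<in> x_words m" using Suc.prems(1) by auto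
  have "word_op n w 1 = word_op n v 1 * word_op n (replicate k (X (Suc m))) 1"
    unfolding w(1) word_op_simps(3) by (rule word_op_X_mult[OF set_x_words_range[OF w(2)]])
  then have "ap (sp_eval xiop (word_op n w 1)) (frag_of a) =
      ap (sp_eval xiop (word_op n v 1)) (ap (sp_eval xiop (word_op n (replicate k (X (Suc m))) 1)) (frag_of a))"
    by (simp add: xi_eval)
  also have "\<dots> = ap (sp_eval xiop (word_op n v 1)) (frag_of (a + single (Suc m) k))"
    using xi_replicate[of "Suc m" a n k] Suc.prems(2) by simp
  also have "\<dots> = frag_of ((a + single (Suc m) k) + xcnt v)"
    by (rule Suc.IH[OF w(2)]) (simp add: Suc.prems(2) lookup_add lookup_single)
  finally show ?case by (simp add: w(1) xcnt_append xcnt_replicate ac_simps)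
qed

lemma xcoef_word: "w \<in> x_words m \<Longrightarrow> w' \<in> x_words m \<Longrightarrow> xcoef w (word_op n w' 1) = (if w' = w then 1 else 0)"
  using xi_prod[of w' m 0 n] xcnt_inj[of w m w'] by (auto simp: xcoef_def)

lemma xcoef_linear:
  "xcoef w 0 = 0" "xcoef w (p + q) = xcoef w p + xcoef w q" "xcoef w (of_int c * p) = c * xcoef w p"
proof -
  show "xcoef w 0 = 0" "xcoef w (p + q) = xcoef w p + xcoef w q"
    by (simp_all add: xcoef_def xi_eval lookup_add)
  have eq: "sp_eval xiop (of_int c) = of_int c"
    by (induction c rule: int_induct[where k = 0]) (simp_all add: xi_eval)
  then show "xcoef w (of_int c * p) = c * xcoef w p"
    by (simp add: xcoef_def xi_eval of_int_times_frag)
qed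

lemma xcoef_sum: "xcoef w (sum f S) = (\<Sum>i\<in>S. xcoef w (f i))"
  by (induction S rule: infinite_finite_induct) (simp_all add: xcoef_linear)

section \<open>Independence of the constant term functionals\<close>

lemma chains_cases:
  assumes "c \<in> chains n k" "k < n"
  obtains (desc) i where "c = desc k i" "k \<le> i" "i \<le> n" "length c = i - k"
  | (M) "c = side_chain n k" "length c = n - k"
  | (U) i where "c = long_chain n k i" "k \<le> i" "i < n" "length c = 2 * n - i - k"
proof -
  from assms consider i where "c = desc k i" "k \<le> i" "i \<le> n" | "c = side_chain n k" | i where "c = long_chain n k i" "k \<le> i" "i < n"
    by (auto simp: chains_def)
  then show thesis
  proof cases
    case 1
    then show ?thesis using desc by simp
  next
    case 2
    then show ?thesis using M assms by (simp add: side_chain_def)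
  next
    case 3
    then show ?thesis using U length_long_chain by simp
  qed
qed

text \<open>
  The chain of length \<open>j\<close> is unique except for \<open>j = n - k\<close>. There the values on \<open>x\<^sub>k\<^sup>j\<close> agree and
  those on the Euler class are opposite, so the two-by-two matrix has determinant \<open>\<plusminus>2\<close>.
\<close>

lemma chain_functionals_independent:
  assumes k: "1 \<le> k" "k < n"
    and e: "\<And>e. homog {1..n} j e \<Longrightarrow> (\<And>g. g \<in> gens n (Suc k) \<Longrightarrow> nh_op n g e = 0) \<Longrightarrow>
      (\<Sum>c\<in>{c \<in> chains n k. length c = j}. \<beta> c * eps (word_op n c e)) = 0"
    and c: "c \<in> chains n k" "length c = j"
  shows "\<beta> c = 0"
proof -
  let ?S = "{c \<in> chains n k. length c = j}"
  \<comment> \<open>the power of \<open>x\<^sub>k\<close> is a test element in every degree\<close>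
  have pw: "(\<Sum>c\<in>?S. \<beta> c * eps (word_op n c (sx k ^ j))) = 0"
  proof (rule e)
    show "homog {1..n} j (sx k ^ j)" using k by (intro homog_power) auto
    show "nh_op n g (sx k ^ j) = 0" if "g \<in> gens n (Suc k)" for g
      by (rule gens_kill_power[OF that k(2)])
  qed
  consider "j < n - k" | "j = n - k" | "j > n - k" by linarith
  then show ?thesis
  proof cases
    case 1
    have *: "c' = desc k (k + j)" if "c' \<in> chains n k" "length c' = j" for c'
      using that(1) k(2)
    proof (cases rule: chains_cases)
      case (desc i)
      then have "i = k + j" using that(2) by simp
      then show ?thesis using desc by simp
    qed (use 1 that in simp_all)
    have "?S \<subseteq> {desc k (k + j)}" using * by blast
    moreover have "desc k (k + j) \<in> ?S" using c *[OF c] by simp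
    ultimately have S: "?S = {desc k (k + j)}" by blast
    have "\<beta> (desc k (k + j)) * eps (word_op n (desc k (k + j)) (sx k ^ j)) = 0" using pw unfolding S by simp
    moreover have "eps (word_op n (desc k (k + j)) (sx k ^ j)) \<noteq> 0" using desc_value[of k "k + j" n] 1 k by simp
    ultimately show ?thesis using *[OF c] by simp
  next
    case 2
    have *: "c' = desc k n \<or> c' = side_chain n k" if "c' \<in> chains n k" "length c' = j" for c'
      using that(1) k(2)
    proof (cases rule: chains_cases)
      case (desc i)
      then have "i = n" using that(2) 2 by simp
      then show ?thesis using desc by simp
    qed (use 2 that k in simp_all)
    have "?S \<subseteq> {desc k n, side_chain n k}" using * by blast
    moreover have "desc k n \<in> ?S" "side_chain n k \<in> ?S"
      using 2 k desc_in_chains[of k n n] side_chain_in_chains[of n k] by (simp_all add: side_chain_def)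
    ultimately have S: "?S = {desc k n, side_chain n k}" by blast
    have ne: "desc k n \<noteq> side_chain n k"
      using desc_Suc[of k "n-1"] k by (simp add: side_chain_def)
    have "homog {1..n} j (euler n k)" using 2 k homog_euler[of 1 k n] by simp
    then have "(\<Sum>c\<in>?S. \<beta> c * eps (word_op n c (euler n k))) = 0"
      by (rule e) (rule gens_kill_euler[OF _ k(2)])
    then have b1: "\<beta> (desc k n) = \<beta> (side_chain n k)"
      using ne k unfolding S by (simp add: euler_value)
    let ?v = "eps (word_op n (desc k n) (sx k ^ (n - k)))"
    have "\<beta> (desc k n) * ?v + \<beta> (side_chain n k) * ?v = 0"
      using pw[unfolded S] ne side_chain_value[OF k] unfolding 2 by simp
    then have "2 * (\<beta> (desc k n) * ?v) = 0" unfolding b1 by simp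
    moreover have "?v \<noteq> 0" using desc_value[of k n n] k by simp
    ultimately have "\<beta> (desc k n) = 0" by simp
    then show ?thesis using b1 *[OF c] by auto
  next
    case 3
    have *: "\<exists>i. c' = long_chain n k i \<and> k \<le> i \<and> i < n \<and> j = 2 * n - i - k" if "c' \<in> chains n k" "length c' = j" for c'
      using that(1) k(2)
    proof (cases rule: chains_cases)
      case (U i)
      then show ?thesis using that(2) by blast
    qed (use 3 that in simp_all)
    obtain i where i: "c = long_chain n k i" "k \<le> i" "i < n" "j = 2 * n - i - k" using *[OF c] by blast
    have "c' = c" if c': "c' \<in> ?S" for c'
    proof -
      obtain i' where i': "c' = long_chain n k i'" "k \<le> i'" "i' < n" "j = 2 * n - i' - k" using *[of c'] c' by blast
      then have "i' = i" using i by linarith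
      then show ?thesis using i i' by simp
    qed
    then have S: "?S = {c}" using c by blast
    have "\<beta> c * eps (word_op n c (sx k ^ j)) = 0" using pw unfolding S by simp
    moreover have "eps (word_op n c (sx k ^ j)) \<noteq> 0" using long_chain_value[of k i n] i k by simp
    ultimately show ?thesis by simp
  qed
qed

lemma finite_chains: "finite (chains n k)"
  by (simp add: chains_def)

lemma finite_nc_words: "finite (nc_words n d)"
proof (induction d)
  case (Suc d)
  have "nc_words n (Suc d) = (\<lambda>(c, u). c @ u) ` (chains n (n - Suc d) \<times> nc_words n d)" by auto
  then show ?case using Suc finite_chains by simp
qed simp

lemma last_chain:
  assumes "c \<in> chains n k" "c \<noteq> []" "1 \<le> k" "k + 2 \<le> n"
  shows "last c = Del k"
proof -
  have "k < n" using assms by simp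
  with assms(1) show ?thesis
  proof (cases rule: chains_cases)
    case (desc i)
    then have "k < i" using assms by (cases "k = i") auto
    then show ?thesis using desc by (simp add: desc_snoc)
  next
    case M
    then show ?thesis using assms by (simp add: side_chain_snoc)
  next
    case (U i)
    then show ?thesis using assms by (cases "k = i") (simp_all add: long_chain_top long_chain_snoc)
  qed
qed

text \<open>
  A nonempty chain of level \<open>k\<close> ends in \<open>\<partial>\<^sub>k\<close>, a letter that does not occur at level \<open>k+1\<close>; this marks
  where the chain stops.
\<close>

lemma chain_factorization_inj:
  assumes "1 \<le> k" "k < n"
  shows "inj_on (\<lambda>(c, u). c @ u) (chains n k \<times> nc_words n (n - Suc k))"
proof (cases "k + 2 \<le> n")
  case False
  then have "n - Suc k = 0" by simp
  then show ?thesis by (auto simp: inj_on_def)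
next
  case True
  have nk: "Del k \<notin> set u" if "u \<in> nc_words n (n - Suc k)" for u
    using set_nc_words[OF _ that] assms by (auto simp: gens_def split: if_splits)
  have *: "z = []" if "c \<in> chains n k" "c @ z \<in> chains n k" "z @ u \<in> nc_words n (n - Suc k)" for c z u
  proof (rule ccontr)
    assume "z \<noteq> []"
    then have "last z = Del k" using last_chain[OF that(2)] assms True by simp
    then show False using nk[OF that(3)] \<open>z \<noteq> []\<close> last_in_set[of z] by auto
  qed
  show ?thesis
  proof (rule inj_onI, clarsimp)
    fix c u c' u'
    assume a: "c \<in> chains n k" "u \<in> nc_words n (n - Suc k)" "c' \<in> chains n k" "u' \<in> nc_words n (n - Suc k)"
      and eq: "c @ u = c' @ u'"
    then obtain z where "c = c' @ z \<and> z @ u = u' \<or> c @ z = c' \<and> u = z @ u'"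
      by (auto simp: append_eq_append_conv2)
    then show "c = c' \<and> u = u'" using *[of c' z u] *[of c z u'] a by auto
  qed
qed

lemma sum_nc_words_Suc:
  assumes "1 \<le> k" "k < n"
  shows "(\<Sum>w\<in>{w \<in> nc_words n (n - k). length w = N}. f w) =
    (\<Sum>(c, u)\<in>{(c, u). c \<in> chains n k \<and> u \<in> nc_words n (n - Suc k) \<and> length c + length u = N}. f (c @ u))"
proof -
  have "n - k = Suc (n - Suc k)" "n - Suc (n - Suc k) = k" using assms by auto
  then have eq: "{w \<in> nc_words n (n - k). length w = N} =
    (\<lambda>(c, u). c @ u) ` {(c, u). c \<in> chains n k \<and> u \<in> nc_words n (n - Suc k) \<and> length c + length u = N}"
    by auto
  have "inj_on (\<lambda>(c, u). c @ u) {(c, u). c \<in> chains n k \<and> u \<in> nc_words n (n - Suc k) \<and> length c + length u = N}"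
    by (rule inj_on_subset[OF chain_factorization_inj[OF assms]]) auto
  from sum.reindex[OF this, of f] show ?thesis unfolding eq by (simp add: case_prod_beta o_def)
qed

text \<open>
  Induction on the level and, inside, on the length \<open>l\<close> of the tail of level \<open>k+1\<close>. On \<open>g e\<close> with \<open>g\<close> of
  degree \<open>l\<close> and \<open>e\<close> of degree \<open>N - l\<close> the tails shorter than \<open>l\<close> contribute nothing by induction, the
  longer ones kill \<open>g\<close>, and those of length \<open>l\<close> turn \<open>g\<close> into a constant.
\<close>

lemma nc_words_functionals_independent:
  assumes "d < n"
    and "\<And>g. homog {1..n} N g \<Longrightarrow> (\<Sum>u\<in>{u \<in> nc_words n d. length u = N}. \<alpha> u * eps (word_op n u g)) = 0"
    and "u \<in> nc_words n d" "length u = N"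
  shows "\<alpha> u = 0"
  using assms
proof (induction d arbitrary: N \<alpha> u)
  case 0
  then have [simp]: "u = []" "N = 0" by auto
  have "{u \<in> nc_words n 0. length u = N} = {[]}" by auto
  then show ?case using "0.prems"(2)[of 1] homog.one by simp
next
  case (Suc d)
  define k where "k = n - Suc d"
  have k: "1 \<le> k" "k < n" "n - Suc k = d" "n - k = Suc d" using Suc.prems by (auto simp: k_def)
  have main: "\<forall>c v. c \<in> chains n k \<longrightarrow> v \<in> nc_words n d \<longrightarrow> length v = l \<longrightarrow> length c + l = N \<longrightarrow> \<alpha> (c @ v) = 0" for l
  proof (induction l rule: less_induct)
    case (less l)
    show ?case
    proof (intro allI impI)
      fix c v assume cv: "c \<in> chains n k" "v \<in> nc_words n d" "length v = l" "length c + l = N"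
      let ?S = "{(c, u). c \<in> chains n k \<and> u \<in> nc_words n d \<and> length c + length u = N}"
      let ?C = "{c \<in> chains n k. length c = N - l}"
      show "\<alpha> (c @ v) = 0"
      proof (rule chain_functionals_independent[OF k(1,2) _ cv(1), of "N - l" "\<lambda>c. \<alpha> (c @ v)"])
        fix e assume e: "homog {1..n} (N - l) e" "\<And>g. g \<in> gens n (Suc k) \<Longrightarrow> nh_op n g e = 0"
        show "(\<Sum>c\<in>?C. \<alpha> (c @ v) * eps (word_op n c e)) = 0"
        proof (rule Suc.IH[of l "\<lambda>v. \<Sum>c\<in>?C. \<alpha> (c @ v) * eps (word_op n c e)" v])
          fix g assume g: "homog {1..n} l g"
          have vg: "set v' \<subseteq> gens n (Suc k)" if "v' \<in> nc_words n d" for v'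
          proof -
            have "n - d = Suc k" "d < n" using Suc.prems(1) by (auto simp: k_def)
            then show ?thesis using set_nc_words[of d n v'] that by simp
          qed
          have "0 = (\<Sum>w\<in>{w \<in> nc_words n (Suc d). length w = N}. \<alpha> w * eps (word_op n w (g * e)))"
            using Suc.prems(2)[of "g * e"] homog_mult[OF g e(1)] cv(4) by simp
          also have "\<dots> = (\<Sum>(c, u)\<in>?S. \<alpha> (c @ u) * eps (word_op n (c @ u) (g * e)))"
            using sum_nc_words_Suc[OF k(1,2), where N = N and f = "\<lambda>w. \<alpha> w * eps (word_op n w (g * e))"] k by simp
          also have "\<dots> = (\<Sum>(c, u)\<in>?S. if length u = l then \<alpha> (c @ u) * eps (word_op n c e) * eps (word_op n u g) else 0)"
          proof (rule sum.cong[OF refl], clarify)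
            fix c' u' assume cu: "c' \<in> chains n k" "u' \<in> nc_words n d" "N = length c' + length u'"
            have r: "word_op n u' (g * e) = word_op n u' g * e"
              by (rule word_op_mult_right[OF vg[OF cu(2)] e(2)])
            have h: "if length u' \<le> l then homog {1..n} (l - length u') (word_op n u' g) else word_op n u' g = 0"
              by (rule homog_word_op[OF vg[OF cu(2)] _ _ g]) auto
            consider "length u' < l" | "length u' = l" | "length u' > l" by linarith
            then show "\<alpha> (c' @ u') * eps (word_op n (c' @ u') (g * e)) =
              (if length u' = l then \<alpha> (c' @ u') * eps (word_op n c' e) * eps (word_op n u' g) else 0)"
            proof cases
              case 1
              then show ?thesis using less[OF 1] cu by auto
            next
              case 2
              then have "word_op n u' g = of_int (eps (word_op n u' g))" using h homog_0_eq by auto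
              then have "word_op n (c' @ u') (g * e) = of_int (eps (word_op n u' g)) * word_op n c' e"
                using r by (metis word_op_simps(3) word_op_linear(5))
              then show ?thesis using 2 by simp
            next
              case 3
              then show ?thesis using h r by simp
            qed
          qed
          also have "\<dots> = (\<Sum>(c, u)\<in>?C \<times> {u \<in> nc_words n d. length u = l}. \<alpha> (c @ u) * eps (word_op n c e) * eps (word_op n u g))"
          proof -
            have fin: "finite ?S"
              by (rule finite_subset[of _ "chains n k \<times> nc_words n d"]) (use finite_chains finite_nc_words in auto)
            have "{x \<in> ?S. length (snd x) = l} = ?C \<times> {u \<in> nc_words n d. length u = l}" using cv(4) by auto
            then show ?thesis using sum.inter_filter[OF fin, of "\<lambda>x. \<alpha> (fst x @ snd x) * eps (word_op n (fst x) e) * eps (word_op n (snd x) g)" "\<lambda>x. length (snd x) = l"]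
              by (simp add: case_prod_beta)
          qed
          also have "\<dots> = (\<Sum>u\<in>{u \<in> nc_words n d. length u = l}. (\<Sum>c\<in>?C. \<alpha> (c @ u) * eps (word_op n c e)) * eps (word_op n u g))"
            by (simp add: sum.swap[of _ "{u \<in> nc_words n d. length u = l}"] sum_distrib_right flip: sum.cartesian_product)
          finally show "(\<Sum>u\<in>{u \<in> nc_words n d. length u = l}. (\<Sum>c\<in>?C. \<alpha> (c @ u) * eps (word_op n c e)) * eps (word_op n u g)) = 0"
            by simp
        qed (use Suc.prems cv in auto)
      qed (use cv in auto)
    qed
  qed
  have nk: "n - Suc d = k" by (simp add: k_def)
  obtain c v where cv: "u = c @ v" "c \<in> chains n k" "v \<in> nc_words n d" using Suc.prems(3) by (auto simp: nk)
  then show ?case using main[of "length v"] Suc.prems(4) by auto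
qed

section \<open>Normal forms act faithfully\<close>

lemma normal_words_factorization_inj:
  assumes "n \<ge> 2" "w \<in> x_words n" "w' \<in> x_words n" "u \<in> NC_words n" "u' \<in> NC_words n" "w @ u = w' @ u'"
  shows "w = w' \<and> u = u'"
proof -
  have x: "filter (\<lambda>g. g \<in> range X) v = v" if "v \<in> x_words n" for v
    using set_x_words[OF that] by (intro filter_True) auto
  have u: "filter (\<lambda>g. g \<in> range X) v = []" if "v \<in> NC_words n" for v
    using set_nc_words[of "n-1" n v] that assms(1) by (intro filter_False) (auto simp: NC_words_def gens_def split: if_splits)
  have "filter (\<lambda>g. g \<in> range X) (w @ u) = w" "filter (\<lambda>g. g \<in> range X) (w' @ u') = w'"
    by (simp_all only: filter_append x[OF assms(2)] x[OF assms(3)] u[OF assms(4)] u[OF assms(5)] append_Nil2)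
  then have "w = w'" using assms(6) by simp
  then show ?thesis using assms(6) by simp
qed

lemma rep_expand: "ap (rep n f) p = (\<Sum>w\<in>keys f. of_int (lookup f w) * word_op n (letters w) p)"
proof -
  have "ap (prod_list (map (\<lambda>g. Aend (nh_op n g)) w)) p = word_op n w p" for w
    by (induction w) simp_all
  then show ?thesis by (simp add: rep_def fp_eval_def ap_sum_left)
qed

text \<open>
  Again the shortest operators are isolated by applying the relation to polynomials of their length.
  What remains is a combination of ordered monomials in the \<open>x\<close>'s, and the vanishing of each of its
  coefficients is a relation between the functionals \<open>g \<mapsto> \<epsilon>(u g)\<close>.
\<close>

lemma normal_form_faithful:
  assumes n: "n \<ge> 2" and f: "keys f \<subseteq> Word ` normal_words n"
    and kill: "\<And>d g. homog {1..n} d g \<Longrightarrow> ap (rep n f) g = 0"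
  shows "f = 0"
proof -
  define P where "P = {(w, u). w \<in> x_words n \<and> u \<in> NC_words n \<and> Word (w @ u) \<in> keys f}"
  define F where "F w u = lookup f (Word (w @ u))" for w u
  have inj: "inj_on (\<lambda>(w, u). Word (w @ u)) P"
    using normal_words_factorization_inj[OF n] by (auto simp: inj_on_def P_def)
  have keys: "keys f = (\<lambda>(w, u). Word (w @ u)) ` P"
    using f by (force simp: P_def normal_words_def)
  have finP: "finite P" using finite_imageD[OF _ inj] keys by (metis finite_keys)
  have xmult: "word_op n w p = word_op n w 1 * p" if "w \<in> x_words n" for w p
    by (rule word_op_X_mult[OF set_x_words_range[OF that]])
  have NC: "set u \<subseteq> gens n 1" if "u \<in> NC_words n" for u
    using set_nc_words[of "n-1" n u] that n by (auto simp: NC_words_def)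
  have main: "\<forall>w u. w \<in> x_words n \<longrightarrow> u \<in> NC_words n \<longrightarrow> length u = l \<longrightarrow> F w u = 0" for l
  proof (induction l rule: less_induct)
    case (less l)
    show ?case
    proof (intro allI impI)
      fix w0 u0 assume 0: "w0 \<in> x_words n" "u0 \<in> NC_words n" "length u0 = l"
      let ?U = "{u \<in> NC_words n. length u = l}"
      have finU: "finite ?U" using finite_nc_words by (simp add: NC_words_def)
      have "(\<Sum>u\<in>?U. F w0 u * eps (word_op n u g)) = 0" if g: "homog {1..n} l g" for g
      proof -
        have "0 = ap (rep n f) g" using kill[OF g] by simp
        also have "\<dots> = (\<Sum>(w, u)\<in>P. of_int (F w u) * word_op n (w @ u) g)"
          unfolding rep_expand keys sum.reindex[OF inj] by (simp add: F_def case_prod_beta)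
        also have "\<dots> = (\<Sum>(w, u)\<in>P. of_int (if length u = l then F w u * eps (word_op n u g) else 0) * word_op n w 1)"
        proof (rule sum.cong[OF refl], clarify)
          fix w u assume "(w, u) \<in> P"
          then have wu: "w \<in> x_words n" "u \<in> NC_words n" by (auto simp: P_def)
          have h: "if length u \<le> l then homog {1..n} (l - length u) (word_op n u g) else word_op n u g = 0"
            by (rule homog_word_op[OF NC[OF wu(2)] _ _ g]) auto
          consider "length u < l" | "length u = l" | "length u > l" by linarith
          then show "of_int (F w u) * word_op n (w @ u) g = of_int (if length u = l then F w u * eps (word_op n u g) else 0) * word_op n w 1"
          proof cases
            case 1
            then show ?thesis using less[OF 1] wu by auto
          next
            case 2
            then have "word_op n u g = of_int (eps (word_op n u g))" using h homog_0_eq by auto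
            then have "word_op n (w @ u) g = of_int (eps (word_op n u g)) * word_op n w 1"
              using xmult[OF wu(1)] by (metis mult_of_int_commute word_op_simps(3))
            then show ?thesis using 2 by (simp add: mult.assoc)
          next
            case 3
            then show ?thesis using h by simp
          qed
        qed
        finally have "xcoef w0 (\<Sum>(w, u)\<in>P. of_int (if length u = l then F w u * eps (word_op n u g) else 0) * word_op n w 1) = 0"
          by (simp add: xcoef_linear)
        then have "0 = (\<Sum>(w, u)\<in>P. (if length u = l then F w u * eps (word_op n u g) else 0) * xcoef w0 (word_op n w 1))"
          by (simp add: xcoef_sum case_prod_unfold xcoef_linear)
        also have "\<dots> = (\<Sum>(w, u)\<in>P. if w = w0 \<and> length u = l then F w0 u * eps (word_op n u g) else 0)"
          by (rule sum.cong) (auto simp: P_def xcoef_word[OF 0(1)])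
        also have "\<dots> = (\<Sum>x\<in>{x\<in>P. fst x = w0 \<and> length (snd x) = l}. F w0 (snd x) * eps (word_op n (snd x) g))"
          using finP by (simp add: sum.inter_filter case_prod_beta)
        also have "\<dots> = (\<Sum>u\<in>{u\<in>?U. (w0, u) \<in> P}. F w0 u * eps (word_op n u g))"
          by (rule sum.reindex_bij_witness[of _ "\<lambda>u. (w0, u)" snd]) (auto simp: P_def)
        also have "\<dots> = (\<Sum>u\<in>?U. F w0 u * eps (word_op n u g))"
          by (rule sum.mono_neutral_left) (use finU 0 in \<open>auto simp: P_def F_def in_keys_iff\<close>)
        finally show ?thesis by simp
      qed
      then show "F w0 u0 = 0"
        using nc_words_functionals_independent[of "n-1" n l "F w0" u0] 0 n by (simp add: NC_words_def)
    qed
  qed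
  have "lookup f x = 0" for x
  proof (rule ccontr)
    assume "lookup f x \<noteq> 0"
    then obtain w u where "x = Word (w @ u)" "w \<in> x_words n" "u \<in> NC_words n"
      using f by (force simp: normal_words_def in_keys_iff[symmetric])
    then show False using main \<open>lookup f x \<noteq> 0\<close> by (auto simp: F_def)
  qed
  then show ?thesis by (intro poly_mapping_eqI) simp
qed

section \<open>The action\<close>

text \<open>
  The generating set of \<open>Pol n\<close> is \<open>{1..n}\<close>; the simplifier must not turn the \<open>1\<close> into a successor.
\<close>

declare One_nat_def [simp del]

lemma NH_eq: "presented_ring (nh_gens n) (nh_relators n) = NH n"
  by (simp add: NH_def)

lemma pol_relators_subset: "pol_relators n \<subseteq> carrier (free_ring {1..n})"
  by (auto simp: pol_relators_def intro!: free_ring_closed fvar_in_free_ring)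

text \<open>
  The maps compared below are only known to be additive on classes of polynomials, not ring
  homomorphisms; for such maps agreement on words suffices.
\<close>

lemma free_ring_additive_eq:
  fixes \<phi> \<psi> :: "'g fpoly \<Rightarrow> 'b::ab_group_add"
  assumes f: "f \<in> carrier (free_ring G)"
    and \<phi>: "\<And>f g. f \<in> carrier (free_ring G) \<Longrightarrow> g \<in> carrier (free_ring G) \<Longrightarrow> \<phi> (f + g) = \<phi> f + \<phi> g"
    and \<psi>: "\<And>f g. f \<in> carrier (free_ring G) \<Longrightarrow> g \<in> carrier (free_ring G) \<Longrightarrow> \<psi> (f + g) = \<psi> f + \<psi> g"
    and w: "\<And>w. set w \<subseteq> G \<Longrightarrow> \<phi> (mon w) = \<psi> (mon w)"
  shows "\<phi> f = \<psi> f"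
proof -
  have sub: "\<chi> (f - g) = \<chi> f - \<chi> g"
    if "f \<in> carrier (free_ring G)" "g \<in> carrier (free_ring G)"
      "\<And>f g. f \<in> carrier (free_ring G) \<Longrightarrow> g \<in> carrier (free_ring G) \<Longrightarrow> \<chi> (f + g) = \<chi> f + \<chi> g"
    for \<chi> :: "'g fpoly \<Rightarrow> 'b" and f g
  proof -
    have "\<chi> ((f - g) + g) = \<chi> (f - g) + \<chi> g" using that by (intro that(3)) (auto intro: free_ring_closed)
    then show ?thesis by simp
  qed
  have at0: "\<chi> 0 = 0" if "\<And>f g. f \<in> carrier (free_ring G) \<Longrightarrow> g \<in> carrier (free_ring G) \<Longrightarrow> \<chi> (f + g) = \<chi> f + \<chi> g"
    for \<chi> :: "'g fpoly \<Rightarrow> 'b"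
    using that[of 0 0] free_ring_closed(1)[of G] by simp
  show ?thesis using f
  proof (induction rule: free_ring_induct)
    case zero
    show ?case using at0[OF \<phi>] at0[OF \<psi>] by simp
  next
    case (mon v)
    then show ?case by (rule w)
  next
    case (diff f g)
    then show ?case using sub[OF diff(1,2) \<phi>] sub[OF diff(1,2) \<psi>] by simp
  qed
qed

lemma ring_actionD:
  assumes "ring_action A M act"
  shows "a \<in> carrier A \<Longrightarrow> f \<in> carrier M \<Longrightarrow> act a f \<in> carrier M"
    "a \<in> carrier A \<Longrightarrow> b \<in> carrier A \<Longrightarrow> f \<in> carrier M \<Longrightarrow> act (a \<oplus>\<^bsub>A\<^esub> b) f = act a f \<oplus>\<^bsub>M\<^esub> act b f"
    "a \<in> carrier A \<Longrightarrow> b \<in> carrier A \<Longrightarrow> f \<in> carrier M \<Longrightarrow> act (a \<otimes>\<^bsub>A\<^esub> b) f = act a (act b f)"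
    "f \<in> carrier M \<Longrightarrow> act \<one>\<^bsub>A\<^esub> f = f"
  using assms by (simp_all add: ring_action_def)

lemma idl_mono: "R \<subseteq> R' \<Longrightarrow> a \<in> idl R \<Longrightarrow> a \<in> idl R'"
  by (rotate_tac, induction rule: idl.induct) (auto intro: idl.intros)

definition spol_in :: "nat \<Rightarrow> spol set" where "spol_in n = spol_of ` carrier (free_ring {1..n})"

lemma spol_in_closed:
  "0 \<in> spol_in n" "1 \<in> spol_in n" "p \<in> spol_in n \<Longrightarrow> q \<in> spol_in n \<Longrightarrow> p + q \<in> spol_in n" "p \<in> spol_in n \<Longrightarrow> q \<in> spol_in n \<Longrightarrow> p - q \<in> spol_in n"
  "p \<in> spol_in n \<Longrightarrow> q \<in> spol_in n \<Longrightarrow> p * q \<in> spol_in n" "p \<in> spol_in n \<Longrightarrow> - p \<in> spol_in n" "i \<in> {1..n} \<Longrightarrow> sx i \<in> spol_in n"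
proof -
  show "0 \<in> spol_in n" "1 \<in> spol_in n"
    unfolding spol_in_def using free_ring_closed(1,2)[of "{1..n}"] by (metis image_eqI spol_of_simps(1,2))+
  show "i \<in> {1..n} \<Longrightarrow> sx i \<in> spol_in n"
    unfolding spol_in_def sx_def by (intro imageI fvar_in_free_ring)
  show "p \<in> spol_in n \<Longrightarrow> q \<in> spol_in n \<Longrightarrow> p + q \<in> spol_in n" "p \<in> spol_in n \<Longrightarrow> q \<in> spol_in n \<Longrightarrow> p - q \<in> spol_in n"
    "p \<in> spol_in n \<Longrightarrow> q \<in> spol_in n \<Longrightarrow> p * q \<in> spol_in n" "p \<in> spol_in n \<Longrightarrow> - p \<in> spol_in n"
    unfolding spol_in_def by (auto simp flip: spol_of_simps intro!: imageI free_ring_closed)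
qed

lemma spol_in_induct [consumes 1, case_names one var diff]:
  assumes "p \<in> spol_in n" "Q 1" "\<And>i p. i \<in> {1..n} \<Longrightarrow> p \<in> spol_in n \<Longrightarrow> Q p \<Longrightarrow> Q (sx i * p)"
    "\<And>p q. p \<in> spol_in n \<Longrightarrow> q \<in> spol_in n \<Longrightarrow> Q p \<Longrightarrow> Q q \<Longrightarrow> Q (p - q)"
  shows "Q p"
proof -
  obtain f where f: "p = spol_of f" "f \<in> carrier (free_ring {1..n})" using assms(1) by (auto simp: spol_in_def)
  have "Q (spol_of f)" using f(2)
  proof (induction rule: free_ring_induct)
    case zero
    have "Q (1 - 1)" by (rule assms(4)) (simp_all add: spol_in_closed assms(2))
    then show ?case by simp
  next
    case (mon w)
    then show ?case
    proof (induction w)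
      case (Cons i w)
      have "spol_of (mon w) \<in> spol_in n" unfolding spol_in_def by (rule imageI) (use Cons in \<open>simp add: mon_in_free_ring\<close>)
      then show ?case using assms(3)[of i "spol_of (mon w)"] Cons by (simp add: mon_Cons sx_def)
    qed (simp add: mon_Nil assms(2))
  next
    case (diff f g)
    then show ?case using assms(4)[of "spol_of f" "spol_of g"] by (simp add: spol_in_def)
  qed
  then show ?thesis using f by simp
qed

lemma homog_spol_in: "homog {1..n} d p \<Longrightarrow> p \<in> spol_in n"
  by (induction rule: homog.induct) (blast intro: spol_in_closed)+

lemma spol_in_s_op: "p \<in> spol_in n \<Longrightarrow> 1 \<le> i \<Longrightarrow> i < n \<Longrightarrow> s_op i p \<in> spol_in n"
proof (induction rule: spol_in_induct)
  case (var j p)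
  have "s_img i j \<in> spol_in n" using var by (auto simp: s_img_def intro!: spol_in_closed)
  then show ?case using var by (auto intro: spol_in_closed)
qed (auto intro: spol_in_closed)

lemma spol_in_sD: "p \<in> spol_in n \<Longrightarrow> n \<ge> 2 \<Longrightarrow> sD_op n p \<in> spol_in n"
proof (induction rule: spol_in_induct)
  case (var j p)
  have "sD_img n j \<in> spol_in n" using var by (auto simp: sD_img_def intro!: spol_in_closed)
  then show ?case using var by (auto intro: spol_in_closed)
qed (auto intro: spol_in_closed)

lemma spol_in_del_op: "p \<in> spol_in n \<Longrightarrow> 1 \<le> i \<Longrightarrow> i < n \<Longrightarrow> del_op i p \<in> spol_in n"
proof (induction rule: spol_in_induct)
  case (var j p)
  have "s_img i j \<in> spol_in n" using var by (auto simp: s_img_def intro!: spol_in_closed)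
  then show ?case using var by (auto simp: del_op_mult del_op_sx intro!: spol_in_closed)
qed (auto intro: spol_in_closed)

lemma spol_in_delD_op: "p \<in> spol_in n \<Longrightarrow> n \<ge> 2 \<Longrightarrow> delD_op n p \<in> spol_in n"
proof (induction rule: spol_in_induct)
  case (var j p)
  have "sD_img n j \<in> spol_in n" using var by (auto simp: sD_img_def intro!: spol_in_closed)
  then show ?case using var by (auto simp: delD_op_mult delD_op_sx intro!: spol_in_closed)
qed (auto intro: spol_in_closed)

lemma spol_in_nh_op:
  assumes "p \<in> spol_in n" "n \<ge> 2" "g \<in> nh_gens n" shows "nh_op n g p \<in> spol_in n"
proof (cases g)
  case (X i)
  then have "i \<in> {1..n}" using assms by (auto simp: nh_gens_def)
  then show ?thesis using X assms by (simp add: spol_in_closed)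
next
  case (Del i)
  then show ?thesis using assms by (auto simp: nh_gens_def intro!: spol_in_del_op)
next
  case DelD
  then show ?thesis using assms spol_in_delD_op[of p n] by (simp add: max_def)
qed

lemma spol_in_rep:
  assumes "n \<ge> 2" "f \<in> carrier (free_ring (nh_gens n))" "p \<in> spol_in n" shows "ap (rep n f) p \<in> spol_in n"
  using assms(2)
proof (induction rule: free_ring_induct)
  case (mon w)
  then show ?case
    by (induction w) (auto simp: rep_mon assms spol_in_nh_op)
qed (auto intro: spol_in_closed)

text \<open>
  The embedding of \<open>Pol n\<close> into the skew polynomials in all variables. Its image is \<open>spol_in n\<close>, and the
  action is defined and compared on the image.
\<close>

definition iota :: "nat \<Rightarrow> nat fpoly set \<Rightarrow> spol"
  where "iota n F = spol_of (SOME f. f \<in> carrier (free_ring {1..n}) \<and> F = presented_class {1..n} (pol_relators n) f)"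

context
  fixes n :: nat
begin

interpretation L: presentation "{1..n}" "pol_relators n"
  by unfold_locales (rule pol_relators_subset)

lemma Pol_eq: "presented_ring {1..n} (pol_relators n) = Pol n" by (simp add: Pol_def)

lemma Pol_carrier: "carrier (Pol n) = L.cls ` L.F"
  using L.carrier_presented by (simp add: Pol_def)

lemma iota_cls: "f \<in> L.F \<Longrightarrow> iota n (L.cls f) = spol_of f"
proof -
  assume f: "f \<in> L.F"
  define g where "g = (SOME g. g \<in> L.F \<and> L.cls f = L.cls g)"
  have g: "g \<in> L.F \<and> L.cls f = L.cls g" unfolding g_def by (rule someI[of _ f]) (simp add: f)
  then have "f - g \<in> idl (pol_relators n)" using L.cls_eq_iff[OF f, of g] by blast
  then have "f - g \<in> idl anticomm" by (rule idl_mono[rotated]) (auto simp: pol_relators_def anticomm_def)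
  then have "spol_of f = spol_of g" by (simp flip: spol_of_eq_0_iff)
  then show ?thesis by (simp add: iota_def g_def)
qed

lemma iota_image: "iota n ` carrier (Pol n) = spol_in n"
  unfolding Pol_carrier spol_in_def image_image by (rule image_cong[OF refl]) (rule iota_cls)

lemma iota_in: "F \<in> carrier (Pol n) \<Longrightarrow> iota n F \<in> spol_in n"
  using iota_image by blast

lemma iota_inj: "inj_on (iota n) (carrier (Pol n))"
proof (rule inj_onI)
  fix F G assume "F \<in> carrier (Pol n)" "G \<in> carrier (Pol n)" and eq: "iota n F = iota n G"
  then obtain f g where fg: "F = L.cls f" "f \<in> L.F" "G = L.cls g" "g \<in> L.F"
    unfolding Pol_carrier by blast
  have "spol_of (f - g) = 0" using eq fg by (simp add: iota_cls)
  then have "f - g \<in> idl anticomm" by (simp only: spol_of_eq_0_iff)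
  then have "f - g \<in> idl (pol_relators n)"
  proof (rule idl_retraction)
    show "f - g \<in> L.F" using fg by (auto intro: free_ring_closed)
    show "fp_eval (\<lambda>g. if g \<in> {1..n} then fvar g else 0) r \<in> pol_relators n \<union> {0}" if "r \<in> anticomm" for r
      using that by (auto simp: anticomm_def pol_relators_def)
  qed
  then show "F = G" using L.cls_eq_iff fg by blast
qed

lemma iota_hom:
  "F \<in> carrier (Pol n) \<Longrightarrow> G \<in> carrier (Pol n) \<Longrightarrow> iota n (F \<oplus>\<^bsub>Pol n\<^esub> G) = iota n F + iota n G"
  "F \<in> carrier (Pol n) \<Longrightarrow> G \<in> carrier (Pol n) \<Longrightarrow> iota n (F \<otimes>\<^bsub>Pol n\<^esub> G) = iota n F * iota n G"
  "iota n \<one>\<^bsub>Pol n\<^esub> = 1" "iota n \<zero>\<^bsub>Pol n\<^esub> = 0"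
  "F \<in> carrier (Pol n) \<Longrightarrow> iota n (\<ominus>\<^bsub>Pol n\<^esub> F) = - iota n F"
  "i \<in> {1..n} \<Longrightarrow> iota n (pol_x n i) = sx i"
proof -
  note cl = L.cls_add[symmetric] L.cls_mult[symmetric] L.cls_uminus[symmetric] iota_cls free_ring_closed
  show "F \<in> carrier (Pol n) \<Longrightarrow> G \<in> carrier (Pol n) \<Longrightarrow> iota n (F \<oplus>\<^bsub>Pol n\<^esub> G) = iota n F + iota n G"
    "F \<in> carrier (Pol n) \<Longrightarrow> G \<in> carrier (Pol n) \<Longrightarrow> iota n (F \<otimes>\<^bsub>Pol n\<^esub> G) = iota n F * iota n G"
    "F \<in> carrier (Pol n) \<Longrightarrow> iota n (\<ominus>\<^bsub>Pol n\<^esub> F) = - iota n F"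
    unfolding Pol_carrier by (auto simp: cl Pol_eq[symmetric])
  show "iota n \<one>\<^bsub>Pol n\<^esub> = 1" "iota n \<zero>\<^bsub>Pol n\<^esub> = 0"
    unfolding Pol_eq[symmetric] L.cls_one[symmetric] L.cls_zero[symmetric]
    by (simp_all add: iota_cls free_ring_closed)
  show "i \<in> {1..n} \<Longrightarrow> iota n (pol_x n i) = sx i"
    by (simp add: pol_x_def iota_cls fvar_in_free_ring sx_def)
qed

lemma pol_x_closed: "i \<in> {1..n} \<Longrightarrow> pol_x n i \<in> carrier (Pol n)"
  unfolding Pol_carrier pol_x_def by (intro imageI fvar_in_free_ring)

definition iota_inv :: "spol \<Rightarrow> nat fpoly set" where "iota_inv = inv_into (carrier (Pol n)) (iota n)"

lemma iota_inv_closed: "p \<in> spol_in n \<Longrightarrow> iota_inv p \<in> carrier (Pol n)"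
  unfolding iota_inv_def iota_image[symmetric] by (rule inv_into_into)

lemma iota_iota_inv: "p \<in> spol_in n \<Longrightarrow> iota n (iota_inv p) = p"
  unfolding iota_inv_def iota_image[symmetric] by (rule f_inv_into_f)

lemma iota_eqI: "F \<in> carrier (Pol n) \<Longrightarrow> G \<in> carrier (Pol n) \<Longrightarrow> iota n F = iota n G \<Longrightarrow> F = G"
  using iota_inj by (rule inj_onD)

lemma iota_inv_ring_hom:
  assumes "\<And>p. p \<in> spol_in n \<Longrightarrow> s p \<in> spol_in n" "s 1 = 1"
    "\<And>p q. s (p + q) = s p + s q" "\<And>p q. s (p * q) = s p * s q"
  shows "(\<lambda>F. iota_inv (s (iota n F))) \<in> ring_hom (Pol n) (Pol n)"
proof -
  interpret R: ring "Pol n" by (rule ring_Pol)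
  show ?thesis
    by (rule ring_hom_memI; (rule iota_eqI)?)
      (auto simp: iota_hom iota_iota_inv iota_inv_closed iota_in assms spol_in_closed)
qed

lemma iota_inv_twisted:
  assumes "\<And>p. p \<in> spol_in n \<Longrightarrow> s p \<in> spol_in n" "\<And>p. p \<in> spol_in n \<Longrightarrow> d p \<in> spol_in n"
    "\<And>p q. d (p + q) = d p + d q" "\<And>p q. d (p * q) = d p * q + s p * d q"
    "\<And>F. F \<in> carrier (Pol n) \<Longrightarrow> D F \<in> carrier (Pol n)"
    "\<And>F. F \<in> carrier (Pol n) \<Longrightarrow> iota n (D F) = d (iota n F)"
  shows "twisted_derivation (Pol n) (\<lambda>F. iota_inv (s (iota n F))) D"
proof -
  interpret R: ring "Pol n" by (rule ring_Pol)
  show ?thesis unfolding twisted_derivation_def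
    by (intro conjI ballI; (rule iota_eqI)?)
      (auto simp: iota_hom iota_iota_inv iota_inv_closed iota_in assms spol_in_closed)
qed

text \<open>
  A twisted derivation is determined by its values on the variables. This turns the conditions
  \<open>is_del\<close> and \<open>is_delD\<close> into the concrete operators.
\<close>

lemma iota_d_unique:
  assumes d: "twisted_derivation (Pol n) s D" and s: "s \<in> ring_hom (Pol n) (Pol n)"
    and st: "\<And>i. i \<in> {1..n} \<Longrightarrow> iota n (s (pol_x n i)) = t (sx i)"
    and one: "D \<one>\<^bsub>Pol n\<^esub> = \<zero>\<^bsub>Pol n\<^esub>"
    and gen: "\<And>i. i \<in> {1..n} \<Longrightarrow> iota n (D (pol_x n i)) = e (sx i)"
    and e: "e 1 = 0" "\<And>p q. e (p + q) = e p + e q" "\<And>p q. e (p * q) = e p * q + t p * e q"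
    and F: "F \<in> carrier (Pol n)"
  shows "iota n (D F) = e (iota n F)"
proof -
  interpret R: ring "Pol n" by (rule ring_Pol)
  obtain f where f: "F = L.cls f" "f \<in> L.F" using F unfolding Pol_carrier by blast
  note cl = L.cls_closed[unfolded Pol_eq]
  have D: "\<And>F. F \<in> carrier (Pol n) \<Longrightarrow> D F \<in> carrier (Pol n)"
    "\<And>F G. F \<in> carrier (Pol n) \<Longrightarrow> G \<in> carrier (Pol n) \<Longrightarrow> D (F \<oplus>\<^bsub>Pol n\<^esub> G) = D F \<oplus>\<^bsub>Pol n\<^esub> D G"
    "\<And>F G. F \<in> carrier (Pol n) \<Longrightarrow> G \<in> carrier (Pol n) \<Longrightarrow> D (F \<otimes>\<^bsub>Pol n\<^esub> G) = D F \<otimes>\<^bsub>Pol n\<^esub> G \<oplus>\<^bsub>Pol n\<^esub> s F \<otimes>\<^bsub>Pol n\<^esub> D G"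
    using d unfolding twisted_derivation_def by blast+
  have "iota n (D (L.cls f)) = e (iota n (L.cls f))"
    using f(2)
  proof (rule free_ring_additive_eq)
    fix f g assume fg: "f \<in> L.F" "g \<in> L.F"
    show "iota n (D (L.cls (f + g))) = iota n (D (L.cls f)) + iota n (D (L.cls g))"
      "e (iota n (L.cls (f + g))) = e (iota n (L.cls f)) + e (iota n (L.cls g))"
      using fg cl[OF fg(1)] cl[OF fg(2)]
      by (simp_all add: L.cls_add[unfolded Pol_eq] iota_hom e D)
  next
    fix w assume "set w \<subseteq> {1..n}"
    then show "iota n (D (L.cls (mon w))) = e (iota n (L.cls (mon w)))"
    proof (induction w)
      case Nil
      show ?case using one by (simp add: mon_Nil L.cls_one[unfolded Pol_eq] iota_hom e)
    next
      case (Cons i w)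
      then have i: "i \<in> {1..n}" and w: "mon w \<in> L.F" by (auto simp: mon_in_free_ring)
      have eq: "L.cls (mon (i # w)) = pol_x n i \<otimes>\<^bsub>Pol n\<^esub> L.cls (mon w)"
        using L.cls_mult[unfolded Pol_eq, OF fvar_in_free_ring[OF i] w] by (simp add: mon_Cons pol_x_def)
      show ?case unfolding eq
        using Cons i pol_x_closed[OF i] cl[OF w] ring_hom_closed[OF s pol_x_closed[OF i]] st[OF i]
        by (simp add: iota_hom e gen D)
    qed
  qed
  then show ?thesis using f by simp
qed

context
  assumes n: "n \<ge> 2"
begin

interpretation H: presentation "nh_gens n" "nh_relators n"
  by unfold_locales (rule nh_relators_subset[OF n])

lemma NH_carrier: "carrier (NH n) = H.cls ` H.F"
  using H.carrier_presented by (simp add: NH_def)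

text \<open>
  The choice of a representative is harmless since the relators act as zero (lemma \<open>rep_idl\<close>).
\<close>

definition nh_act :: "nh_gen fpoly set \<Rightarrow> nat fpoly set \<Rightarrow> nat fpoly set"
  where "nh_act a F = iota_inv (ap (rep n (SOME f. f \<in> H.F \<and> a = H.cls f)) (iota n F))"

lemma nh_act_props:
  assumes f: "f \<in> H.F" and F: "F \<in> carrier (Pol n)"
  shows "iota n (nh_act (H.cls f) F) = ap (rep n f) (iota n F)" "nh_act (H.cls f) F \<in> carrier (Pol n)"
proof -
  define g where "g = (SOME g. g \<in> H.F \<and> H.cls f = H.cls g)"
  have g: "g \<in> H.F \<and> H.cls f = H.cls g" unfolding g_def by (rule someI[of _ f]) (simp add: f)
  then have "f - g \<in> idl (nh_relators n)" using H.cls_eq_iff[OF f, of g] by blast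
  then have r: "rep n f = rep n g" using rep_idl[OF n, of "f - g"] by simp
  have eq: "nh_act (H.cls f) F = iota_inv (ap (rep n f) (iota n F))" by (simp add: nh_act_def r g_def)
  have "ap (rep n f) (iota n F) \<in> spol_in n" by (rule spol_in_rep[OF n f iota_in[OF F]])
  then show "iota n (nh_act (H.cls f) F) = ap (rep n f) (iota n F)" "nh_act (H.cls f) F \<in> carrier (Pol n)"
    by (simp_all add: eq iota_iota_inv iota_inv_closed)
qed

lemma nh_act_gen:
  assumes "g \<in> nh_gens n" "F \<in> carrier (Pol n)"
  shows "iota n (nh_act (nh_class n g) F) = nh_op n g (iota n F)" "nh_act (nh_class n g) F \<in> carrier (Pol n)"
  using nh_act_props[OF fvar_in_free_ring[OF assms(1)] assms(2)] by (simp_all add: nh_class_def)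

lemma gens_in_nh_gens: "i \<in> {1..n} \<Longrightarrow> X i \<in> nh_gens n" "i \<in> {1..n-1} \<Longrightarrow> Del i \<in> nh_gens n" "DelD \<in> nh_gens n"
  by (auto simp: nh_gens_def)

lemma nh_act_is_action: "ring_action (NH n) (Pol n) nh_act"
proof -
  interpret R: ring "Pol n" by (rule ring_Pol)
  show ?thesis unfolding ring_action_def NH_carrier
  proof (intro conjI ballI; (elim imageE)?; (hypsubst)?)
    fix f F assume "f \<in> H.F" "F \<in> carrier (Pol n)"
    then show "nh_act (H.cls f) F \<in> carrier (Pol n)" by (rule nh_act_props)
  next
    fix f F G assume a: "f \<in> H.F" "F \<in> carrier (Pol n)" "G \<in> carrier (Pol n)"
    show "nh_act (H.cls f) (F \<oplus>\<^bsub>Pol n\<^esub> G) = nh_act (H.cls f) F \<oplus>\<^bsub>Pol n\<^esub> nh_act (H.cls f) G"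
      by (rule iota_eqI) (use a in \<open>simp_all add: nh_act_props iota_hom\<close>)
  next
    fix F f g assume a: "F \<in> carrier (Pol n)" "f \<in> H.F" "g \<in> H.F"
    show "nh_act (H.cls f \<oplus>\<^bsub>NH n\<^esub> H.cls g) F = nh_act (H.cls f) F \<oplus>\<^bsub>Pol n\<^esub> nh_act (H.cls g) F"
      unfolding H.cls_add[OF a(2,3), unfolded NH_eq, symmetric]
      by (rule iota_eqI) (use a in \<open>simp_all add: nh_act_props iota_hom free_ring_closed\<close>)
  next
    fix F f g assume a: "F \<in> carrier (Pol n)" "f \<in> H.F" "g \<in> H.F"
    show "nh_act (H.cls f \<otimes>\<^bsub>NH n\<^esub> H.cls g) F = nh_act (H.cls f) (nh_act (H.cls g) F)"
      unfolding H.cls_mult[OF a(2,3), unfolded NH_eq, symmetric]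
      by (rule iota_eqI) (use a in \<open>simp_all add: nh_act_props iota_hom free_ring_closed\<close>)
  next
    fix F assume a: "F \<in> carrier (Pol n)"
    show "nh_act \<one>\<^bsub>NH n\<^esub> F = F"
      unfolding H.cls_one[unfolded NH_eq, symmetric]
      by (rule iota_eqI) (use a in \<open>simp_all add: nh_act_props iota_hom free_ring_closed\<close>)
  qed
qed

lemma is_s_s_op: "i \<in> {1..n-1} \<Longrightarrow> is_s n i (\<lambda>F. iota_inv (s_op i (iota n F)))"
proof -
  assume i: "i \<in> {1..n-1}"
  interpret R: ring "Pol n" by (rule ring_Pol)
  have PS: "s_op i p \<in> spol_in n" if "p \<in> spol_in n" for p using spol_in_s_op[OF that] i by auto
  have ii: "i \<in> {1..n}" "i + 1 \<in> {1..n}" using i n by auto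
  show ?thesis unfolding is_s_def
  proof (intro conjI ballI)
    show "(\<lambda>F. iota_inv (s_op i (iota n F))) \<in> ring_hom (Pol n) (Pol n)"
      by (rule iota_inv_ring_hom) (simp_all add: PS)
    show "iota_inv (s_op i (iota n (pol_x n i))) = \<ominus>\<^bsub>Pol n\<^esub> pol_x n (i + 1)"
      by (rule iota_eqI) (use ii pol_x_closed[OF ii(2)] PS in \<open>simp_all add: iota_iota_inv iota_inv_closed iota_hom s_img_def spol_in_closed\<close>)
    show "iota_inv (s_op i (iota n (pol_x n (i + 1)))) = \<ominus>\<^bsub>Pol n\<^esub> pol_x n i"
      by (rule iota_eqI) (use ii pol_x_closed[OF ii(1)] PS in \<open>simp_all add: iota_iota_inv iota_inv_closed iota_hom s_img_def spol_in_closed\<close>)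
    fix j assume j: "j \<in> {1..n} - {i, i + 1}"
    show "iota_inv (s_op i (iota n (pol_x n j))) = \<ominus>\<^bsub>Pol n\<^esub> pol_x n j"
      by (rule iota_eqI) (use j pol_x_closed[of j] PS in \<open>simp_all add: iota_iota_inv iota_inv_closed iota_hom s_img_def spol_in_closed\<close>)
  qed
qed

lemma is_sD_sD: "is_sD n (\<lambda>F. iota_inv (sD_op n (iota n F)))"
proof -
  interpret R: ring "Pol n" by (rule ring_Pol)
  have PS: "sD_op n p \<in> spol_in n" if "p \<in> spol_in n" for p using spol_in_sD[OF that n] .
  have ii: "n \<in> {1..n}" "n - 1 \<in> {1..n}" using n by auto
  show ?thesis unfolding is_sD_def
  proof (intro conjI ballI)
    show "(\<lambda>F. iota_inv (sD_op n (iota n F))) \<in> ring_hom (Pol n) (Pol n)"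
      by (rule iota_inv_ring_hom) (use n in \<open>simp_all add: PS\<close>)
    show "iota_inv (sD_op n (iota n (pol_x n n))) = pol_x n (n - 1)"
      by (rule iota_eqI) (use n ii pol_x_closed[OF ii(2)] PS in \<open>simp_all add: iota_iota_inv iota_inv_closed iota_hom sD_img_def spol_in_closed\<close>)
    show "iota_inv (sD_op n (iota n (pol_x n (n - 1)))) = pol_x n n"
      by (rule iota_eqI) (use n ii pol_x_closed[OF ii(1)] PS in \<open>simp_all add: iota_iota_inv iota_inv_closed iota_hom sD_img_def spol_in_closed\<close>)
    fix j assume j: "j \<in> {1..n} - {n - 1, n}"
    show "iota_inv (sD_op n (iota n (pol_x n j))) = \<ominus>\<^bsub>Pol n\<^esub> pol_x n j"
      by (rule iota_eqI) (use n j pol_x_closed[of j] PS in \<open>simp_all add: iota_iota_inv iota_inv_closed iota_hom sD_img_def spol_in_closed\<close>)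
  qed
qed

lemma NH_action_nh_act: "NH_action n nh_act"
proof -
  interpret R: ring "Pol n" by (rule ring_Pol)
  have one: "\<one>\<^bsub>Pol n\<^esub> \<in> carrier (Pol n)" by simp
  show ?thesis unfolding NH_action_def
  proof (intro conjI ballI)
    show "ring_action (NH n) (Pol n) nh_act" by (rule nh_act_is_action)
  next
    fix i F assume a: "i \<in> {1..n}" "F \<in> carrier (Pol n)"
    show "nh_act (nh_class n (X i)) F = pol_x n i \<otimes>\<^bsub>Pol n\<^esub> F"
      by (rule iota_eqI)
        (use a nh_act_gen[OF gens_in_nh_gens(1)] pol_x_closed in \<open>simp_all add: iota_hom\<close>)
  next
    fix i assume i: "i \<in> {1..n-1}"
    note g = nh_act_gen[OF gens_in_nh_gens(2)[OF i]]
    have tw: "twisted_derivation (Pol n) (\<lambda>F. iota_inv (s_op i (iota n F))) (nh_act (nh_class n (Del i)))"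
      by (rule iota_inv_twisted[of _ "del_op i"]) (use i n spol_in_s_op spol_in_del_op g in \<open>auto simp: del_op_mult\<close>)
    show "is_del n i (nh_act (nh_class n (Del i)))"
      unfolding is_del_def
    proof (intro conjI ballI)
      show "\<exists>s. is_s n i s \<and> twisted_derivation (Pol n) s (nh_act (nh_class n (Del i)))"
        using is_s_s_op[OF i] tw by blast
      show "nh_act (nh_class n (Del i)) \<one>\<^bsub>Pol n\<^esub> = \<zero>\<^bsub>Pol n\<^esub>"
        by (rule iota_eqI) (simp_all add: g[OF one] iota_hom)
      fix j assume j: "j \<in> {1..n}"
      show "nh_act (nh_class n (Del i)) (pol_x n j) = (if j \<in> {i, i + 1} then \<one>\<^bsub>Pol n\<^esub> else \<zero>\<^bsub>Pol n\<^esub>)"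
        by (rule iota_eqI) (use g[OF pol_x_closed[OF j]] j in \<open>auto simp: iota_hom del_op_sx\<close>)
    qed
  next
    note g = nh_act_gen[OF gens_in_nh_gens(3)]
    have m: "max n 1 = n" "max n (Suc 0) = n" using n by auto
    have tw: "twisted_derivation (Pol n) (\<lambda>F. iota_inv (sD_op n (iota n F))) (nh_act (nh_class n DelD))"
      by (rule iota_inv_twisted[of _ "delD_op n"]) (use n spol_in_sD spol_in_delD_op g in \<open>auto simp: delD_op_mult m\<close>)
    have ii: "n \<in> {1..n}" "n - 1 \<in> {1..n}" "n - 1 \<noteq> n" using n by auto
    show "is_delD n (nh_act (nh_class n DelD))"
      unfolding is_delD_def
    proof (intro conjI ballI)
      show "\<exists>s. is_sD n s \<and> twisted_derivation (Pol n) s (nh_act (nh_class n DelD))"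
        using is_sD_sD tw by blast
      show "nh_act (nh_class n DelD) \<one>\<^bsub>Pol n\<^esub> = \<zero>\<^bsub>Pol n\<^esub>"
        by (rule iota_eqI) (use n in \<open>simp_all add: g[OF one] iota_hom m\<close>)
      show "nh_act (nh_class n DelD) (pol_x n n) = \<ominus>\<^bsub>Pol n\<^esub> \<one>\<^bsub>Pol n\<^esub>"
        by (rule iota_eqI) (use n g[OF pol_x_closed[OF ii(1)]] ii in \<open>simp_all add: iota_hom m delD_op_sx\<close>)
      show "nh_act (nh_class n DelD) (pol_x n (n - 1)) = \<one>\<^bsub>Pol n\<^esub>"
        by (rule iota_eqI) (use n g[OF pol_x_closed[OF ii(2)]] ii in \<open>simp_all add: iota_hom m delD_op_sx\<close>)
      fix j assume j: "j \<in> {1..n} - {n - 1, n}"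
      show "nh_act (nh_class n DelD) (pol_x n j) = \<zero>\<^bsub>Pol n\<^esub>"
        by (rule iota_eqI) (use n g[OF pol_x_closed[of j]] j in \<open>simp_all add: iota_hom m delD_op_sx\<close>)
    qed
  qed
qed

lemma action_unique_gen:
  assumes act: "NH_action n act" and g: "g \<in> nh_gens n" and F: "F \<in> carrier (Pol n)"
  shows "iota n (act (nh_class n g) F) = nh_op n g (iota n F)"
proof -
  interpret R: ring "Pol n" by (rule ring_Pol)
  have nn: "1 \<le> n" "max n 1 = n" "max n (Suc 0) = n" using n by auto
  show ?thesis
  proof (cases g)
    case (X i)
    then have i: "i \<in> {1..n}" using g by (auto simp: nh_gens_def)
    then have "act (nh_class n g) F = pol_x n i \<otimes>\<^bsub>Pol n\<^esub> F"
      using act F X by (simp add: NH_action_def)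
    then show ?thesis using X F i pol_x_closed[OF i] by (simp add: iota_hom)
  next
    case (Del i)
    then have i: "i \<in> {1..n-1}" using g by (auto simp: nh_gens_def)
    let ?D = "act (nh_class n g)"
    have "is_del n i ?D" using act i Del by (simp add: NH_action_def)
    then obtain s where s: "is_s n i s" "twisted_derivation (Pol n) s ?D" "?D \<one>\<^bsub>Pol n\<^esub> = \<zero>\<^bsub>Pol n\<^esub>"
      "\<And>j. j \<in> {1..n} \<Longrightarrow> ?D (pol_x n j) = (if j \<in> {i, i+1} then \<one>\<^bsub>Pol n\<^esub> else \<zero>\<^bsub>Pol n\<^esub>)"
      unfolding is_del_def by blast
    have sx: "iota n (s (pol_x n j)) = s_op i (sx j)" if j: "j \<in> {1..n}" for j
    proof -
      have ii: "i \<in> {1..n}" "i + 1 \<in> {1..n}" using i n by auto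
      consider "j = i" | "j = i + 1" | "j \<in> {1..n} - {i, i+1}" using j by blast
      then show ?thesis
      proof cases
        case 1
        have "s (pol_x n j) = \<ominus>\<^bsub>Pol n\<^esub> pol_x n (i+1)" using s(1) 1 by (simp only: is_s_def)
        then show ?thesis using 1 ii pol_x_closed[OF ii(2)] by (simp add: iota_hom s_img_def)
      next
        case 2
        have "s (pol_x n j) = \<ominus>\<^bsub>Pol n\<^esub> pol_x n i" using s(1) 2 by (simp only: is_s_def)
        then show ?thesis using 2 ii pol_x_closed[OF ii(1)] by (simp add: iota_hom s_img_def)
      next
        case 3
        have "s (pol_x n j) = \<ominus>\<^bsub>Pol n\<^esub> pol_x n j" using s(1) 3 unfolding is_s_def by blast
        then show ?thesis using 3 j pol_x_closed[OF j] by (simp add: iota_hom s_img_def)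
      qed
    qed
    have "iota n (?D F) = del_op i (iota n F)"
    proof (rule iota_d_unique[OF s(2), where t = "s_op i" and e = "del_op i"])
      show "s \<in> ring_hom (Pol n) (Pol n)" using s(1) by (simp only: is_s_def)
      show "iota n (?D (pol_x n j)) = del_op i (sx j)" if "j \<in> {1..n}" for j
        unfolding s(4)[OF that] by (simp add: iota_hom del_op_sx)
    qed (rule sx s(3) F del_op_mult del_op_simps; assumption?)+
    then show ?thesis using Del by simp
  next
    case DelD
    let ?D = "act (nh_class n g)"
    have "is_delD n ?D" using act DelD by (simp add: NH_action_def)
    then obtain s where s: "is_sD n s" "twisted_derivation (Pol n) s ?D" "?D \<one>\<^bsub>Pol n\<^esub> = \<zero>\<^bsub>Pol n\<^esub>"
      "?D (pol_x n n) = \<ominus>\<^bsub>Pol n\<^esub> \<one>\<^bsub>Pol n\<^esub>" "?D (pol_x n (n-1)) = \<one>\<^bsub>Pol n\<^esub>"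
      "\<And>j. j \<in> {1..n} - {n-1, n} \<Longrightarrow> ?D (pol_x n j) = \<zero>\<^bsub>Pol n\<^esub>"
      unfolding is_delD_def by blast
    have ii: "n \<in> {1..n}" "n - 1 \<in> {1..n}" "n \<noteq> n - 1" using n by auto
    have sx: "iota n (s (pol_x n j)) = sD_op n (sx j)" if j: "j \<in> {1..n}" for j
    proof -
      consider "j = n" | "j = n - 1" | "j \<in> {1..n} - {n-1, n}" using j by blast
      then show ?thesis
      proof cases
        case 1
        have "s (pol_x n j) = pol_x n (n-1)" using s(1) 1 by (simp only: is_sD_def)
        then show ?thesis using 1 ii nn by (simp add: iota_hom sD_img_def)
      next
        case 2
        have "s (pol_x n j) = pol_x n n" using s(1) 2 by (simp only: is_sD_def)
        then show ?thesis using 2 ii nn by (simp add: iota_hom sD_img_def)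
      next
        case 3
        have "s (pol_x n j) = \<ominus>\<^bsub>Pol n\<^esub> pol_x n j" using s(1) 3 unfolding is_sD_def by blast
        then show ?thesis using 3 j pol_x_closed[OF j] nn by (simp add: iota_hom sD_img_def)
      qed
    qed
    have dx: "iota n (?D (pol_x n j)) = delD_op n (sx j)" if j: "j \<in> {1..n}" for j
    proof -
      consider "j = n" | "j = n - 1" | "j \<in> {1..n} - {n-1, n}" using j by blast
      then show ?thesis
        by cases (use s(4-) ii nn in \<open>simp_all add: iota_hom delD_op_sx\<close>)
    qed
    have "iota n (?D F) = delD_op n (iota n F)"
    proof (rule iota_d_unique[OF s(2), where t = "sD_op n" and e = "delD_op n"])
      show "s \<in> ring_hom (Pol n) (Pol n)" using s(1) by (simp only: is_sD_def)
    qed (rule sx dx s(3) F delD_op_mult[OF nn(1)] delD_op_simps[OF nn(1)]; assumption?)+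
    then show ?thesis using DelD nn by simp
  qed
qed

text \<open>
  Every action that satisfies the defining conditions agrees with the concrete one, so faithfulness need
  only be checked for the latter.
\<close>

lemma action_unique:
  assumes act: "NH_action n act" and f: "f \<in> H.F" and F: "F \<in> carrier (Pol n)"
  shows "iota n (act (H.cls f) F) = ap (rep n f) (iota n F)"
proof -
  interpret R: ring "Pol n" by (rule ring_Pol)
  interpret N: ring "NH n" by (rule ring_NH[OF n])
  have ra: "ring_action (NH n) (Pol n) act" using act by (simp add: NH_action_def)
  note cl = H.cls_closed[unfolded NH_eq]
  have actc: "a \<in> carrier (NH n) \<Longrightarrow> F \<in> carrier (Pol n) \<Longrightarrow> act a F \<in> carrier (Pol n)" for a F
    by (rule ring_actionD(1)[OF ra])
  note gen = action_unique_gen[OF act]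
  show ?thesis using f
  proof (rule free_ring_additive_eq)
    fix f g assume fg: "f \<in> H.F" "g \<in> H.F"
    have "act (H.cls f \<oplus>\<^bsub>NH n\<^esub> H.cls g) F = act (H.cls f) F \<oplus>\<^bsub>Pol n\<^esub> act (H.cls g) F"
      by (rule ring_actionD(2)[OF ra cl[OF fg(1)] cl[OF fg(2)] F])
    then show "iota n (act (H.cls (f + g)) F) = iota n (act (H.cls f) F) + iota n (act (H.cls g) F)"
      using actc[OF cl[OF fg(1)] F] actc[OF cl[OF fg(2)] F]
      by (simp add: H.cls_add[OF fg, unfolded NH_eq] iota_hom)
    show "ap (rep n (f + g)) (iota n F) = ap (rep n f) (iota n F) + ap (rep n g) (iota n F)" by simp
  next
    fix w assume "set w \<subseteq> nh_gens n"
    then show "iota n (act (H.cls (mon w)) F) = ap (rep n (mon w)) (iota n F)"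
    proof (induction w)
      case Nil
      have "act \<one>\<^bsub>NH n\<^esub> F = F" by (rule ring_actionD(4)[OF ra F])
      then show ?case by (simp add: mon_Nil H.cls_one[unfolded NH_eq])
    next
      case (Cons g w)
      then have g: "g \<in> nh_gens n" and w: "mon w \<in> H.F" by (auto simp: mon_in_free_ring)
      have eq: "H.cls (mon (g # w)) = nh_class n g \<otimes>\<^bsub>NH n\<^esub> H.cls (mon w)"
        using H.cls_mult[unfolded NH_eq, OF fvar_in_free_ring[OF g] w] by (simp add: mon_Cons nh_class_def)
      have "nh_class n g \<in> carrier (NH n)" using cl[OF fvar_in_free_ring[OF g]] by (simp add: nh_class_def)
      then have "act (H.cls (mon (g # w))) F = act (nh_class n g) (act (H.cls (mon w)) F)"
        unfolding eq using cl[OF w] F by (intro ring_actionD(3)[OF ra])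
      then show ?case using Cons gen[OF g actc[OF cl[OF w] F]] by (simp add: rep_mon)
    qed
  qed
qed

lemma spanning: "f \<in> H.F \<Longrightarrow> f \<in> span_mod n (normal_words n)"
proof (induction rule: free_ring_induct)
  case (mon w)
  have "normal_words_of n (bideg w) \<subseteq> normal_words n" by (auto simp: normal_words_of_def)
  from subsetD[OF span_mod_mono[OF this] spanning_word[OF n mon]] show ?case .
qed (auto intro: span_mod_0 span_mod_diff)

lemma faithful:
  assumes "NH_action n act"
  shows "faithful_action (NH n) (Pol n) act"
  unfolding faithful_action_def
proof (intro ballI impI)
  fix a assume a: "a \<in> carrier (NH n)" and kill: "\<forall>F\<in>carrier (Pol n). act a F = \<zero>\<^bsub>Pol n\<^esub>"
  obtain f where f: "a = H.cls f" "f \<in> H.F" using a unfolding NH_carrier by blast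
  obtain g where g: "keys g \<subseteq> Word ` normal_words n" "f - g \<in> idl (nh_relators n)"
    using spanning[OF f(2)] by (auto simp: span_mod_def)
  have r: "rep n f = rep n g" using rep_idl[OF n g(2)] by simp
  have "g = 0"
  proof (rule normal_form_faithful[OF n g(1)])
    fix d p assume "homog {1..n} d p"
    then obtain F where F: "F \<in> carrier (Pol n)" "p = iota n F" using homog_spol_in[of n d p] iota_image by blast
    have "ap (rep n f) p = iota n (act a F)" using action_unique[OF assms f(2) F(1)] f F by simp
    then show "ap (rep n g) p = 0" using kill F r by (simp add: iota_hom)
  qed
  then show "a = \<zero>\<^bsub>NH n\<^esub>" using g(2) H.cls_eq_zero_iff[OF f(2), unfolded NH_eq] f(1) by simp
qed

end

end

declare One_nat_def [simp]

section \<open>Graded ranks from normal forms\<close>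

text \<open>
  A ring whose additive group is parametrised by the integer combinations of a set \<open>K\<close> of normal
  words. Coordinates with respect to \<open>K\<close> translate statements about \<open>\<int>\<close>-bases into statements about
  finitely supported functions.
\<close>

locale normal_forms =
  fixes A :: "('a, 'c) ring_scheme" and cl :: "('i \<Rightarrow>\<^sub>0 int) \<Rightarrow> 'a" and K :: "'i set"
  assumes ring: "ring A"
    and carrier: "carrier A = cl ` {f. keys f \<subseteq> K}"
    and cl_add: "\<And>f g. keys f \<subseteq> K \<Longrightarrow> keys g \<subseteq> K \<Longrightarrow> cl (f + g) = cl f \<oplus>\<^bsub>A\<^esub> cl g"
    and cl_inj: "inj_on cl {f. keys f \<subseteq> K}"
begin

sublocale ring A by (rule ring)

abbreviation NF :: "('i \<Rightarrow>\<^sub>0 int) set" where "NF \<equiv> {f. keys f \<subseteq> K}"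

abbreviation comb :: "('a \<Rightarrow>\<^sub>0 int) \<Rightarrow> 'a"
  where "comb c \<equiv> (\<Oplus>\<^bsub>A\<^esub>b\<in>keys c. [lookup c b] \<cdot>\<^bsub>A\<^esub> b)"

definition co :: "'a \<Rightarrow> ('i \<Rightarrow>\<^sub>0 int)" where "co = the_inv_into NF cl"

lemma co_cl: "f \<in> NF \<Longrightarrow> co (cl f) = f"
  unfolding co_def by (rule the_inv_into_f_f[OF cl_inj])

lemma co_NF: "a \<in> carrier A \<Longrightarrow> keys (co a) \<subseteq> K"
  using co_cl carrier by auto

lemma cl_co: "a \<in> carrier A \<Longrightarrow> cl (co a) = a"
  using co_cl carrier by auto

lemma NF_add: "f \<in> NF \<Longrightarrow> g \<in> NF \<Longrightarrow> f + g \<in> NF"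
  using Poly_Mapping.keys_add[of f g] by auto

lemma cl_closed: "f \<in> NF \<Longrightarrow> cl f \<in> carrier A"
  using carrier by blast

lemma cl_0: "cl 0 = \<zero>\<^bsub>A\<^esub>"
proof -
  have c: "cl 0 \<in> carrier A" by (rule cl_closed) simp
  have "cl 0 \<oplus>\<^bsub>A\<^esub> cl 0 = cl 0" using cl_add[of 0 0] by simp
  then show ?thesis using add.r_cancel_one[OF c c] by simp
qed

lemma cl_uminus: "f \<in> NF \<Longrightarrow> cl (- f) = \<ominus>\<^bsub>A\<^esub> cl f"
  using cl_add[of "- f" f] cl_0 minus_equality[of "cl (- f)" "cl f"] cl_closed by simp

lemma cl_cmul_nat: "f \<in> NF \<Longrightarrow> cl (frag_cmul (int k) f) = [k] \<cdot>\<^bsub>A\<^esub> cl f"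
proof (induction k)
  case (Suc k)
  have "frag_cmul (int (Suc k)) f = frag_cmul (int k) f + f" by (simp add: frag_cmul_distrib add.commute)
  moreover have "cl (frag_cmul (int k) f + f) = cl (frag_cmul (int k) f) \<oplus>\<^bsub>A\<^esub> cl f"
    using Suc keys_cmul[of "int k" f] by (intro cl_add) auto
  ultimately show ?case using Suc by simp
qed (simp add: cl_0)

lemma cl_cmul: "f \<in> NF \<Longrightarrow> cl (frag_cmul k f) = [k] \<cdot>\<^bsub>A\<^esub> cl f"
proof (cases "k \<ge> 0")
  case True
  then show "f \<in> NF \<Longrightarrow> ?thesis" using cl_cmul_nat[of f "nat k"] by (simp add: add_pow_int_ge)
next
  case False
  assume f: "f \<in> NF"
  have "frag_cmul k f = - frag_cmul (int (nat (- k))) f" using False by simp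
  moreover have "cl (- frag_cmul (int (nat (- k))) f) = \<ominus>\<^bsub>A\<^esub> cl (frag_cmul (int (nat (- k))) f)"
    using f keys_cmul[of "int (nat (- k))" f] by (intro cl_uminus) auto
  ultimately show ?thesis using False cl_cmul_nat[OF f, of "nat (- k)"] by (simp add: add_pow_int_lt)
qed

lemma cl_sum:
  assumes "finite S" "\<And>b. b \<in> S \<Longrightarrow> h b \<in> NF"
  shows "cl (sum h S) = (\<Oplus>\<^bsub>A\<^esub>b\<in>S. cl (h b)) \<and> sum h S \<in> NF"
  using assms
proof (induction S rule: finite_induct)
  case (insert x S)
  have "(\<Oplus>\<^bsub>A\<^esub>b\<in>insert x S. cl (h b)) = cl (h x) \<oplus>\<^bsub>A\<^esub> (\<Oplus>\<^bsub>A\<^esub>b\<in>S. cl (h b))"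
    by (rule finsum_insert) (use insert cl_closed in auto)
  moreover have "cl (h x + sum h S) = cl (h x) \<oplus>\<^bsub>A\<^esub> cl (sum h S)" using insert by (intro cl_add) auto
  moreover have "h x + sum h S \<in> NF" using insert by (intro NF_add) auto
  ultimately show ?case using insert by simp
qed (simp add: cl_0)

lemma combination_iff:
  assumes "a \<in> carrier A" "B \<subseteq> carrier A" "keys c \<subseteq> B"
  shows "a = comb c \<longleftrightarrow> co a = frag_extend co c"
proof -
  let ?h = "\<lambda>b. frag_cmul (lookup c b) (co b)"
  have h: "?h b \<in> NF" if "b \<in> keys c" for b
    using order_trans[OF keys_cmul co_NF[of b]] assms(2,3) that by auto
  have "cl (?h b) = [lookup c b] \<cdot>\<^bsub>A\<^esub> b" if "b \<in> keys c" for b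
  proof -
    have "b \<in> carrier A" using assms(2,3) that by auto
    then show ?thesis using cl_cmul[of "co b"] co_NF[of b] cl_co[of b] by simp
  qed
  then have "comb c = (\<Oplus>\<^bsub>A\<^esub>b\<in>keys c. cl (?h b))"
    by (intro finsum_cong' Pi_I cl_closed[OF h]) simp_all
  also have "\<dots> = cl (frag_extend co c)" using cl_sum[of "keys c" ?h] h by (simp add: frag_extend_def)
  finally have eq: "comb c = cl (frag_extend co c)" .
  have "frag_extend co c \<in> NF" using cl_sum[of "keys c" ?h] h by (simp add: frag_extend_def)
  from co_cl[OF this] cl_co[OF assms(1)] show ?thesis unfolding eq by auto
qed

lemma all_co_iff: "(\<forall>a\<in>carrier A. P (co a)) \<longleftrightarrow> (\<forall>v\<in>NF. P v)"
proof
  assume l: "\<forall>a\<in>carrier A. P (co a)"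
  show "\<forall>v\<in>NF. P v"
  proof
    fix v assume v: "v \<in> NF"
    from l cl_closed[OF v] have "P (co (cl v))" by blast
    then show "P v" unfolding co_cl[OF v] .
  qed
next
  assume r: "\<forall>v\<in>NF. P v"
  show "\<forall>a\<in>carrier A. P (co a)" using r co_NF by blast
qed

lemma int_basis_iff:
  "int_basis A B \<longleftrightarrow> B \<subseteq> carrier A \<and>
    (\<forall>v\<in>NF. \<exists>!c :: 'a \<Rightarrow>\<^sub>0 int. keys c \<subseteq> B \<and> v = frag_extend co c)"
proof (cases "B \<subseteq> carrier A")
  case True
  have "(\<forall>a\<in>carrier A. \<exists>!c :: 'a \<Rightarrow>\<^sub>0 int. keys c \<subseteq> B \<and>
      a = comb c) \<longleftrightarrow>
    (\<forall>a\<in>carrier A. \<exists>!c :: 'a \<Rightarrow>\<^sub>0 int. keys c \<subseteq> B \<and> co a = frag_extend co c)"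
  proof (rule ball_cong[OF refl])
    fix a assume a: "a \<in> carrier A"
    have eq: "(keys c \<subseteq> B \<and> a = comb c)
      = (keys c \<subseteq> B \<and> co a = frag_extend co c)" for c
      using combination_iff[OF a True, of c] by blast
    show "(\<exists>!c :: 'a \<Rightarrow>\<^sub>0 int. keys c \<subseteq> B \<and> a = comb c)
      = (\<exists>!c :: 'a \<Rightarrow>\<^sub>0 int. keys c \<subseteq> B \<and> co a = frag_extend co c)"
      by (simp only: eq)
  qed
  also have "\<dots> \<longleftrightarrow> (\<forall>v\<in>NF. \<exists>!c :: 'a \<Rightarrow>\<^sub>0 int. keys c \<subseteq> B \<and> v = frag_extend co c)"
    by (rule all_co_iff)
  finally show ?thesis unfolding int_basis_def using True by (simp only: simp_thms)
next
  case False
  then show ?thesis unfolding int_basis_def by (simp only: simp_thms)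
qed

definition std_basis :: "'a set" where "std_basis = (\<lambda>k. cl (frag_of k)) ` K"

lemma int_basis_std: "int_basis A std_basis"
  unfolding int_basis_iff
proof (intro conjI ballI)
  show "std_basis \<subseteq> carrier A" by (auto simp: std_basis_def intro: cl_closed)
  fix v assume v: "v \<in> NF"
  let ?\<psi> = "\<lambda>k. cl (frag_of k)"
  let ?\<Psi> = "frag_extend (\<lambda>k. frag_of (?\<psi> k))"
  have co\<psi>: "co (?\<psi> k) = frag_of k" if "k \<in> K" for k using that co_cl[of "frag_of k"] by simp
  show "\<exists>!c. keys c \<subseteq> std_basis \<and> v = frag_extend co c"
  proof (rule ex1I[of _ "?\<Psi> v"])
    have "keys v \<subseteq> K" using v by simp
    then have "frag_extend co (?\<Psi> v) = v"
      by (induction v rule: frag_induction) (simp_all add: co\<psi> frag_extend_diff)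
    moreover have "keys (?\<Psi> v) \<subseteq> std_basis"
      using keys_frag_extend[of "\<lambda>k. frag_of (?\<psi> k)" v] v by (auto simp: std_basis_def)
    ultimately show "keys (?\<Psi> v) \<subseteq> std_basis \<and> v = frag_extend co (?\<Psi> v)" by simp
  next
    fix c assume c: "keys c \<subseteq> std_basis \<and> v = frag_extend co c"
    then have "keys c \<subseteq> std_basis" by simp
    then have "?\<Psi> (frag_extend co c) = c"
      by (induction c rule: frag_induction) (auto simp: co\<psi> frag_extend_diff std_basis_def)
    then show "c = ?\<Psi> v" using c by simp
  qed
qed

text \<open>
  Let \<open>S\<close> be the part of a homogeneous basis in bidegree \<open>(d, p)\<close> and \<open>M\<close> the set of normal words there.
  Expanding \<open>S\<close> in \<open>M\<close> and \<open>M\<close> in \<open>S\<close> gives matrices whose products in both orders are identities.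
  Their traces agree, hence so do the cardinalities. Homogeneity is used to see that a normal word
  involves only basis elements of its own bidegree, and finiteness of \<open>S\<close> follows since each of the
  finitely many elements of \<open>M\<close> involves finitely many basis elements.
\<close>

theorem graded_rank:
  fixes dg :: "'i \<Rightarrow> int \<times> bit"
  assumes comp: "\<And>d p. C d p = cl ` {f. keys f \<subseteq> {k\<in>K. dg k = (d, p)}}"
    and fin: "\<And>e. finite {k\<in>K. dg k = e}"
    and F: "\<And>d p. lookup (fls_nth F d) p = int (card {k\<in>K. dg k = (d, p)})"
  shows "has_graded_rank A C F"
  unfolding has_graded_rank_def
proof (intro conjI allI impI)
  have "\<exists>d p. b \<in> C d p" if b: "b \<in> std_basis" for b
  proof -
    obtain k where "k \<in> K" "b = cl (frag_of k)" using b by (auto simp: std_basis_def)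
    then have "b \<in> C (fst (dg k)) (snd (dg k))" by (simp add: comp)
    then show ?thesis by blast
  qed
  then show "\<exists>B. homogeneous_basis A C B"
    unfolding homogeneous_basis_def using int_basis_std by blast
next
  fix B d p assume hb: "homogeneous_basis A C B"
  then have B: "B \<subseteq> carrier A" and ex1: "\<And>v. v \<in> NF \<Longrightarrow> \<exists>!c. keys c \<subseteq> B \<and> v = frag_extend co c"
    and hom: "\<And>b. b \<in> B \<Longrightarrow> \<exists>d p. b \<in> C d p"
    unfolding homogeneous_basis_def int_basis_iff by auto
  define KE where "KE = {k\<in>K. dg k = (d, p)}"
  define S where "S = B \<inter> C d p"
  have coC: "b \<in> C d' p' \<longleftrightarrow> b \<in> carrier A \<and> keys (co b) \<subseteq> {k\<in>K. dg k = (d', p')}" for b d' p'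
  proof
    assume "b \<in> C d' p'"
    then obtain f where "b = cl f" "keys f \<subseteq> {k\<in>K. dg k = (d', p')}" by (auto simp: comp)
    moreover from this have "f \<in> NF" by auto
    ultimately show "b \<in> carrier A \<and> keys (co b) \<subseteq> {k\<in>K. dg k = (d', p')}"
      by (simp add: co_cl cl_closed)
  next
    assume "b \<in> carrier A \<and> keys (co b) \<subseteq> {k\<in>K. dg k = (d', p')}"
    then have "b = cl (co b)" "co b \<in> {f. keys f \<subseteq> {k\<in>K. dg k = (d', p')}}"
      using cl_co[of b] by simp_all
    then show "b \<in> C d' p'" unfolding comp by (rule image_eqI)
  qed
  have uniq: "c = c'" if "keys c \<subseteq> B" "keys c' \<subseteq> B" "frag_extend co c = frag_extend co c'" "frag_extend co c \<in> NF" for c c'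
    using ex1[OF that(4)] that by auto
  define \<beta> where "\<beta> i = (THE c. keys c \<subseteq> B \<and> frag_of i = frag_extend co c)" for i
  have \<beta>: "keys (\<beta> i) \<subseteq> B" "frag_of i = frag_extend co (\<beta> i)" if "i \<in> K" for i
    using theI'[OF ex1[of "frag_of i"]] that by (auto simp: \<beta>_def)
  have lk: "lookup (frag_extend co c) k = (\<Sum>b\<in>T. lookup c b * lookup (co b) k)"
    if "finite T" "keys c \<subseteq> T" for c k T
    unfolding frag_extend_def using that
    by (auto simp: lookup_sum in_keys_iff intro!: sum.mono_neutral_left)
  \<comment> \<open>basis elements of other bidegrees have no coordinate in the bidegree considered\<close>
  have disj: "lookup (co b) k = 0" if "b \<in> B" "b \<notin> S" "k \<in> KE" for b k
  proof (rule ccontr)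
    assume "lookup (co b) k \<noteq> 0"
    then have "k \<in> keys (co b)" by (simp add: in_keys_iff)
    moreover obtain d' p' where "b \<in> C d' p'" using hom \<open>b \<in> B\<close> by blast
    ultimately show False using coC[of b d' p'] that by (auto simp: KE_def S_def)
  qed
  have \<beta>S: "keys (\<beta> i) \<subseteq> S" if i: "i \<in> KE" for i
  proof -
    have iK: "i \<in> K" using i by (simp add: KE_def)
    let ?T = "keys (\<beta> i)"
    \<comment> \<open>discarding the terms outside \<open>S\<close> does not change the combination, so there are none\<close>
    define c where "c = (\<Sum>b\<in>?T \<inter> S. frag_cmul (lookup (\<beta> i) b) (frag_of b))"
    have lc: "lookup c b = (if b \<in> ?T \<inter> S then lookup (\<beta> i) b else 0)" for b
      by (simp add: c_def lookup_sum if_distrib cong: if_cong)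
    then have kc: "keys c \<subseteq> ?T \<inter> S" by (auto simp: in_keys_iff split: if_splits)
    have ec: "frag_extend co c = frag_of i"
    proof (rule poly_mapping_eqI)
      fix k
      have e: "lookup (frag_extend co c) k = (\<Sum>b\<in>?T. lookup c b * lookup (co b) k)"
        by (rule lk) (use kc in auto)
      show "lookup (frag_extend co c) k = lookup (frag_of i) k"
      proof (cases "k \<in> KE")
        case True
        have "lookup (frag_of i) k = (\<Sum>b\<in>?T. lookup (\<beta> i) b * lookup (co b) k)"
          unfolding \<beta>(2)[OF iK] by (rule lk) auto
        also have "\<dots> = (\<Sum>b\<in>?T. lookup c b * lookup (co b) k)"
          using disj[OF _ _ True] \<beta>(1)[OF iK] by (intro sum.cong) (auto simp: lc)
        finally show ?thesis using e by simp
      next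
        case False
        have "lookup (co b) k = 0" if "b \<in> S" for b
          using that coC[of b d p] False by (auto simp: S_def KE_def in_keys_iff subset_iff)
        then have "lookup (frag_extend co c) k = 0"
          unfolding e by (intro sum.neutral) (auto simp: lc)
        moreover have "k \<noteq> i" using False i by auto
        ultimately show ?thesis by simp
      qed
    qed
    have "c = \<beta> i"
    proof (rule uniq)
      show "keys c \<subseteq> B" using kc \<beta>(1)[OF iK] by blast
      show "keys (\<beta> i) \<subseteq> B" by (rule \<beta>(1)[OF iK])
      show "frag_extend co c = frag_extend co (\<beta> i)" using ec \<beta>(2)[OF iK] by (rule trans)
      show "frag_extend co c \<in> NF" using ec iK by simp
    qed
    then show ?thesis using kc by blast
  qed
  have finKE: "finite KE" using fin by (simp add: KE_def)
  have expand: "lookup (frag_of b) b' = (\<Sum>i\<in>KE. lookup (co b) i * lookup (\<beta> i) b')"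
    if b: "b \<in> S" for b b'
  proof -
    define c where "c = (\<Sum>i\<in>KE. frag_cmul (lookup (co b) i) (\<beta> i))"
    have bc: "b \<in> carrier A" "keys (co b) \<subseteq> KE" using b coC[of b d p] by (auto simp: S_def KE_def)
    have "frag_extend co c = (\<Sum>i\<in>KE. frag_cmul (lookup (co b) i) (frag_of i))"
      unfolding c_def frag_extend_sum[OF finKE] by (intro sum.cong) (auto simp: frag_extend_cmul \<beta>(2)[symmetric] KE_def)
    also have "\<dots> = frag_extend frag_of (co b)"
      unfolding frag_extend_def by (rule sum.mono_neutral_right) (use finKE bc in \<open>auto simp: in_keys_iff\<close>)
    also have "\<dots> = co b" by (rule frag_expansion[symmetric])
    finally have ec: "frag_extend co c = co b" .
    have "keys c \<subseteq> (\<Union>i\<in>KE. keys (\<beta> i))"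
      unfolding c_def by (rule order_trans[OF keys_sum]) (rule UN_mono[OF order_refl keys_cmul])
    then have "keys c \<subseteq> B" using \<beta>(1) by (auto simp: KE_def)
    moreover have "keys (frag_of b) \<subseteq> B" using b by (simp add: S_def)
    moreover have "frag_extend co (frag_of b) = frag_extend co c" by (simp add: ec)
    moreover have "frag_extend co (frag_of b) \<in> NF" using co_NF[OF bc(1)] by simp
    ultimately have "frag_of b = c" using uniq by blast
    then show ?thesis by (simp add: c_def lookup_sum)
  qed
  have finS: "finite S"
  proof (rule finite_subset[of _ "\<Union>i\<in>KE. keys (\<beta> i)"])
    show "S \<subseteq> (\<Union>i\<in>KE. keys (\<beta> i))"
    proof
      fix b assume b: "b \<in> S"
      have "(\<Sum>i\<in>KE. lookup (co b) i * lookup (\<beta> i) b) \<noteq> 0"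
        using expand[OF b, of b] by simp
      then obtain i where "i \<in> KE" "lookup (co b) i * lookup (\<beta> i) b \<noteq> 0"
        by (rule sum.not_neutral_contains_not_neutral)
      then show "b \<in> (\<Union>i\<in>KE. keys (\<beta> i))" by (auto simp: in_keys_iff)
    qed
  qed (use finKE in auto)
  have one: "(\<Sum>b\<in>S. lookup (\<beta> i) b * lookup (co b) i) = 1" if i: "i \<in> KE" for i
  proof -
    have "lookup (frag_extend co (\<beta> i)) i = 1" using arg_cong[OF \<beta>(2)[of i], of "\<lambda>f. lookup f i"] i by (simp add: KE_def)
    then show ?thesis using lk[OF finS \<beta>S[OF i], of i] by simp
  qed
  \<comment> \<open>the two traces\<close>
  have "int (card S) = (\<Sum>b\<in>S. \<Sum>i\<in>KE. lookup (co b) i * lookup (\<beta> i) b)"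
  proof -
    have "(\<Sum>i\<in>KE. lookup (co b) i * lookup (\<beta> i) b) = 1" if "b \<in> S" for b
      using expand[OF that, of b] by simp
    then show ?thesis by simp
  qed
  also have "\<dots> = (\<Sum>i\<in>KE. \<Sum>b\<in>S. lookup (\<beta> i) b * lookup (co b) i)"
    by (subst sum.swap) (simp add: mult.commute)
  also have "\<dots> = int (card KE)" using one by simp
  finally have "card S = card KE" by simp
  then show "finite (B \<inter> C d p)" "lookup (fls_nth F d) p = int (card (B \<inter> C d p))"
    using finS F[of d p] by (simp_all add: S_def KE_def)
qed

end

section \<open>Generating functions\<close>

text \<open>
  \<open>tq\<close> is \<open>\<pi>q\<^sup>-\<^sup>2\<close>, the bidegree of a single \<open>\<partial>\<close>.
\<close>

definition tq :: qpi where "tq = \<pi> * unit_inv qv ^ 2"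

abbreviation geom :: "nat \<Rightarrow> qpi" where "geom m \<equiv> (\<Sum>i<m. tq ^ i)"

lemma power_diff_geom:
  fixes a b t :: "'a::comm_ring_1"
  assumes "b = a * t"
  shows "a ^ Suc m - b ^ Suc m = (a - b) * (a ^ m * (\<Sum>i<Suc m. t ^ i))"
proof -
  define S where "S = (\<Sum>i<Suc m. t ^ i)"
  have S: "1 - t ^ Suc m = (1 - t) * S" unfolding S_def by (rule one_diff_power_eq)
  have "a ^ Suc m - b ^ Suc m = a ^ Suc m * (1 - t ^ Suc m)"
    by (simp add: assms power_mult_distrib algebra_simps)
  also have "\<dots> = (a - b) * (a ^ m * S)"
    unfolding S by (simp add: assms algebra_simps)
  finally show ?thesis unfolding S_def .
qed

lemma power_inverse_cancel:
  fixes a u :: "'a::comm_ring_1"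
  assumes "a * u = 1" shows "u ^ k * a ^ k = 1"
  using assms by (simp add: mult.commute flip: power_mult_distrib)

lemma inv_qv_eq: "unit_inv qv = \<pi> * qv * tq"
proof -
  have qb: "qv * unit_inv qv = 1" by (rule unit_inv_right[OF unit_qv])
  have "\<pi> * qv * tq = (\<pi> * \<pi>) * (qv * unit_inv qv) * unit_inv qv"
    unfolding tq_def power2_eq_square by (simp only: ac_simps)
  also have "\<dots> = unit_inv qv" unfolding \<pi>_square qb by (simp only: mult_1_left)
  finally show ?thesis by (rule sym)
qed

lemma qint_eq: "qint (Suc m) = (\<pi> * qv) ^ m * geom (Suc m)"
proof -
  let ?a = "\<pi> * qv" and ?b = "unit_inv qv"
  have "qint (Suc m) = ((?a - ?b) * (?a ^ m * geom (Suc m))) * unit_inv (?a - ?b)"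
    unfolding qint_def power_diff_geom[OF inv_qv_eq] ..
  also have "\<dots> = ((?a - ?b) * unit_inv (?a - ?b)) * (?a ^ m * geom (Suc m))"
    by (simp only: mult.assoc mult.commute mult.left_commute)
  finally show ?thesis unfolding unit_inv_right[OF unit_\<pi>_qv_minus_qv_inv] mult_1_left .
qed

lemma geom_add: "geom (m + l) = geom m + tq ^ m * geom l"
  by (induction l) (simp_all add: power_add distrib_left add.assoc)

lemma geom_double: "geom (2 * k) = (1 + tq ^ k) * geom k"
  using geom_add[of k k] by (simp add: mult_2 distrib_right)

lemma prod_1_Suc:
  fixes f :: "nat \<Rightarrow> 'a::comm_monoid_mult"
  shows "(\<Prod>k=1..Suc m. f k) = (\<Prod>k=1..m. f k) * f (Suc m)"
  by (simp add: mult.commute)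

lemma qdfact_eq: "qdfact m = (\<pi> * qv) ^ (m * m) * (\<Prod>k=1..m. (1 + tq ^ k) * geom k)"
proof (induction m)
  case 0
  show ?case by (simp add: qdfact_def)
next
  case (Suc m)
  have e: "(\<pi> * qv) ^ (Suc m * Suc m) = (\<pi> * qv) ^ (m * m) * (\<pi> * qv) ^ Suc (2 * m)"
  proof -
    have "Suc m * Suc m = m * m + Suc (2 * m)" by simp
    then show ?thesis by (simp only: power_add)
  qed
  have d: "2 * Suc m = Suc (Suc (2 * m))" by simp
  have q: "qint (2 * Suc m) = (\<pi> * qv) ^ Suc (2 * m) * ((1 + tq ^ Suc m) * geom (Suc m))"
    unfolding geom_double[symmetric] d by (rule qint_eq)
  have "qdfact (Suc m) = qdfact m * qint (2 * Suc m)"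
    unfolding qdfact_def by (rule prod_1_Suc)
  also have "\<dots> = (\<pi> * qv) ^ (Suc m * Suc m) *
      ((\<Prod>k=1..m. (1 + tq ^ k) * geom k) * ((1 + tq ^ Suc m) * geom (Suc m)))"
    unfolding Suc.IH q e by (simp only: mult.assoc mult.commute mult.left_commute)
  also have "(\<Prod>k=1..m. (1 + tq ^ k) * geom k) * ((1 + tq ^ Suc m) * geom (Suc m)) =
      (\<Prod>k=1..Suc m. (1 + tq ^ k) * geom k)"
    by (rule prod_1_Suc[symmetric])
  finally show ?case .
qed

text \<open>
  With \<open>a = \<pi>q\<close> one has \<open>[m] = a\<^sup>m\<^sup>-\<^sup>1(1 + t + \<cdots> + t\<^sup>m\<^sup>-\<^sup>1)\<close>, and the exponents
  \<open>m + (1 + 3 + \<cdots> + (2m-1)) = m(m+1)\<close> of \<open>a\<close> cancel against the prefactor for \<open>n = m+1\<close>.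
\<close>

lemma rank_formula_eq:
  "unit_inv (\<pi> * qv) ^ (Suc m * m) * qint (Suc m) * qdfact m = geom (Suc m) * (\<Prod>k=1..m. (1 + tq ^ k) * geom k)"
proof -
  let ?a = "\<pi> * qv"
  have "?a * unit_inv ?a = 1" by (rule unit_inv_right[OF unit_\<pi>_qv])
  then have "unit_inv ?a ^ (Suc m * m) * ?a ^ (Suc m * m) = 1"
    by (rule power_inverse_cancel)
  moreover have "?a ^ (Suc m * m) = ?a ^ m * ?a ^ (m * m)" by (simp only: mult_Suc power_add)
  ultimately have c: "unit_inv ?a ^ (Suc m * m) * (?a ^ m * ?a ^ (m * m)) = 1" by (simp only:)
  have "unit_inv ?a ^ (Suc m * m) * qint (Suc m) * qdfact m =
    (unit_inv ?a ^ (Suc m * m) * (?a ^ m * ?a ^ (m * m))) * (geom (Suc m) * (\<Prod>k=1..m. (1 + tq ^ k) * geom k))"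
    unfolding qint_eq qdfact_eq by (simp only: ac_simps)
  then show ?thesis unfolding c mult_1_left .
qed

text \<open>
  The lengths of the chains are \<open>0, \<dots>, n-k\<close> for the descending words, \<open>n-k\<close> for the side chain, and
  \<open>n-k+1, \<dots>, 2(n-k)\<close> for the long chains.
\<close>

lemma sum_chains:
  assumes "1 \<le> k" "k < n"
  shows "(\<Sum>c\<in>chains n k. tq ^ length c) = (1 + tq ^ (n - k)) * geom (Suc (n - k))"
proof -
  let ?m = "n - k"
  have i1: "inj_on (desc k) {k..n}"
  proof (rule inj_onI)
    fix i j assume "i \<in> {k..n}" "j \<in> {k..n}" "desc k i = desc k j"
    then show "i = j" using length_desc[of k i] length_desc[of k j] by auto
  qed
  have i2: "inj_on (long_chain n k) {k..n-1}"
  proof (rule inj_onI)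
    fix i j assume a: "i \<in> {k..n-1}" "j \<in> {k..n-1}" "long_chain n k i = long_chain n k j"
    then have ij: "k \<le> i" "i < n" "k \<le> j" "j < n" using assms by auto
    then have "2 * n - i - k = 2 * n - j - k" using length_long_chain[OF ij(1,2)] length_long_chain[OF ij(3,4)] a(3) by simp
    then show "i = j" using ij by linarith
  qed
  have D: "DelD \<notin> set (desc k j)" "DelD \<in> set (side_chain n k)" "DelD \<in> set (long_chain n k j)" for j
    by (auto simp: set_desc side_chain_def long_chain_def)
  have lU: "length (long_chain n k j) \<noteq> length (side_chain n k)" if "j \<in> {k..n-1}" for j
    using that assms by (auto simp: length_long_chain side_chain_def)
  have "(\<Sum>c\<in>chains n k. tq ^ length c) = (\<Sum>c\<in>desc k ` {k..n} \<union> {side_chain n k}. tq ^ length c) + (\<Sum>c\<in>long_chain n k ` {k..n-1}. tq ^ length c)"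
    unfolding chains_def
  proof (rule sum.union_disjoint)
    show "(desc k ` {k..n} \<union> {side_chain n k}) \<inter> long_chain n k ` {k..n - 1} = {}"
    proof (rule equals0I)
      fix c assume "c \<in> (desc k ` {k..n} \<union> {side_chain n k}) \<inter> long_chain n k ` {k..n - 1}"
      then obtain j where j: "c = long_chain n k j" "j \<in> {k..n-1}" "c \<in> desc k ` {k..n} \<or> c = side_chain n k" by blast
      have "DelD \<in> set c" "length c \<noteq> length (side_chain n k)" using D(3) lU[OF j(2)] j(1) by simp_all
      then show False using D(1) j(3) by (elim disjE imageE) simp_all
    qed
  qed auto
  also have "(\<Sum>c\<in>desc k ` {k..n} \<union> {side_chain n k}. tq ^ length c) = (\<Sum>c\<in>desc k ` {k..n}. tq ^ length c) + (\<Sum>c\<in>{side_chain n k}. tq ^ length c)"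
  proof (rule sum.union_disjoint)
    show "desc k ` {k..n} \<inter> {side_chain n k} = {}" using D by (metis disjoint_insert(2) image_iff inf_bot_right)
  qed auto
  also have "(\<Sum>c\<in>{side_chain n k}. tq ^ length c) = tq ^ ?m"
  proof -
    have "length (side_chain n k) = ?m" using assms by (simp add: side_chain_def)
    then show ?thesis by simp
  qed
  also have "(\<Sum>c\<in>desc k ` {k..n}. tq ^ length c) = (\<Sum>j\<in>{k..n}. tq ^ (j - k))"
    by (simp add: sum.reindex[OF i1])
  also have "\<dots> = geom (Suc ?m)"
    by (rule sum.reindex_bij_witness[of _ "\<lambda>i. i + k" "\<lambda>j. j - k"])
      (use assms in \<open>auto simp del: sum.lessThan_Suc\<close>)
  also have "(\<Sum>c\<in>long_chain n k ` {k..n-1}. tq ^ length c) = (\<Sum>j\<in>{k..n-1}. tq ^ (2 * n - j - k))"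
    unfolding sum.reindex[OF i2] by (rule sum.cong) (use assms in \<open>auto simp: length_long_chain\<close>)
  also have "\<dots> = (\<Sum>i<?m. tq ^ (?m + Suc i))"
  proof (rule sum.reindex_bij_witness[of _ "\<lambda>i. n - Suc i" "\<lambda>j. n - Suc j"])
    fix j assume "j \<in> {k..n-1}"
    then have "n - k + Suc (n - Suc j) = 2 * n - j - k" using assms by auto
    then show "tq ^ (n - k + Suc (n - Suc j)) = tq ^ (2 * n - j - k)" by (simp only:)
  qed (use assms in auto)
  also have "\<dots> = tq ^ ?m * (\<Sum>i<?m. tq ^ Suc i)"
    by (simp only: power_add sum_distrib_left)
  also have "geom (Suc ?m) + tq ^ ?m + tq ^ ?m * (\<Sum>i<?m. tq ^ Suc i) = (1 + tq ^ ?m) * geom (Suc ?m)"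
  proof -
    have "geom (Suc ?m) = 1 + (\<Sum>i<?m. tq ^ Suc i)"
      using sum.lessThan_Suc_shift[of "\<lambda>i. tq ^ i" ?m] by (simp only: power_0)
    then have "tq ^ ?m * geom (Suc ?m) = tq ^ ?m + tq ^ ?m * (\<Sum>i<?m. tq ^ Suc i)"
      by (simp only: distrib_left mult_1_right)
    then show ?thesis by (simp only: distrib_right mult_1_left add.assoc)
  qed
  finally show ?thesis .
qed

lemma sum_nc_words:
  assumes "d < n"
  shows "(\<Sum>u\<in>nc_words n d. tq ^ length u) = geom (Suc d) * (\<Prod>k=1..d. (1 + tq ^ k) * geom k)"
  using assms
proof (induction d)
  case 0
  show ?case by simp
next
  case (Suc d)
  define k where "k = n - Suc d"
  have k: "1 \<le> k" "k < n" "n - Suc k = d" "n - k = Suc d" using Suc.prems by (auto simp: k_def)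
  have inj: "inj_on (\<lambda>(c, u). c @ u) (chains n k \<times> nc_words n d)"
    using chain_factorization_inj[OF k(1,2)] unfolding k(3) .
  have "nc_words n (Suc d) = (\<lambda>(c, u). c @ u) ` (chains n k \<times> nc_words n d)" by (auto simp: k_def)
  then have "(\<Sum>u\<in>nc_words n (Suc d). tq ^ length u) = (\<Sum>(c, u)\<in>chains n k \<times> nc_words n d. tq ^ length c * tq ^ length u)"
    using sum.reindex[OF inj, of "\<lambda>w. tq ^ length w"] by (simp add: case_prod_unfold o_def power_add)
  also have "\<dots> = (\<Sum>c\<in>chains n k. tq ^ length c) * (\<Sum>u\<in>nc_words n d. tq ^ length u)"
    by (simp only: sum_product sum.cartesian_product)
  also have "\<dots> = ((1 + tq ^ Suc d) * geom (Suc (Suc d))) * (geom (Suc d) * (\<Prod>k=1..d. (1 + tq ^ k) * geom k))"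
    using Suc sum_chains[OF k(1,2)] unfolding k(4) by simp
  also have "\<dots> = geom (Suc (Suc d)) * ((1 + tq ^ Suc d) * geom (Suc d) * (\<Prod>k=1..d. (1 + tq ^ k) * geom k))"
    by (simp only: ac_simps)
  also have "(1 + tq ^ Suc d) * geom (Suc d) * (\<Prod>k=1..d. (1 + tq ^ k) * geom k) = (\<Prod>k=1..Suc d. (1 + tq ^ k) * geom k)"
    unfolding prod_1_Suc by (rule mult.commute)
  finally show ?case .
qed

subsection \<open>Coefficients\<close>

abbreviation gb :: "bit \<Rightarrow> int \<Rightarrow> bit \<Rightarrow>\<^sub>0 int" where "gb \<equiv> single"

lemma \<pi>_power: "\<pi> ^ l = fls_const (gb (of_nat l) 1)"
proof (induction l)
  case (Suc l)
  then show ?case by (simp add: \<pi>_def mult_single)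
qed simp

lemma nth_tq_mult: "fls_nth (tq ^ l * f) d = gb (of_nat l) 1 * fls_nth f (d + 2 * int l)"
proof -
  have "tq ^ l * f = fls_const (gb (of_nat l) 1) * (fls_X_inv ^ (2 * l) * f)"
    by (simp only: tq_def power_mult_distrib \<pi>_power unit_inv_qv power_mult mult.assoc)
  then show ?thesis by (simp add: fls_X_inv_power_times_conv_shift(1))
qed

text \<open>
  The Hilbert series of the ordered monomials in \<open>m\<close> variables.
\<close>

definition xser :: "nat \<Rightarrow> (bit \<Rightarrow>\<^sub>0 int) fps"
  where "xser m = Abs_fps (\<lambda>e. if even e then gb (of_nat (e div 2)) (int (card {w \<in> x_words m. length w = e div 2})) else 0)"

lemma finite_x_words_length: "finite {w \<in> x_words m. length w = l}"
proof (rule finite_subset)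
  show "{w \<in> x_words m. length w = l} \<subseteq> {w. set w \<subseteq> X ` {1..m} \<and> length w = l}" using set_x_words by blast
  show "finite {w. set w \<subseteq> X ` {1..m} \<and> length w = l}" by (rule finite_lists_length_eq) simp
qed

lemma x_words_SucI: "v \<in> x_words m \<Longrightarrow> v @ replicate k (X (Suc m)) \<in> x_words (Suc m)"
  by auto

lemma X_notin_x_words: "w \<in> x_words m \<Longrightarrow> X (Suc m) \<notin> set w"
  using set_x_words[of w m] by auto

text \<open>
  An ordered monomial in \<open>x\<^sub>1, \<dots>, x\<^sub>m\<^sub>+\<^sub>1\<close> either avoids the last variable or is obtained from a shorter
  one by appending it.
\<close>

lemma card_x_words_Suc:
  "card {w \<in> x_words (Suc m). length w = Suc l} = card {w \<in> x_words m. length w = Suc l} + card {w \<in> x_words (Suc m). length w = l}"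
proof -
  let ?x = "X (Suc m)"
  have split: "{w \<in> x_words (Suc m). length w = Suc l} =
    {w \<in> x_words m. length w = Suc l} \<union> (\<lambda>w. w @ [?x]) ` {w \<in> x_words (Suc m). length w = l}" (is "?A = ?B \<union> ?C")
  proof
    show "?A \<subseteq> ?B \<union> ?C"
    proof
      fix w assume w: "w \<in> ?A"
      then obtain v k where v: "w = v @ replicate k ?x" "v \<in> x_words m" by auto
      show "w \<in> ?B \<union> ?C"
      proof (cases k)
        case 0
        then show ?thesis using w v by simp
      next
        case (Suc k')
        then have "w = (v @ replicate k' ?x) @ [?x]" using v by (simp add: replicate_append_same)
        moreover have "v @ replicate k' ?x \<in> x_words (Suc m)" by (rule x_words_SucI[OF v(2)])
        ultimately show ?thesis using w by auto
      qed
    qed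
    have "w \<in> x_words (Suc m)" if "w \<in> x_words m" for w
      using x_words_SucI[OF that, of 0] by simp
    moreover have "w @ [?x] \<in> x_words (Suc m)" if "w \<in> x_words (Suc m)" for w
    proof -
      obtain v k where v: "w = v @ replicate k ?x" "v \<in> x_words m" using \<open>w \<in> x_words (Suc m)\<close> by auto
      then have "w @ [?x] = v @ replicate (Suc k) ?x" by (simp add: replicate_append_same)
      then show ?thesis using x_words_SucI[OF v(2), of "Suc k"] by simp
    qed
    ultimately show "?B \<union> ?C \<subseteq> ?A" by (auto simp del: x_words.simps)
  qed
  have "?B \<inter> ?C = {}" using X_notin_x_words by fastforce
  moreover have "card ?C = card {w \<in> x_words (Suc m). length w = l}"
    by (rule card_image) (auto simp: inj_on_def)
  ultimately show ?thesis unfolding split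
    by (subst card_Un_disjoint) (auto intro: finite_x_words_length simp del: x_words.simps)
qed

lemma card_x_words_0: "card {w \<in> x_words m. length w = 0} = 1"
proof -
  have "{w \<in> x_words m. length w = 0} = {[]}" using Nil_in_x_words[of m] by auto
  then show ?thesis by simp
qed

lemma xser_0: "xser 0 = 1"
proof (rule fps_ext)
  fix e
  have "{w \<in> x_words 0. length w = l} = (if l = 0 then {[]} else {})" for l by auto
  then show "fps_nth (xser 0) e = fps_nth 1 e" by (auto simp: xser_def elim!: evenE)
qed

lemma xser_Suc: "xser (Suc m) * (1 - fps_const (gb 1 1) * fps_X\<^sup>2) = xser m"
proof (rule fps_ext)
  fix e
  let ?N = "\<lambda>m l. card {w \<in> x_words m. length w = l}"
  have "fps_nth (xser (Suc m) * (1 - fps_const (gb 1 1) * fps_X\<^sup>2)) e =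
    fps_nth (xser (Suc m)) e - gb 1 1 * fps_nth (fps_X\<^sup>2 * xser (Suc m)) e"
  proof -
    have "xser (Suc m) * (1 - fps_const (gb 1 1) * fps_X\<^sup>2) = xser (Suc m) - fps_const (gb 1 1) * (fps_X\<^sup>2 * xser (Suc m))"
      unfolding right_diff_distrib mult_1_right by (simp only: mult.assoc mult.commute mult.left_commute)
    then show ?thesis by (simp only: fps_sub_nth fps_mult_left_const_nth)
  qed
  also have "\<dots> = fps_nth (xser m) e"
  proof (cases "even e \<and> e \<ge> 2")
    case True
    define l where "l = e div 2 - 1"
    have e: "e = 2 * Suc l" using True unfolding l_def by presburger
    have even: "fps_nth (xser m') (2 * j) = gb (of_nat j) (int (?N m' j))" for m' j
      by (simp add: xser_def)
    have shift: "fps_nth (fps_X\<^sup>2 * xser (Suc m)) (2 * Suc l) = fps_nth (xser (Suc m)) (2 * l)"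
      by (simp add: fps_X_power_mult_nth)
    have "gb 1 1 * gb (of_nat l) (int (?N (Suc m) l)) = gb (of_nat (Suc l)) (int (?N (Suc m) l))"
      by (simp add: mult_single)
    then show ?thesis
      unfolding e shift even card_x_words_Suc[of m l] of_nat_add single_add by (simp only: add_diff_cancel_right')
  next
    case False
    have odd: "fps_nth (xser m') j = 0" if "odd j" for m' j using that by (simp add: xser_def)
    consider "odd e" | "e = 0" using False by (cases "e = 0"; cases "e = 1") auto
    then show ?thesis
    proof cases
      case 1
      then have "fps_nth (fps_X\<^sup>2 * xser (Suc m)) e = 0" by (auto simp: fps_X_power_mult_nth odd)
      then show ?thesis using 1 by (simp add: odd)
    next
      case 2
      then show ?thesis
        using card_x_words_0[of m] card_x_words_0[of "Suc m"] by (simp add: xser_def fps_X_power_mult_nth del: x_words.simps)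
    qed
  qed
  finally show "fps_nth (xser (Suc m) * (1 - fps_const (gb 1 1) * fps_X\<^sup>2)) e = fps_nth (xser m) e" .
qed

lemma unit_inv_xser: "unit_inv ((1 - \<pi> * qv\<^sup>2) ^ m) = fps_to_fls (xser m)"
proof -
  let ?u = "1 - \<pi> * qv\<^sup>2"
  have u: "?u = fps_to_fls (1 - fps_const (gb 1 1) * fps_X\<^sup>2)"
    by (simp add: \<pi>_def fls_times_fps_to_fls fps_to_fls_power)
  have inv: "?u ^ m * fps_to_fls (xser m) = 1"
  proof (induction m)
    case 0
    show ?case by (simp add: xser_0)
  next
    case (Suc m)
    have "?u ^ Suc m * fps_to_fls (xser (Suc m)) = ?u ^ m * (fps_to_fls (xser (Suc m)) * ?u)"
      by (simp only: power_Suc ac_simps)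
    also have "fps_to_fls (xser (Suc m)) * ?u = fps_to_fls (xser m)"
      unfolding u fls_times_fps_to_fls[symmetric] xser_Suc ..
    finally show ?case using Suc by simp
  qed
  have "?u ^ m dvd 1" using inv by (metis dvdI)
  from unit_inv_right[OF this] have r: "?u ^ m * unit_inv (?u ^ m) = 1" .
  have "unit_inv (?u ^ m) = (?u ^ m * fps_to_fls (xser m)) * unit_inv (?u ^ m)" by (simp add: inv)
  also have "\<dots> = (?u ^ m * unit_inv (?u ^ m)) * fps_to_fls (xser m)" by (simp only: ac_simps)
  finally show ?thesis by (simp add: r)
qed

section \<open>The graded ranks\<close>

lemma bideg_NC_words: "n \<ge> 2 \<Longrightarrow> u \<in> NC_words n \<Longrightarrow> bideg u = (- 2 * int (length u), of_nat (length u))"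
proof -
  assume n: "n \<ge> 2" and u: "u \<in> NC_words n"
  have "set u \<subseteq> gens n 1" using set_nc_words[of "n-1" n u] n u by (auto simp: NC_words_def)
  then have "sum_list (map gen_deg u) = - 2 * int (length u)"
  proof (induction u)
    case (Cons g u)
    then show ?case by (auto simp: gens_def split: if_splits)
  qed simp
  then show ?thesis by (simp add: bideg_def)
qed

lemma bideg_x_words: "v \<in> x_words m \<Longrightarrow> bideg v = (2 * int (length v), of_nat (length v))"
proof -
  assume "v \<in> x_words m"
  then have "set v \<subseteq> range X" by (rule set_x_words_range)
  then have "sum_list (map gen_deg v) = 2 * int (length v)"
    by (induction v) auto
  then show ?thesis by (simp add: bideg_def)
qed

lemma finite_NC_words: "finite (NC_words n)" by (simp add: NC_words_def finite_nc_words)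

lemma card_words: "card {k \<in> Word ` W. Q (letters k)} = card {w \<in> W. Q w}"
proof -
  have "{k \<in> Word ` W. Q (letters k)} = Word ` {w \<in> W. Q w}" by auto
  then show ?thesis by (simp add: card_image inj_on_def)
qed

lemma lookup_sum_tq:
  assumes "n \<ge> 2"
  shows "lookup (fls_nth (\<Sum>u\<in>NC_words n. tq ^ length u) d) p = int (card {u \<in> NC_words n. bideg u = (d, p)})"
proof -
  have nth_sum: "fls_nth (sum f S) d = (\<Sum>i\<in>S. fls_nth (f i) d)" for f :: "nh_gen list \<Rightarrow> qpi" and S
    by (induction S rule: infinite_finite_induct) simp_all
  have "lookup (fls_nth (tq ^ length u) d) p = (if bideg u = (d, p) then 1 else 0)" if "u \<in> NC_words n" for u
    using nth_tq_mult[of "length u" 1 d] bideg_NC_words[OF assms that] by (auto simp: lookup_single)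
  then have "lookup (fls_nth (\<Sum>u\<in>NC_words n. tq ^ length u) d) p = (\<Sum>u\<in>NC_words n. if bideg u = (d, p) then 1 else 0)"
    unfolding nth_sum lookup_sum by (rule sum.cong[OF refl])
  also have "\<dots> = int (card {u \<in> NC_words n. bideg u = (d, p)})"
    using finite_NC_words by (simp add: sum.If_cases Int_def)
  finally show ?thesis .
qed

lemma normal_words_of_eq:
  assumes "n \<ge> 2"
  shows "{w \<in> normal_words n. bideg w = (d, p)} =
    (\<Union>u\<in>NC_words n. (\<lambda>v. v @ u) ` {v \<in> x_words n. 2 * int (length v) = d + 2 * int (length u) \<and> of_nat (length v + length u) = p})"
proof -
  have *: "bideg (v @ u) = (d, p) \<longleftrightarrow> 2 * int (length v) = d + 2 * int (length u) \<and> of_nat (length v + length u) = p"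
    if "v \<in> x_words n" "u \<in> NC_words n" for v u
    unfolding bideg_append bideg_x_words[OF that(1)] bideg_NC_words[OF assms that(2)] of_nat_add add_Pair prod.inject
    by (intro conj_cong refl) linarith
  show ?thesis (is "?A = ?B")
  proof
    show "?A \<subseteq> ?B" using * unfolding normal_words_def by fast
    show "?B \<subseteq> ?A" using * unfolding normal_words_def by fast
  qed
qed

lemma finite_x_words_deg: "finite {v \<in> x_words n. 2 * int (length v) = e \<and> Q v}"
  by (rule finite_subset[OF _ finite_x_words_length[of n "nat (e div 2)"]]) auto

lemma lookup_sum_tq_xser:
  assumes "n \<ge> 2"
  shows "lookup (fls_nth ((\<Sum>u\<in>NC_words n. tq ^ length u) * fps_to_fls (xser n)) d) p = int (card {w \<in> normal_words n. bideg w = (d, p)})"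
proof -
  have nth_sum: "fls_nth (sum f S) d = (\<Sum>i\<in>S. fls_nth (f i) d)" for f :: "nh_gen list \<Rightarrow> qpi" and S
    by (induction S rule: infinite_finite_induct) simp_all
  let ?V = "\<lambda>u. {v \<in> x_words n. 2 * int (length v) = d + 2 * int (length u) \<and> of_nat (length v + length u) = p}"
  have "lookup (fls_nth (tq ^ length u * fps_to_fls (xser n)) d) p = int (card (?V u))" for u :: "nh_gen list"
  proof -
    let ?l = "length u" and ?e = "d + 2 * int (length u)"
    show ?thesis
    proof (cases "?e \<ge> 0 \<and> even ?e")
      case True
      then obtain j where j: "?e = 2 * int j" by (metis evenE nonneg_int_cases zero_le_mult_iff zero_less_numeral not_less)
      then have "fls_nth (fps_to_fls (xser n)) ?e = gb (of_nat j) (int (card {w \<in> x_words n. length w = j}))"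
        by (simp add: xser_def nat_mult_distrib)
      then have "fls_nth (tq ^ ?l * fps_to_fls (xser n)) d = gb (of_nat (?l + j)) (int (card {w \<in> x_words n. length w = j}))"
        unfolding nth_tq_mult by (simp add: mult_single)
      moreover have "?V u = (if of_nat (?l + j) = p then {w \<in> x_words n. length w = j} else {})"
        unfolding j by (auto simp: add.commute)
      ultimately show ?thesis by (simp add: lookup_single when_def)
    next
      case False
      then have z: "fls_nth (fps_to_fls (xser n)) ?e = 0"
        by (auto simp: xser_def even_nat_iff)
      have V: "?V u = {}"
      proof (rule equals0I)
        fix v assume "v \<in> ?V u"
        then have "?e = 2 * int (length v)" by simp
        then show False using False by simp
      qed
      show ?thesis unfolding nth_tq_mult z V by simp
    qed
  qed
  then have "lookup (fls_nth ((\<Sum>u\<in>NC_words n. tq ^ length u) * fps_to_fls (xser n)) d) p = (\<Sum>u\<in>NC_words n. int (card (?V u)))"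
    unfolding sum_distrib_right nth_sum lookup_sum by (rule sum.cong[OF refl])
  also have "\<dots> = (\<Sum>u\<in>NC_words n. int (card ((\<lambda>v. v @ u) ` ?V u)))"
    by (intro sum.cong refl arg_cong[of _ _ int] card_image[symmetric]) (auto simp: inj_on_def)
  also have "\<dots> = int (card (\<Union>u\<in>NC_words n. (\<lambda>v. v @ u) ` ?V u))"
  proof -
    have "card (\<Union>u\<in>NC_words n. (\<lambda>v. v @ u) ` ?V u) = (\<Sum>u\<in>NC_words n. card ((\<lambda>v. v @ u) ` ?V u))"
    proof (rule card_UN_disjoint)
      show "finite (NC_words n)" by (rule finite_NC_words)
      show "\<forall>u\<in>NC_words n. finite ((\<lambda>v. v @ u) ` ?V u)"
        by (intro ballI finite_imageI finite_x_words_deg)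
      show "\<forall>u\<in>NC_words n. \<forall>u'\<in>NC_words n. u \<noteq> u' \<longrightarrow> (\<lambda>v. v @ u) ` ?V u \<inter> (\<lambda>v. v @ u') ` ?V u' = {}"
        using normal_words_factorization_inj[OF assms] by blast
    qed
    then show ?thesis by simp
  qed
  finally show ?thesis unfolding normal_words_of_eq[OF assms] .
qed

context
  fixes n :: nat
  assumes n: "n \<ge> 2"
begin

interpretation H: presentation "nh_gens n" "nh_relators n"
  by unfold_locales (rule nh_relators_subset[OF n])

lemma normal_words_letters: "w \<in> normal_words n \<Longrightarrow> set w \<subseteq> nh_gens n"
proof -
  assume "w \<in> normal_words n"
  then obtain v u where w: "w = v @ u" "v \<in> x_words n" "u \<in> NC_words n" by (auto simp: normal_words_def)
  have "set u \<subseteq> gens n 1" using set_nc_words[of "n-1" n u] w n by (auto simp: NC_words_def)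
  then show ?thesis using set_x_words[OF w(2)] nh_gens_cases[OF n] w by auto
qed

lemma NF_closed: "keys f \<subseteq> Word ` normal_words n \<Longrightarrow> f \<in> H.F"
  unfolding free_ring_def using normal_words_letters by fastforce

lemma cls_inj_NF: "inj_on H.cls {f. keys f \<subseteq> Word ` normal_words n}"
proof (rule inj_onI)
  fix f g assume "f \<in> {f. keys f \<subseteq> Word ` normal_words n}" "g \<in> {f. keys f \<subseteq> Word ` normal_words n}"
    and eq: "H.cls f = H.cls g"
  then have fg: "keys f \<subseteq> Word ` normal_words n" "keys g \<subseteq> Word ` normal_words n" by auto
  have "f - g \<in> idl (nh_relators n)" using eq H.cls_eq_iff[OF NF_closed NF_closed, OF fg] by simp
  then have r: "rep n (f - g) = 0" by (rule rep_idl[OF n])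
  have "f - g = 0"
    by (rule normal_form_faithful[OF n]) (use keys_diff[of f g] fg r in auto)
  then show "f = g" by simp
qed

lemma cls_span_mod_image:
  assumes "K \<subseteq> normal_words n" "M \<subseteq> H.F" "\<And>f. f \<in> M \<Longrightarrow> f \<in> span_mod n K" "{f. keys f \<subseteq> Word ` K} \<subseteq> M"
  shows "H.cls ` M = H.cls ` {f. keys f \<subseteq> Word ` K}"
proof
  show "H.cls ` M \<subseteq> H.cls ` {f. keys f \<subseteq> Word ` K}"
  proof
    fix a assume "a \<in> H.cls ` M"
    then obtain f where f: "a = H.cls f" "f \<in> M" by blast
    obtain g where g: "keys g \<subseteq> Word ` K" "f - g \<in> idl (nh_relators n)"
      using assms(3)[OF f(2)] by (auto simp: span_mod_def)
    have "keys g \<subseteq> Word ` normal_words n" using g(1) assms(1) by blast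
    then have "H.cls f = H.cls g" using H.cls_eq_iff[of f g] f(2) assms(2) NF_closed[of g] g(2) by blast
    then show "a \<in> H.cls ` {f. keys f \<subseteq> Word ` K}" using f g by blast
  qed
qed (use assms(4) in blast)

lemma NH_component_eq:
  "NH_component n d p = H.cls ` {f. keys f \<subseteq> Word ` normal_words_of n (d, p)}"
proof -
  let ?M = "{f :: nh_gen fpoly. f \<in> H.F \<and> (\<forall>w\<in>keys f. sum_list (map gen_deg (letters w)) = d \<and> of_nat (length (letters w)) = p)}"
  have "NH_component n d p = H.cls ` ?M" by (simp add: NH_component_def presented_component_def)
  also have "\<dots> = H.cls ` {f. keys f \<subseteq> Word ` normal_words_of n (d, p)}"
  proof (rule cls_span_mod_image)
    show "normal_words_of n (d, p) \<subseteq> normal_words n" by (auto simp: normal_words_of_def)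
    show "?M \<subseteq> H.F" by blast
    show "{f. keys f \<subseteq> Word ` normal_words_of n (d, p)} \<subseteq> ?M"
    proof
      fix f :: "nh_gen fpoly" assume "f \<in> {f. keys f \<subseteq> Word ` normal_words_of n (d, p)}"
      then have f: "keys f \<subseteq> Word ` normal_words_of n (d, p)" by simp
      then have "f \<in> H.F" by (intro NF_closed) (auto simp: normal_words_of_def)
      then show "f \<in> ?M" using f by (auto simp: normal_words_of_def bideg_def)
    qed
    fix f assume f: "f \<in> ?M"
    then have "keys f \<subseteq> {w. set (letters w) \<subseteq> nh_gens n \<and> bideg (letters w) = (d, p)}"
      by (auto simp: free_ring_def bideg_def)
    then show "f \<in> span_mod n (normal_words_of n (d, p))"
    proof (induction f rule: frag_induction)
      case zero
      show ?case by (rule span_mod_0)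
    next
      case (one x)
      then show ?case using spanning_word[OF n, of "letters x"] by simp
    next
      case (diff a b)
      then show ?case by (intro span_mod_diff)
    qed
  qed
  finally show ?thesis .
qed

lemma Word_normal_words_of: "{k \<in> Word ` normal_words n. bideg (letters k) = (d, p)} = Word ` normal_words_of n (d, p)"
  by (auto simp: normal_words_of_def)

lemma finite_normal_words_of: "finite {k \<in> Word ` normal_words n. bideg (letters k) = e}"
proof -
  obtain d p where e: "e = (d, p)" by (cases e)
  have "finite {w \<in> normal_words n. bideg w = (d, p)}"
    unfolding normal_words_of_eq[OF n] by (intro finite_UN_I[OF finite_NC_words] finite_imageI finite_x_words_deg)
  then show ?thesis unfolding e Word_normal_words_of by (simp add: normal_words_of_def)
qed

lemma NH_rank:
  "has_graded_rank (NH n) (NH_component n) ((\<Sum>u\<in>NC_words n. tq ^ length u) * fps_to_fls (xser n))"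
proof -
  interpret NF: normal_forms "NH n" H.cls "Word ` normal_words n"
  proof (rule normal_forms.intro)
    show "ring (NH n)" by (rule ring_NH[OF n])
    have "H.cls ` H.F = H.cls ` {f. keys f \<subseteq> Word ` normal_words n}"
      by (rule cls_span_mod_image) (use NF_closed spanning[OF n] in auto)
    then show "carrier (NH n) = H.cls ` {f. keys f \<subseteq> Word ` normal_words n}"
      using H.carrier_presented by (simp add: NH_def)
    show "inj_on H.cls {f. keys f \<subseteq> Word ` normal_words n}" by (rule cls_inj_NF)
    fix f g :: "nh_gen fpoly" assume "keys f \<subseteq> Word ` normal_words n" "keys g \<subseteq> Word ` normal_words n"
    then show "H.cls (f + g) = H.cls f \<oplus>\<^bsub>NH n\<^esub> H.cls g"
      using H.cls_add[unfolded NH_eq] NF_closed by blast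
  qed
  show ?thesis
  proof (rule NF.graded_rank[where dg = "\<lambda>k. bideg (letters k)"])
    show "NH_component n d p = H.cls ` {f. keys f \<subseteq> {k \<in> Word ` normal_words n. bideg (letters k) = (d, p)}}" for d p
      unfolding Word_normal_words_of by (rule NH_component_eq)
    show "finite {k \<in> Word ` normal_words n. bideg (letters k) = e}" for e by (rule finite_normal_words_of)
    show "lookup (fls_nth ((\<Sum>u\<in>NC_words n. tq ^ length u) * fps_to_fls (xser n)) d) p =
      int (card {k \<in> Word ` normal_words n. bideg (letters k) = (d, p)})" for d p
      by (simp only: lookup_sum_tq_xser[OF n] card_words[where Q = "\<lambda>w. bideg w = (d, p)"])
  qed
qed

lemma NC_words_letters: "u \<in> NC_words n \<Longrightarrow> set u \<subseteq> gens n 1"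
  using set_nc_words[of "n-1" n u] n by (auto simp: NC_words_def)

lemma gens_subset: "gens n 1 \<subseteq> nh_gens n"
  using nh_gens_cases[OF n] by blast

text \<open>
  The generated subring consists of the classes of all polynomials in the \<open>\<partial>\<close>'s, since those classes are
  closed under the ring operations.
\<close>

lemma NC_carrier: "carrier (NC n) = H.cls ` carrier (free_ring (gens n 1))"
proof -
  let ?G = "Del ` {1..n - 1} \<union> {DelD}"
  have G: "?G = gens n 1" using n by (auto simp: gens_def)
  have sub: "carrier (free_ring (gens n 1)) \<subseteq> H.F" using gens_subset by (auto simp: free_ring_def)
  have c: "carrier (NC n) = generate_ring (NH n) (nh_class n ` gens n 1)" unfolding NC_def G by simp
  have "h \<in> H.cls ` carrier (free_ring (gens n 1))" if "h \<in> generate_ring (NH n) (nh_class n ` gens n 1)" for h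
    using that
  proof (induction rule: generate_ring.induct)
    case one
    have "\<one>\<^bsub>NH n\<^esub> = H.cls 1" using H.cls_one by (simp add: NH_eq)
    then show ?case using free_ring_closed(2)[of "gens n 1"] by blast
  next
    case (incl h)
    then obtain x where "x \<in> gens n 1" "h = H.cls (fvar x)" by (auto simp: nh_class_def)
    then show ?case using fvar_in_free_ring[of x] by blast
  next
    case (a_inv h)
    then obtain f where f: "h = H.cls f" "f \<in> carrier (free_ring (gens n 1))" by blast
    then have "\<ominus>\<^bsub>NH n\<^esub> h = H.cls (- f)" using H.cls_uminus[of f] sub by (auto simp: NH_eq)
    then show ?case using free_ring_closed(5)[OF f(2)] by blast
  next
    case (eng_add h1 h2)
    then obtain f g where f: "h1 = H.cls f" "f \<in> carrier (free_ring (gens n 1))" "h2 = H.cls g" "g \<in> carrier (free_ring (gens n 1))" by blast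
    then have "h1 \<oplus>\<^bsub>NH n\<^esub> h2 = H.cls (f + g)" using H.cls_add[of f g] sub by (auto simp: NH_eq)
    then show ?case using free_ring_closed(3)[OF f(2,4)] by blast
  next
    case (eng_mult h1 h2)
    then obtain f g where f: "h1 = H.cls f" "f \<in> carrier (free_ring (gens n 1))" "h2 = H.cls g" "g \<in> carrier (free_ring (gens n 1))" by blast
    then have "h1 \<otimes>\<^bsub>NH n\<^esub> h2 = H.cls (f * g)" using H.cls_mult[of f g] sub by (auto simp: NH_eq)
    then show ?case using free_ring_closed(4)[OF f(2,4)] by blast
  qed
  moreover have "H.cls f \<in> generate_ring (NH n) (nh_class n ` gens n 1)" if "f \<in> carrier (free_ring (gens n 1))" for f
    using that
  proof (induction rule: free_ring_induct)
    case zero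
    then show ?case using ring.zero_in_generate[OF ring_NH[OF n]] by (simp add: H.cls_zero[unfolded NH_eq])
  next
    case (mon w)
    then show ?case
    proof (induction w)
      case Nil
      show ?case using generate_ring.one[of "NH n"] by (simp add: mon_Nil H.cls_one[unfolded NH_eq])
    next
      case (Cons g w)
      then have g: "g \<in> gens n 1" "g \<in> nh_gens n" and w: "mon w \<in> H.F" using gens_subset by (auto simp: mon_in_free_ring)
      have eq: "H.cls (mon (g # w)) = nh_class n g \<otimes>\<^bsub>NH n\<^esub> H.cls (mon w)"
        using H.cls_mult[unfolded NH_eq, OF fvar_in_free_ring[OF g(2)] w] by (simp add: mon_Cons nh_class_def)
      show ?case unfolding eq
        by (rule generate_ring.eng_mult) (use Cons g in \<open>auto intro: generate_ring.incl\<close>)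
    qed
  next
    case (diff f g)
    have fg: "f \<in> H.F" "- g \<in> H.F" "g \<in> H.F" using diff(1,2) sub by (auto intro: free_ring_closed)
    have "H.cls (f - g) = H.cls f \<oplus>\<^bsub>NH n\<^esub> (\<ominus>\<^bsub>NH n\<^esub> H.cls g)"
      using H.cls_add[OF fg(1,2), unfolded NH_eq] H.cls_uminus[OF fg(3), unfolded NH_eq] by simp
    then show ?case using diff(3,4) by (simp add: generate_ring.eng_add generate_ring.a_inv)
  qed
  ultimately show ?thesis unfolding c by blast
qed

lemma NC_carrier_NF: "carrier (NC n) = H.cls ` {f. keys f \<subseteq> Word ` NC_words n}"
  unfolding NC_carrier
proof (rule cls_span_mod_image)
  show "NC_words n \<subseteq> normal_words n" by (rule NC_words_subset_normal_words)
  show "carrier (free_ring (gens n 1)) \<subseteq> H.F" using gens_subset by (auto simp: free_ring_def)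
  show "{f. keys f \<subseteq> Word ` NC_words n} \<subseteq> carrier (free_ring (gens n 1))"
    using NC_words_letters by (fastforce simp: free_ring_def)
  fix f assume "f \<in> carrier (free_ring (gens n 1))"
  then show "f \<in> span_mod n (NC_words n)"
  proof (induction rule: free_ring_induct)
    case (mon w)
    have "mon [] \<in> span_mod n (NC_words n)" by (rule span_mod_mon) (simp add: NC_words_def Nil_in_nc_words)
    then show ?case using spanning_NC_word[OF n mon, of "mon []"] by (simp add: mon_Nil)
  qed (auto intro: span_mod_0 span_mod_diff)
qed

lemma NC_rank: "has_graded_rank (NC n) (NC_component n) (\<Sum>u\<in>NC_words n. tq ^ length u)"
proof -
  have sub: "Word ` NC_words n \<subseteq> Word ` normal_words n" using NC_words_subset_normal_words by blast
  interpret NF: normal_forms "NC n" H.cls "Word ` NC_words n"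
  proof (rule normal_forms.intro)
    show "ring (NC n)" by (rule ring_NC[OF n])
    show "carrier (NC n) = H.cls ` {f. keys f \<subseteq> Word ` NC_words n}" by (rule NC_carrier_NF)
    show "inj_on H.cls {f. keys f \<subseteq> Word ` NC_words n}"
      by (rule inj_on_subset[OF cls_inj_NF]) (use sub in auto)
    fix f g :: "nh_gen fpoly" assume "keys f \<subseteq> Word ` NC_words n" "keys g \<subseteq> Word ` NC_words n"
    then have "f \<in> H.F" "g \<in> H.F" using NF_closed[OF order_trans[OF _ sub]] by blast+
    then show "H.cls (f + g) = H.cls f \<oplus>\<^bsub>NC n\<^esub> H.cls g"
      using H.cls_add[unfolded NH_eq] by (simp add: NC_def)
  qed
  show ?thesis
  proof (rule NF.graded_rank[where dg = "\<lambda>k. bideg (letters k)"])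
    fix d p
    let ?K = "{k \<in> Word ` NC_words n. bideg (letters k) = (d, p)}"
    have K: "?K = Word ` NC_words n \<inter> Word ` normal_words_of n (d, p)" by (auto simp: normal_words_of_def subsetD[OF NC_words_subset_normal_words])
    let ?C = "{f :: nh_gen fpoly. keys f \<subseteq> Word ` normal_words_of n (d, p)}"
    let ?D = "{f :: nh_gen fpoly. keys f \<subseteq> Word ` NC_words n}"
    have CD: "{f. keys f \<subseteq> ?K} = ?C \<inter> ?D" unfolding K by blast
    have "Word ` normal_words_of n (d, p) \<subseteq> Word ` normal_words n" by (auto simp: normal_words_of_def)
    then have "?C \<subseteq> {f. keys f \<subseteq> Word ` normal_words n}" by blast
    moreover have "?D \<subseteq> {f. keys f \<subseteq> Word ` normal_words n}" using sub by blast
    ultimately show "NC_component n d p = H.cls ` {f. keys f \<subseteq> ?K}"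
      unfolding CD NC_component_def NH_component_eq NC_carrier_NF
      by (rule inj_on_image_Int[OF cls_inj_NF, symmetric])
    show "finite {k \<in> Word ` NC_words n. bideg (letters k) = e}" for e using finite_NC_words by simp
    show "lookup (fls_nth (\<Sum>u\<in>NC_words n. tq ^ length u) d) p =
      int (card {k \<in> Word ` NC_words n. bideg (letters k) = (d, p)})"
      by (simp only: lookup_sum_tq[OF n] card_words[where Q = "\<lambda>w. bideg w = (d, p)"])
  qed
qed

end

theorem corollary4p10:
  fixes n :: nat
  assumes "n \<ge> 2"
  shows "((\<exists>act. NH_action n act) \<and>
          (\<forall>act. NH_action n act \<longrightarrow> faithful_action (NH n) (Pol n) act)) \<and>
         has_graded_rank (NC n) (NC_component n)
           (unit_inv (\<pi> * qv) ^ (n * (n - 1)) * qint n * qdfact (n - 1)) \<and>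
         has_graded_rank (NH n) (NH_component n)
           (unit_inv (\<pi> * qv) ^ (n * (n - 1)) * qint n * qdfact (n - 1)
              * unit_inv ((1 - \<pi> * qv\<^sup>2) ^ n))"
proof -
  obtain m where m: "n = Suc m" using assms by (cases n) auto
  have "unit_inv (\<pi> * qv) ^ (n * (n - 1)) * qint n * qdfact (n - 1) = (\<Sum>u\<in>NC_words n. tq ^ length u)"
    unfolding NC_words_def m diff_Suc_1 rank_formula_eq by (rule sum_nc_words[symmetric]) simp
  then show ?thesis
    using NH_action_nh_act[OF assms] faithful[OF assms] NC_rank[OF assms] NH_rank[OF assms]
    unfolding unit_inv_xser by auto
qed

end
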